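(* Let $d\ge1$ and let $V:\mathbb{R}^d\to\mathbb{C}$ satisfy (A1), (A2), (A3) and (C1), and let $H=-\Delta+V$. If $\lambda\in\partial\operatorname{Num}(H)\cap\operatorname{Num}(H)$, then the upper curvature $\gamma_u(\lambda)$ of $\partial\overline{\operatorname{Num}}(H)$ at $\lambda$ is finite. In particular, if $\partial\operatorname{Num}(H)$ has a point of infinite upper curvature, then $\operatorname{Num}(H)$ is not closed.
   Context: (A1): $V\in L^1_{loc}(\mathbb{R}^d)$ and the sesquilinear form $\mathcal{E}(f,g)=\langle\nabla f,\nabla g\rangle+\int V f\bar g\,dx$ on $\operatorname{D}(\mathcal{E})=H^1(\mathbb{R}^d)\cap\{f\in L^2: V|f|^2\in L^1\}$ is closed and sectorial; $H=-\Delta+V$ denotes the $m$-sectorial operator in $L^2(\mathbb{R}^d)$ associated with $\mathcal{E}$ by the first representation theorem. (A2): $\operatorname{D}(H)\subset\{f\in L^2(\mathbb{R}^d):\operatorname{Im}(V)f\in L^2\}$. (A3): $\operatorname{Re}(V)\in L^p_{loc}(\mathbb{R}^d)$ with $p=d/2$ if $d\ge3$ and some $p>1$ if $d=2$ (no condition if $d=1$). (C1): there exist $x_1\neq x_2$ in $\mathbb{R}^d$ at which $\operatorname{Im}V$ is continuous with $\operatorname{Im}V(x_1)\neq\operatorname{Im}V(x_2)$. $\operatorname{Num}(H)=\{\langle Hf,f\rangle:f\in\operatorname{D}(H),\|f\|=1\}$. Curvature conventions. Let $\Omega\subset\mathbb{C}$ be a closed convex set with nonempty interior and $\lambda\in\partial\Omega$.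 There is at least one supporting line of $\Omega$ through $\lambda$; $\lambda$ is called a corner point if there is more than one. If $\lambda$ is a corner point, $\Omega$ lies in a closed sector with vertex $\lambda$ and semivertical angle $<\pi/2$; take the smallest such sector and let $l_\lambda$ be the supporting line through $\lambda$ orthogonal to the axis of this sector; otherwise $l_\lambda$ is the unique supporting line. Use rectangular coordinates $(\xi,\eta)$ with origin at $\lambda$, $\xi$-axis equal to $l_\lambda$, oriented so that $\Omega\subset\{\eta\ge 0\}$. Let $D'_\varepsilon=\{(\xi,\eta):\xi^2+\eta^2\le\varepsilon^2,\ \xi\neq 0\}$. Define $\gamma_u^+(\lambda)=\lim_{\varepsilon\downarrow 0}\sup\{\eta/\xi^2:(\xi,\eta)\in\partial\Omega\cap D'_\varepsilon,\ \xi>0\}$ and $\gamma_l^+(\lambda)$ the same with $\inf$ in place of $\sup$; $\gamma_u^-(\lambda),\gamma_l^-(\lambda)$ are defined analogously with $\xi<0$. Set $\gamma_u(\lambda)=\max(\gamma_u^+(\lambda),\gamma_u^-(\lambda))$, $\gamma_l(\lambda)=\min(\gamma_l^+(\lambda),\gamma_l^-(\lambda))$. The point $\lambda$ is of infinite upper curvature if $\gamma_u(\lambda)=\infty$, and of unilateral infinite curvature if $\gamma_l^+(\lambda)=\infty$ or $\gamma_l^-(\lambda)=\infty$. For an operator $A$, these notions at $\lambda\in\partial\operatorname{Num}(A)$ refer to $\Omega=\overline{\operatorname{Num}}(A)$. *)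

theory Defs
  imports "HOL-Analysis.Analysis"
begin

text \<open>Smooth (C-infinity) complex-valued functions: differentiable everywhere, and all
  partial derivatives are again smooth (coinductive = infinitely often).\<close>
coinductive smooth_fun :: "('a::euclidean_space \<Rightarrow> complex) \<Rightarrow> bool" where
  "(\<forall>x. f differentiable (at x)) \<Longrightarrow>
   (\<forall>b\<in>Basis. smooth_fun (\<lambda>x. frechet_derivative f (at x) b)) \<Longrightarrow> smooth_fun f"

definition pderiv_cl :: "('a::euclidean_space \<Rightarrow> complex) \<Rightarrow> 'a \<Rightarrow> 'a \<Rightarrow> complex" where
  "pderiv_cl f b x = frechet_derivative f (at x) b"

definition test_fun :: "('a::euclidean_space \<Rightarrow> complex) \<Rightarrow> bool" where
  "test_fun \<phi> \<longleftrightarrow> smooth_fun \<phi> \<and> compact (closure {x. \<phi> x \<noteq> 0})"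

definition loc_integrable :: "('a::euclidean_space \<Rightarrow> complex) \<Rightarrow> bool" where
  "loc_integrable f \<longleftrightarrow> f \<in> borel_measurable lebesgue \<and>
     (\<forall>K. compact K \<longrightarrow> set_integrable lebesgue K f)"

definition Lp_loc :: "real \<Rightarrow> ('a::euclidean_space \<Rightarrow> real) \<Rightarrow> bool" where
  "Lp_loc p f \<longleftrightarrow> f \<in> borel_measurable lebesgue \<and>
     (\<forall>K. compact K \<longrightarrow> set_integrable lebesgue K (\<lambda>x. \<bar>f x\<bar> powr p))"

definition L2 :: "('a::euclidean_space \<Rightarrow> complex) \<Rightarrow> bool" where
  "L2 f \<longleftrightarrow> f \<in> borel_measurable lebesgue \<and> integrable lebesgue (\<lambda>x. (cmod (f x))\<^sup>2)"

definition L2_inner :: "('a::euclidean_space \<Rightarrow> complex) \<Rightarrow> ('a \<Rightarrow> complex) \<Rightarrow> complex" where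
  "L2_inner f g = (LINT x|lebesgue. f x * cnj (g x))"

definition L2_norm :: "('a::euclidean_space \<Rightarrow> complex) \<Rightarrow> real" where
  "L2_norm f = sqrt (LINT x|lebesgue. (cmod (f x))\<^sup>2)"

definition is_weak_pderiv :: "('a::euclidean_space \<Rightarrow> complex) \<Rightarrow> 'a \<Rightarrow> ('a \<Rightarrow> complex) \<Rightarrow> bool" where
  "is_weak_pderiv f b g \<longleftrightarrow> loc_integrable f \<and> loc_integrable g \<and>
     (\<forall>\<phi>. test_fun \<phi> \<longrightarrow>
        (LINT x|lebesgue. f x * pderiv_cl \<phi> b x) = - (LINT x|lebesgue. g x * \<phi> x))"

definition weak_pderiv :: "('a::euclidean_space \<Rightarrow> complex) \<Rightarrow> 'a \<Rightarrow> 'a \<Rightarrow> complex" where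
  "weak_pderiv f b = (SOME g. is_weak_pderiv f b g)"

definition H1 :: "('a::euclidean_space \<Rightarrow> complex) set" where
  "H1 = {f. L2 f \<and> (\<forall>b\<in>Basis. \<exists>g. is_weak_pderiv f b g \<and> L2 g)}"

definition form_dom :: "('a::euclidean_space \<Rightarrow> complex) \<Rightarrow> ('a \<Rightarrow> complex) set" where
  "form_dom V = H1 \<inter> {f. L2 f \<and> integrable lebesgue (\<lambda>x. V x * (cmod (f x))\<^sup>2)}"

definition form_E :: "('a::euclidean_space \<Rightarrow> complex) \<Rightarrow> ('a \<Rightarrow> complex) \<Rightarrow> ('a \<Rightarrow> complex) \<Rightarrow> complex" where
  "form_E V f g = (\<Sum>b\<in>Basis. L2_inner (weak_pderiv f b) (weak_pderiv g b))
                  + (LINT x|lebesgue. V x * f x * cnj (g x))"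

definition sectorial_form :: "('a::euclidean_space \<Rightarrow> complex) \<Rightarrow> bool" where
  "sectorial_form V \<longleftrightarrow> (\<exists>\<gamma>::real. \<exists>\<theta>. 0 \<le> \<theta> \<and> \<theta> < pi/2 \<and>
     (\<forall>f\<in>form_dom V. L2_norm f = 1 \<longrightarrow>
        \<bar>Im (form_E V f f)\<bar> \<le> tan \<theta> * (Re (form_E V f f) - \<gamma>)))"

definition closed_form :: "('a::euclidean_space \<Rightarrow> complex) \<Rightarrow> bool" where
  "closed_form V \<longleftrightarrow> (\<forall>fs f. (\<forall>n. fs n \<in> form_dom V) \<longrightarrow> L2 f \<longrightarrow>
     (\<lambda>n. L2_norm (\<lambda>x. fs n x - f x)) \<longlonglongrightarrow> 0 \<longrightarrow>
     (\<forall>e>0. \<exists>N. \<forall>n\<ge>N. \<forall>m\<ge>N. cmod (form_E V (\<lambda>x. fs n x - fs m x) (\<lambda>x. fs n x - fs m x)) < e) \<longrightarrow>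
     f \<in> form_dom V \<and> (\<lambda>n. form_E V (\<lambda>x. fs n x - f x) (\<lambda>x. fs n x - f x)) \<longlonglongrightarrow> 0)"

text \<open>Operator associated with E by the first representation theorem.\<close>
definition op_dom :: "('a::euclidean_space \<Rightarrow> complex) \<Rightarrow> ('a \<Rightarrow> complex) set" where
  "op_dom V = {f\<in>form_dom V. \<exists>h. L2 h \<and> (\<forall>g\<in>form_dom V. form_E V f g = L2_inner h g)}"

definition op_H :: "('a::euclidean_space \<Rightarrow> complex) \<Rightarrow> ('a \<Rightarrow> complex) \<Rightarrow> ('a \<Rightarrow> complex)" where
  "op_H V f = (SOME h. L2 h \<and> (\<forall>g\<in>form_dom V. form_E V f g = L2_inner h g))"

definition Num :: "('a::euclidean_space \<Rightarrow> complex) \<Rightarrow> complex set" where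
  "Num V = {L2_inner (op_H V f) f | f. f \<in> op_dom V \<and> L2_norm f = 1}"

definition A1 :: "('a::euclidean_space \<Rightarrow> complex) \<Rightarrow> bool" where
  "A1 V \<longleftrightarrow> loc_integrable V \<and> closed_form V \<and> sectorial_form V"

definition A2 :: "('a::euclidean_space \<Rightarrow> complex) \<Rightarrow> bool" where
  "A2 V \<longleftrightarrow> op_dom V \<subseteq> {f. L2 f \<and> L2 (\<lambda>x. complex_of_real (Im (V x)) * f x)}"

definition A3 :: "('a::euclidean_space \<Rightarrow> complex) \<Rightarrow> bool" where
  "A3 V \<longleftrightarrow>
     (if DIM('a) \<ge> 3 then Lp_loc (real DIM('a) / 2) (\<lambda>x. Re (V x))
      else if DIM('a) = 2 then (\<exists>p>1. Lp_loc p (\<lambda>x. Re (V x)))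
      else True)"

definition C1 :: "('a::euclidean_space \<Rightarrow> complex) \<Rightarrow> bool" where
  "C1 V \<longleftrightarrow> (\<exists>x1 x2. x1 \<noteq> x2 \<and> isCont (\<lambda>x. Im (V x)) x1 \<and> isCont (\<lambda>x. Im (V x)) x2
      \<and> Im (V x1) \<noteq> Im (V x2))"

definition supp_normals :: "complex set \<Rightarrow> complex \<Rightarrow> complex set" where
  "supp_normals \<Omega> lam = {n. cmod n = 1 \<and> (\<forall>z\<in>\<Omega>. Re ((z - lam) * cnj n) \<ge> 0)}"

definition corner_point :: "complex set \<Rightarrow> complex \<Rightarrow> bool" where
  "corner_point \<Omega> lam \<longleftrightarrow> (\<exists>n1 n2. n1 \<in> supp_normals \<Omega> lam \<and> n2 \<in> supp_normals \<Omega> lam \<and> n1 \<noteq> n2)"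

definition sector :: "complex \<Rightarrow> complex \<Rightarrow> real \<Rightarrow> complex set" where
  "sector lam a \<alpha> = {z. Re ((z - lam) * cnj a) \<ge> cmod (z - lam) * cos \<alpha>}"

definition smallest_sector :: "complex set \<Rightarrow> complex \<Rightarrow> complex \<Rightarrow> real \<Rightarrow> bool" where
  "smallest_sector \<Omega> lam a \<alpha> \<longleftrightarrow> cmod a = 1 \<and> 0 \<le> \<alpha> \<and> \<alpha> < pi/2 \<and> \<Omega> \<subseteq> sector lam a \<alpha> \<and>
     (\<forall>a' \<alpha>'. cmod a' = 1 \<and> 0 \<le> \<alpha>' \<and> \<alpha>' < pi/2 \<and> \<Omega> \<subseteq> sector lam a' \<alpha>' \<longrightarrow>
        sector lam a \<alpha> \<subseteq> sector lam a' \<alpha>')"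

text \<open>Unit normal of the distinguished supporting line l_lam, pointing into Omega
  (the eta-direction).\<close>
definition l_normal :: "complex set \<Rightarrow> complex \<Rightarrow> complex" where
  "l_normal \<Omega> lam = (if corner_point \<Omega> lam
      then (THE a. \<exists>\<alpha>. smallest_sector \<Omega> lam a \<alpha>)
      else (THE n. n \<in> supp_normals \<Omega> lam))"

definition xi_coord :: "complex set \<Rightarrow> complex \<Rightarrow> complex \<Rightarrow> real" where
  "xi_coord \<Omega> lam z = Re ((z - lam) * cnj (- \<i> * l_normal \<Omega> lam))"

definition eta_coord :: "complex set \<Rightarrow> complex \<Rightarrow> complex \<Rightarrow> real" where
  "eta_coord \<Omega> lam z = Re ((z - lam) * cnj (l_normal \<Omega> lam))"

definition gamma_u_plus :: "complex set \<Rightarrow> complex \<Rightarrow> ereal" where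
  "gamma_u_plus \<Omega> lam = Lim (at_right (0::real)) (\<lambda>\<epsilon>.
     SUP z\<in>{z\<in>frontier \<Omega>. cmod (z - lam) \<le> \<epsilon> \<and> xi_coord \<Omega> lam z > 0}.
        ereal (eta_coord \<Omega> lam z / (xi_coord \<Omega> lam z)\<^sup>2))"

definition gamma_u_minus :: "complex set \<Rightarrow> complex \<Rightarrow> ereal" where
  "gamma_u_minus \<Omega> lam = Lim (at_right (0::real)) (\<lambda>\<epsilon>.
     SUP z\<in>{z\<in>frontier \<Omega>. cmod (z - lam) \<le> \<epsilon> \<and> xi_coord \<Omega> lam z < 0}.
        ereal (eta_coord \<Omega> lam z / (xi_coord \<Omega> lam z)\<^sup>2))"

definition gamma_u :: "complex set \<Rightarrow> complex \<Rightarrow> ereal" where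
  "gamma_u \<Omega> lam = max (gamma_u_plus \<Omega> lam) (gamma_u_minus \<Omega> lam)"

end

(* Let lambda = E(f) with f a unit vector in the operator domain, and suppose that gamma_u(lambda)
   is infinite.  Any curve lambda + t c + O(t^2) with c nonzero inside the closed numerical range
   bounds the curvature at lambda, so the first variation of E must vanish at every unit form vector u
   with E(u) = lambda; hence E(u,h) = lambda <u,h> for all h in the form domain.

   The unique continuation theorem is avoided by taking u = |f|.  Since E(|f|) = lambda - s with
   s >= 0, and since multiplication by exp(+-ikx) shows that the numerical range contains lambda + k^2,
   s > 0 would make the boundary flat at lambda; so s = 0 and |f| is an eigenfunction.  Taking imaginary
   parts, (Im V - Im lambda)|f| = 0, so |f| vanishes on a ball by (C1).  The equation tested with
   phi^2/(|f| + eps) bounds the local energy of log(|f| + eps) uniformly in eps, which spreads the zeros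
   of |f| from the ball to the whole space. *)

theory Submission
  imports Defs "HOL-Library.Function_Algebras"
begin

text \<open>The modulus |f| and the modulated functions need not lie in the operator domain, so the
  argument runs on the numerical range of the form on its full domain; approximation by the operator
  domain keeps it inside the closure of \<open>Num V\<close>. Passing to |f| leaves V|f|^2 and the
  norm unchanged and can only lower the gradient energy, so s is real and the segment from lambda -
  s to lambda + 1 is horizontal. Functions are not identified almost everywhere and
  \<open>weak_pderiv\<close> is a choice, so gradients enter as limits of difference quotients:
  moduli, phases and quotients are estimated pointwise on differences, where Picone's identity is
  exact. For a locally integrable potential the decisive bound is v phi^2 / (v + eps) <= phi^2: it
  controls the potential term by the integral of |V| phi^2, uniformly in eps. Where v vanishes at x
  but not at x + H b, ln (v + eps) differs at the two points by an amount that is unbounded as eps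
  tends to 0; bounded energy allows this only on a null set.\<close>

section \<open>Sesquilinear forms on complex subspaces\<close>

text \<open>Minimising a functional that satisfies a parallelogram law (\<open>\<delta>\<close> plays the role of the
  squared distance) over decreasing midpoint-convex sets. For constant \<open>C\<close> this is the projection
  theorem; for shrinking \<open>C\<close> it replaces weak compactness (Mazur's lemma).\<close>
lemma minimising_sequence_Cauchy:
  fixes J :: "'v \<Rightarrow> real" and C :: "nat \<Rightarrow> 'v set" and \<delta> :: "'v \<Rightarrow> 'v \<Rightarrow> real"
  assumes decr: "\<And>m n. m \<le> n \<Longrightarrow> C n \<subseteq> C m"
    and below: "\<And>n x. x \<in> C n \<Longrightarrow> L \<le> J x"
    and above: "\<And>n. \<exists>x\<in>C n. J x \<le> B"
    and mid: "\<And>n x y. x \<in> C n \<Longrightarrow> y \<in> C n \<Longrightarrow> mid x y \<in> C n"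
    and para: "\<And>n x y. x \<in> C n \<Longrightarrow> y \<in> C n \<Longrightarrow> \<delta> x y = 2 * J x + 2 * J y - 4 * J (mid x y)"
  obtains y where "\<And>n. y n \<in> C n" "\<And>n x. x \<in> C n \<Longrightarrow> J (y n) \<le> J x + 1 / real (Suc n)"
    "\<And>e. e > 0 \<Longrightarrow> \<exists>N. \<forall>m\<ge>N. \<forall>n\<ge>N. \<delta> (y m) (y n) < e"
proof -
  define d where "d n = Inf (J ` C n)" for n
  have ne: "C n \<noteq> {}" for n using above[of n] by auto
  have bdd: "bdd_below (J ` C n)" for n using below by (auto simp: bdd_below_def)
  have d_le: "d n \<le> J x" if "x \<in> C n" for n x
    unfolding d_def using bdd that by (simp add: cInf_lower)
  have "\<exists>x\<in>C n. J x < d n + 1 / real (Suc n)" for n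
    using cInf_lessD[of "J ` C n" "d n + 1 / real (Suc n)"] ne unfolding d_def by auto
  then obtain y where y: "\<And>n. y n \<in> C n" "\<And>n. J (y n) < d n + 1 / real (Suc n)" by metis
  have incd: "incseq d"
    unfolding incseq_def d_def using decr bdd ne by (auto intro!: cInf_superset_mono)
  have dB: "d n \<le> B" for n using above[of n] d_le[of _ n] by force
  obtain l where l: "d \<longlonglongrightarrow> l"
    using incseq_convergent[OF incd] dB by (metis (no_types))
  have inv: "(\<lambda>n. 1 / real (Suc n)) \<longlonglongrightarrow> 0" by (rule LIMSEQ_Suc[OF lim_1_over_n])
  \<comment> \<open>For m, n >= N the midpoint lies in \<open>C N\<close>, so its value is at least
    \<open>d N\<close>; the parallelogram law turns this into a bound on \<delta>.\<close>
  have key: "\<delta> (y m) (y n) \<le> 2 * (d m - l) + 2 * (d n - l) + 2 * (1 / real (Suc m)) + 2 * (1 / real (Suc n)) + 4 * (l - d N)"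
    if "m \<ge> N" "n \<ge> N" for m n N
  proof -
    have in': "y m \<in> C N" "y n \<in> C N" using y(1) decr that by blast+
    have "d N \<le> J (mid (y m) (y n))" using d_le mid in' by blast
    moreover have "\<delta> (y m) (y n) = 2 * J (y m) + 2 * J (y n) - 4 * J (mid (y m) (y n))" using para in' by blast
    ultimately show ?thesis using y(2)[of m] y(2)[of n] by argo
  qed
  show thesis
  proof (rule that)
    show "y n \<in> C n" for n by (rule y)
    show "J (y n) \<le> J x + 1 / real (Suc n)" if "x \<in> C n" for n x using y(2)[of n] d_le[OF that] by simp
    fix e :: real assume e: "e > 0"
    \<comment> \<open>The coefficients 2, 2, 2, 2 and 4 in \<open>key\<close> leave a total below 12
      e / 20.\<close>
    have "eventually (\<lambda>n. \<bar>d n - l\<bar> < e / 20 \<and> 1 / real (Suc n) < e / 20) sequentially"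
      using tendstoD[OF l, of "e/20"] order_tendstoD(2)[OF inv, of "e/20"] e
      by (simp add: dist_real_def eventually_conj_iff)
    then obtain N where N: "\<And>n. n \<ge> N \<Longrightarrow> \<bar>d n - l\<bar> < e / 20 \<and> 1 / real (Suc n) < e / 20"
      by (auto simp: eventually_sequentially)
    show "\<exists>N. \<forall>m\<ge>N. \<forall>n\<ge>N. \<delta> (y m) (y n) < e"
    proof (intro exI allI impI)
      fix m n assume mn: "N \<le> m" "N \<le> n"
      show "\<delta> (y m) (y n) < e"
        using key[OF mn] N[OF mn(1)] N[OF mn(2)] N[OF order_refl] e unfolding abs_less_iff by argo
    qed
  qed
qed

text \<open>L2, H1, the form domain and the operator domain are sets of functions inside one type,
  so scaling is a parameter and closure is assumed on D. Functions equal almost everywhere stay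
  distinct, which is why the forms below are only positive semidefinite. \<open>scl_neg\<close> ties
  scaling to the group and gives closure under subtraction.\<close>

locale cspace =
  fixes D :: "'v::ab_group_add set" and scl :: "complex \<Rightarrow> 'v \<Rightarrow> 'v"
  assumes D_add: "x \<in> D \<Longrightarrow> y \<in> D \<Longrightarrow> x + y \<in> D"
    and D_scl: "x \<in> D \<Longrightarrow> scl c x \<in> D"
    and scl_neg: "scl (-1) x = - x"
begin

definition sesq :: "('v \<Rightarrow> 'v \<Rightarrow> complex) \<Rightarrow> bool" where
  "sesq a \<longleftrightarrow> (\<forall>x\<in>D. \<forall>y\<in>D. \<forall>z\<in>D. a (x + y) z = a x z + a y z \<and> a x (y + z) = a x y + a x z)
     \<and> (\<forall>x\<in>D. \<forall>y\<in>D. \<forall>c. a (scl c x) y = c * a x y \<and> a x (scl c y) = cnj c * a x y)"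

definition psd :: "('v \<Rightarrow> 'v \<Rightarrow> complex) \<Rightarrow> bool" where
  "psd q \<longleftrightarrow> sesq q \<and> (\<forall>x\<in>D. \<forall>y\<in>D. q y x = cnj (q x y)) \<and> (\<forall>x\<in>D. 0 \<le> Re (q x x))"

definition nrm :: "('v \<Rightarrow> 'v \<Rightarrow> complex) \<Rightarrow> 'v \<Rightarrow> real" where "nrm q x = sqrt (Re (q x x))"

lemma D_minus: "x \<in> D \<Longrightarrow> - x \<in> D" using D_scl[of x "-1"] by (simp add: scl_neg)

lemma D_diff: "x \<in> D \<Longrightarrow> y \<in> D \<Longrightarrow> x - y \<in> D"
  using D_add[of x "-y"] D_minus by simp

lemma sesq_simps:
  assumes "sesq a" "x \<in> D" "y \<in> D"
  shows "z \<in> D \<Longrightarrow> a (x + y) z = a x z + a y z" "z \<in> D \<Longrightarrow> a z (x + y) = a z x + a z y"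
    "a (scl c x) y = c * a x y" "a x (scl c y) = cnj c * a x y"
    "a (- x) y = - a x y" "a x (- y) = - a x y"
    "z \<in> D \<Longrightarrow> a (x - y) z = a x z - a y z" "z \<in> D \<Longrightarrow> a z (x - y) = a z x - a z y"
proof -
  have *: "a (x + y) z = a x z + a y z" "a z (x + y) = a z x + a z y"
    "a (scl c x) y = c * a x y" "a x (scl c y) = cnj c * a x y"
    if "x \<in> D" "y \<in> D" "z \<in> D" for x y z c using assms(1) that by (auto simp: sesq_def)
  have **: "a (- x) y = - a x y" "a x (- y) = - a x y" if "x \<in> D" "y \<in> D" for x y
    using *(3)[OF that that(2), of "-1"] *(4)[OF that that(2), of "-1"] by (simp_all add: scl_neg)
  note [simp] = assms(2,3)
  show "z \<in> D \<Longrightarrow> a (x + y) z = a x z + a y z" "z \<in> D \<Longrightarrow> a z (x + y) = a z x + a z y"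
    "a (scl c x) y = c * a x y" "a x (scl c y) = cnj c * a x y"
    "a (- x) y = - a x y" "a x (- y) = - a x y" using * ** *(3,4)[OF assms(2,3,3)] by simp_all
  show "z \<in> D \<Longrightarrow> a (x - y) z = a x z - a y z" "z \<in> D \<Longrightarrow> a z (x - y) = a z x - a z y"
    using *(1)[of x "-y" z] *(2)[of x "-y" z] **(2)[of z y] **(1)[of y z] D_minus[of y] by auto
qed

lemma psdD:
  assumes "psd q"
  shows "sesq q" "x \<in> D \<Longrightarrow> y \<in> D \<Longrightarrow> q y x = cnj (q x y)" "x \<in> D \<Longrightarrow> 0 \<le> Re (q x x)"
    "x \<in> D \<Longrightarrow> q x x = complex_of_real (Re (q x x))"
proof -
  show *: "sesq q" "x \<in> D \<Longrightarrow> y \<in> D \<Longrightarrow> q y x = cnj (q x y)" "x \<in> D \<Longrightarrow> 0 \<le> Re (q x x)" for x y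
    using assms unfolding psd_def by blast+
  show "x \<in> D \<Longrightarrow> q x x = complex_of_real (Re (q x x))"
    using arg_cong[OF *(2)[of x x], of Im] by (simp add: complex_eq_iff)
qed

lemma nrm_sq: "psd q \<Longrightarrow> x \<in> D \<Longrightarrow> (nrm q x)\<^sup>2 = Re (q x x)"
  using psdD(3) by (simp add: nrm_def)

lemma nrm_nonneg: "psd q \<Longrightarrow> x \<in> D \<Longrightarrow> 0 \<le> nrm q x"
  using psdD(3) by (simp add: nrm_def)

lemma sesq_parallelogram:
  assumes "sesq a" "x \<in> D" "y \<in> D"
  shows "a (x + y) (x + y) + a (x - y) (x - y) = 2 * a x x + 2 * a y y"
  using assms by (simp add: sesq_simps D_add D_diff algebra_simps)

lemma sesq_perturb:
  assumes "sesq a" "x \<in> D" "y \<in> D"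
  shows "a (x + scl c y) (x + scl c y) = a x x + cnj c * a x y + c * a y x + c * cnj c * a y y"
  using assms by (simp add: sesq_simps D_add D_scl algebra_simps)

text \<open>This is hypothesis \<open>para\<close> of \<open>minimising_sequence_Cauchy\<close> for
  the functional Re q(x, x).\<close>

lemma sesq_midpoint:
  assumes q: "sesq q" and xy: "x \<in> D" "y \<in> D"
  shows "Re (q (x - y) (x - y)) = 2 * Re (q x x) + 2 * Re (q y y) - 4 * Re (q (scl (1/2) (x + y)) (scl (1/2) (x + y)))"
  using arg_cong[OF sesq_parallelogram[OF q xy], of Re] D_add[OF xy]
  by (simp add: sesq_simps(3,4)[OF q] D_scl)

lemma sesq_polarisation:
  assumes a: "sesq a" and "x \<in> D" "y \<in> D"
  shows "4 * a x y = a (x + scl 1 y) (x + scl 1 y) - a (x + scl (-1) y) (x + scl (-1) y)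
     + \<i> * a (x + scl \<i> y) (x + scl \<i> y) - \<i> * a (x + scl (-\<i>) y) (x + scl (-\<i>) y)"
  unfolding sesq_perturb[OF assms] by (simp add: algebra_simps)

lemma Cauchy_Schwarz:
  assumes q: "psd q" and x: "x \<in> D" and y: "y \<in> D"
  shows "cmod (q x y) \<le> nrm q x * nrm q y"
proof -
  define w A B where "w = q x y" and "A = Re (q x x)" and "B = Re (q y y)"
  have AB: "0 \<le> A" "0 \<le> B" using psdD(3)[OF q x] psdD(3)[OF q y] by (auto simp: A_def B_def)
  \<comment> \<open>Subtracting r w y from x makes both cross terms real, equal to -r |w|^2
    each.\<close>
  have key: "0 \<le> A - 2 * r * (cmod w)\<^sup>2 + r\<^sup>2 * (cmod w)\<^sup>2 * B" for r :: real
  proof -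
    let ?c = "- (complex_of_real r * w)"
    have "q (x + scl ?c y) (x + scl ?c y) = q x x + cnj ?c * w + ?c * cnj w + ?c * cnj ?c * q y y"
      using sesq_perturb[OF psdD(1)[OF q] x y, of ?c] psdD(2)[OF q x y] by (simp add: w_def)
    then have "Re (q (x + scl ?c y) (x + scl ?c y))
      = Re (q x x + cnj ?c * w + ?c * cnj w + ?c * cnj ?c * q y y)" by (rule arg_cong)
    also have "... = A - 2 * r * (cmod w)\<^sup>2 + r\<^sup>2 * (cmod w)\<^sup>2 * B"
      unfolding cmod_power2 A_def B_def by (simp add: power2_eq_square algebra_simps)
    finally show ?thesis using psdD(3)[OF q D_add[OF x D_scl[OF y]]] by metis
  qed
  have "(cmod w)\<^sup>2 \<le> A * B"
  \<comment> \<open>The seminorm of y may vanish. Then \<open>key\<close> is affine in r, and a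
    large r forces w = 0.\<close>
  proof (cases "B = 0")
    case True
    have "0 \<le> A - 2 * ((A + 1) / (2 * (cmod w)\<^sup>2)) * (cmod w)\<^sup>2" if "w \<noteq> 0"
      using key[of "(A + 1) / (2 * (cmod w)\<^sup>2)"] True by simp
    then have "w = 0" by (cases "w = 0") (auto simp: field_simps)
    then show ?thesis using True by simp
  next
    case False
    then have "B > 0" using AB by simp
    then show ?thesis using key[of "1 / B"] by (simp add: field_simps power2_eq_square)
  qed
  then have "cmod w \<le> sqrt (A * B)" by (rule real_le_rsqrt)
  then show ?thesis by (simp add: w_def A_def B_def nrm_def real_sqrt_mult)
qed

lemma nrm_triangle:
  assumes q: "psd q" and x: "x \<in> D" and y: "y \<in> D"
  shows "nrm q (x + y) \<le> nrm q x + nrm q y"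
proof -
  have "Re (q (x + y) (x + y)) = (nrm q x)\<^sup>2 + 2 * Re (q x y) + (nrm q y)\<^sup>2"
    using psdD(2)[OF q x y] psdD(1)[OF q] x y by (simp add: nrm_sq[OF q] sesq_simps D_add)
  also have "... \<le> (nrm q x + nrm q y)\<^sup>2"
    using Cauchy_Schwarz[OF q x y] complex_Re_le_cmod[of "q x y"] by (simp add: power2_sum)
  finally show ?thesis
    unfolding nrm_def[of q "x + y"] using nrm_nonneg[OF q x] nrm_nonneg[OF q y] by (simp add: real_le_lsqrt)
qed

lemma nrm_scl:
  assumes q: "psd q" and x: "x \<in> D"
  shows "nrm q (scl c x) = cmod c * nrm q x"
proof -
  have "q (scl c x) (scl c x) = complex_of_real ((cmod c)\<^sup>2) * q x x"
    unfolding complex_norm_square using x by (simp add: sesq_simps[OF psdD(1)[OF q]] D_scl)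
  then have "Re (q (scl c x) (scl c x)) = (cmod c)\<^sup>2 * Re (q x x)" by simp
  then show ?thesis by (simp add: nrm_def real_sqrt_mult)
qed

lemma nrm_minus: "psd q \<Longrightarrow> x \<in> D \<Longrightarrow> nrm q (- x) = nrm q x"
  using nrm_scl[of q x "-1"] by (simp add: scl_neg)

lemma nrm_diff_commute: "psd q \<Longrightarrow> x \<in> D \<Longrightarrow> y \<in> D \<Longrightarrow> nrm q (x - y) = nrm q (y - x)"
  using nrm_minus[of q "x - y"] D_diff by simp

text \<open>Polarisation, after rescaling \<open>x\<close> and \<open>y\<close> to equal length.\<close>
lemma sesq_bounded:
  assumes a: "sesq a" and q: "psd q" and M: "\<And>x. x \<in> D \<Longrightarrow> cmod (a x x) \<le> M * Re (q x x)"
    and "0 \<le> M" and x: "x \<in> D" and y: "y \<in> D"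
  shows "cmod (a x y) \<le> 2 * M * nrm q x * nrm q y"
proof -
  have tri: "cmod (A - B + \<i> * C - \<i> * E) \<le> cmod A + cmod B + cmod C + cmod E" for A B C E
    using norm_triangle_ineq4[of "A - B + \<i> * C" "\<i> * E"] norm_triangle_ineq[of "A - B" "\<i> * C"]
      norm_triangle_ineq4[of A B] by (simp add: norm_mult)
  have sum: "cmod (a x y) \<le> M * (Re (q x x) + Re (q y y))" if x: "x \<in> D" and y: "y \<in> D" for x y
  proof -
    let ?z = "\<lambda>c. x + scl c y"
    have zD: "?z c \<in> D" for c using x y D_add D_scl by blast
    have "4 * cmod (a x y) = cmod (4 * a x y)" by (simp add: norm_mult)
    also have "... \<le> cmod (a (?z 1) (?z 1)) + cmod (a (?z (-1)) (?z (-1)))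
        + cmod (a (?z \<i>) (?z \<i>)) + cmod (a (?z (-\<i>)) (?z (-\<i>)))"
      unfolding sesq_polarisation[OF a x y] by (rule tri)
    also have "... \<le> M * Re (q (?z 1) (?z 1)) + M * Re (q (?z (-1)) (?z (-1)))
        + M * Re (q (?z \<i>) (?z \<i>)) + M * Re (q (?z (-\<i>)) (?z (-\<i>)))"
      by (intro add_mono M zD)
    also have "... = 4 * (M * (Re (q x x) + Re (q y y)))"
      unfolding sesq_perturb[OF psdD(1)[OF q] x y] by (simp add: algebra_simps)
    finally show ?thesis by simp
  qed
  show ?thesis
  proof (cases "nrm q x = 0 \<or> nrm q y = 0")
    case False
    then have pos: "nrm q x > 0" "nrm q y > 0" using nrm_nonneg[OF q] x y by (auto simp: less_le)
    define r where "r = sqrt (nrm q y / nrm q x)"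
    have r: "r > 0" and r2: "r\<^sup>2 = nrm q y / nrm q x" using pos by (auto simp: r_def)
    have e: "a x y = a (scl (of_real r) x) (scl (of_real (1/r)) y)"
      using r by (simp add: sesq_simps[OF a] x y D_scl)
    have nsq: "Re (q (scl c x) (scl c x)) = (cmod c)\<^sup>2 * (nrm q x)\<^sup>2" if "x \<in> D" for c x
      using nrm_sq[OF q D_scl[OF that], of c] nrm_scl[OF q that, of c] by (simp add: power_mult_distrib)
    have "cmod (a x y) \<le> M * (r\<^sup>2 * (nrm q x)\<^sup>2 + (1/r)\<^sup>2 * (nrm q y)\<^sup>2)"
      using sum[OF D_scl[OF x, of "of_real r"] D_scl[OF y, of "of_real (1/r)"]] r
      by (simp add: e nsq[OF x] nsq[OF y] norm_divide)
    also have "... = 2 * M * nrm q x * nrm q y"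
      unfolding power_divide r2 using pos by (simp add: field_simps power2_eq_square)
    finally show ?thesis .
  next
    case True
    have nsq: "Re (q (scl c x) (scl c x)) = (cmod c)\<^sup>2 * (nrm q x)\<^sup>2" if "x \<in> D" for c x
      using nrm_sq[OF q D_scl[OF that], of c] nrm_scl[OF q that, of c] by (simp add: power_mult_distrib)
    have "cmod (a x y) \<le> e" if e: "e > 0" for e
    proof -
      define K where "K = M * ((nrm q x)\<^sup>2 + (nrm q y)\<^sup>2)"
      have K: "K \<ge> 0" using \<open>0 \<le> M\<close> by (simp add: K_def)
      define t where "t = sqrt (e / (K + 1))"
      have t: "t > 0" and t2: "t\<^sup>2 = e / (K + 1)" using e K by (auto simp: t_def)
      \<comment> \<open>When a seminorm vanishes the lengths cannot be equalised; instead the other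
        factor is shrunk by t, while the null factor grows at no cost.\<close>
      obtain c where c: "c > 0" "(c\<^sup>2 * (nrm q x)\<^sup>2 + (1/c)\<^sup>2 * (nrm q y)\<^sup>2) = t\<^sup>2 * ((nrm q x)\<^sup>2 + (nrm q y)\<^sup>2)"
      proof (cases "nrm q x = 0")
        case True
        then show ?thesis using t that[of "1/t"] by simp
      next
        case False
        then have "nrm q y = 0" using True by simp
        then show ?thesis using t that[of t] by simp
      qed
      have e': "a x y = a (scl (of_real c) x) (scl (of_real (1/c)) y)"
        using c by (simp add: sesq_simps[OF a] x y D_scl)
      have "cmod (a x y) \<le> M * (c\<^sup>2 * (nrm q x)\<^sup>2 + (1/c)\<^sup>2 * (nrm q y)\<^sup>2)"
        using sum[OF D_scl[OF x, of "of_real c"] D_scl[OF y, of "of_real (1/c)"]] c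
        by (simp add: e' nsq[OF x] nsq[OF y] norm_divide)
      also have "... = t\<^sup>2 * K" using c(2) by (simp add: K_def)
      also have "... \<le> e" unfolding t2 using K e by (simp add: field_simps)
      finally show ?thesis .
    qed
    then have "cmod (a x y) \<le> 0" by (rule field_le_epsilon[where y=0, simplified])
    then show ?thesis using True by auto
  qed
qed

text \<open>An affine map sends the two given values to 0 and 1. After rotating g by a phase, F is
  real on the diagonal along the segment from f to g, so the intermediate value theorem attains the
  weight u. Since p is only semidefinite, \<open>null\<close> ensures that the vector found can be
  normalised. It is applied to the form domain and to the operator domain.\<close>

lemma Toeplitz_Hausdorff:
  assumes E: "sesq E" and p: "psd p"
    and null: "\<And>x y. x \<in> D \<Longrightarrow> y \<in> D \<Longrightarrow> Re (p x x) = 0 \<Longrightarrow> E x y = 0 \<and> E y x = 0"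
  shows "convex {E f f |f. f \<in> D \<and> Re (p f f) = 1}"
proof (rule convexI)
  fix \<alpha> \<beta> :: complex and v u :: real
  assume "\<alpha> \<in> {E f f |f. f \<in> D \<and> Re (p f f) = 1}" "\<beta> \<in> {E f f |f. f \<in> D \<and> Re (p f f) = 1}"
    and vu: "0 \<le> v" "0 \<le> u" "v + u = 1"
  then obtain f g where f: "f \<in> D" "Re (p f f) = 1" "\<alpha> = E f f" and g: "g \<in> D" "Re (p g g) = 1" "\<beta> = E g g"
    by blast
  have pf: "p f f = 1" "p g g = 1" using psdD(4)[OF p] f g by (metis of_real_1)+
  show "v *\<^sub>R \<alpha> + u *\<^sub>R \<beta> \<in> {E f f |f. f \<in> D \<and> Re (p f f) = 1}"
  proof (cases "\<alpha> = \<beta>")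
    case True
    then have "v *\<^sub>R \<alpha> + u *\<^sub>R \<beta> = \<alpha>" using vu by (simp flip: scaleR_add_left)
    then show ?thesis using f by auto
  next
    case False
    define F where "F x y = (E x y - \<alpha> * p x y) / (\<beta> - \<alpha>)" for x y
    have sp: "sesq p" using psdD(1)[OF p] .
    have F: "sesq F"
      unfolding sesq_def F_def using False E sp
      by (auto simp: sesq_def add_divide_distrib[symmetric] algebra_simps)
    have Ff: "F f f = 0" "F g g = 1" using f g pf False by (auto simp: F_def)
    \<comment> \<open>The cross term cnj \<mu> F(f, g) + \<mu> F(g, f) has imaginary part Im (\<mu>
      w), and \<mu> rotates w onto the real axis.\<close>
    define w where "w = F g f - cnj (F f g)"
    define \<mu> where "\<mu> = (if w = 0 then 1 else cnj w / complex_of_real (cmod w))"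
    have mu: "cmod \<mu> = 1" by (auto simp: \<mu>_def norm_divide)
    have muw: "Im (\<mu> * w) = 0"
    proof (cases "w = 0")
      case False
      have "cnj w * w = complex_of_real ((cmod w)\<^sup>2)" by (simp only: complex_norm_square mult.commute)
      then show ?thesis using False by (simp add: \<mu>_def)
    qed simp
    define g' where "g' = scl \<mu> g"
    have g': "g' \<in> D" unfolding g'_def using g D_scl by blast
    have mm: "\<mu> * cnj \<mu> = 1" using mu complex_norm_square[of \<mu>] by simp
    have Fg: "F g' g' = 1" "p g' g' = 1"
      using mm Ff pf g by (simp_all add: g'_def sesq_simps[OF F] sesq_simps[OF sp] D_scl mult.commute)
    define r k where "r = Re (F f g' + F g' f)" and "k = Re (p f g')"
    have rc: "F f g' + F g' f = complex_of_real r"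
    proof -
      have "F f g' + F g' f = cnj \<mu> * F f g + \<mu> * F g f" using f g by (simp add: g'_def sesq_simps[OF F])
      moreover have "Im (cnj \<mu> * F f g + \<mu> * F g f) = Im (\<mu> * w)" by (simp add: w_def algebra_simps)
      ultimately have "Im (F f g' + F g' f) = 0" using muw by metis
      then show ?thesis unfolding r_def by (simp add: complex_eq_iff)
    qed
    have kc: "p f g' + p g' f = complex_of_real (2 * k)"
      using psdD(2)[OF p f(1) g'] by (simp add: k_def complex_eq_iff)
    define h where "h t = scl (complex_of_real (1 - t)) f + scl (complex_of_real t) g'" for t
    have h: "h t \<in> D" for t unfolding h_def using f g' D_add D_scl by blast
    have bil: "b (h t) (h t) = (1 - t)\<^sup>2 * b f f + of_real (t * (1 - t)) * (b f g' + b g' f) + t\<^sup>2 * b g' g'"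
      if "sesq b" for b t
      using f(1) g' by (simp add: h_def sesq_simps[OF that] D_add D_scl power2_eq_square algebra_simps)
    have Fh: "F (h t) (h t) = complex_of_real (t\<^sup>2 + t * (1 - t) * r)" for t
      unfolding bil[OF F] Ff Fg rc by simp
    have ph: "p (h t) (h t) = complex_of_real ((1 - t)\<^sup>2 + t\<^sup>2 + t * (1 - t) * (2 * k))" for t
      unfolding bil[OF sp] pf Fg kc by simp
    \<comment> \<open>The function equals -u at 0 and 1 - u at 1; a zero says that F is u times p on
      \<open>h t\<close>.\<close>
    let ?\<phi> = "\<lambda>t. t\<^sup>2 + t * (1 - t) * r - u * ((1 - t)\<^sup>2 + t\<^sup>2 + t * (1 - t) * (2 * k))"
    have "\<exists>t. 0 \<le> t \<and> t \<le> 1 \<and> ?\<phi> t = 0"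
      by (rule IVT') (use vu in \<open>auto intro!: continuous_intros\<close>)
    then obtain t where t: "0 \<le> t" "t \<le> 1" "?\<phi> t = 0" by blast
    define N where "N = Re (p (h t) (h t))"
    have pN: "p (h t) (h t) = complex_of_real N" unfolding N_def using psdD(4)[OF p h] .
    have FN: "F (h t) (h t) = complex_of_real (u * N)"
    proof -
      have "N = (1 - t)\<^sup>2 + t\<^sup>2 + t * (1 - t) * (2 * k)" unfolding N_def ph by simp
      then have "t\<^sup>2 + t * (1 - t) * r = u * N" using t(3) by simp
      then show ?thesis unfolding Fh by simp
    qed
    have "N \<ge> 0" unfolding N_def using psdD(3)[OF p h] .
    \<comment> \<open>If \<open>h t\<close> were null, F would vanish against it in either slot.
      Pairing with f and g' then gives t = 0, where the p-value is 1.\<close>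
    moreover have "N \<noteq> 0"
    proof
      assume N0: "N = 0"
      have z: "F (h t) y = 0 \<and> F y (h t) = 0" if "y \<in> D" for y
      proof -
        have "nrm p (h t) = 0" using N0 by (simp add: nrm_def N_def)
        then have "p (h t) y = 0" "p y (h t) = 0"
          using Cauchy_Schwarz[OF p h that, of t] Cauchy_Schwarz[OF p that h, of t] by auto
        then show ?thesis using null[OF h that, of t] N0 by (simp add: F_def N_def)
      qed
      have fh: "F f (h t) = of_real (1 - t) * F f f + of_real t * F f g'"
        and hg: "F (h t) g' = of_real (1 - t) * F f g' + of_real t * F g' g'"
        using f(1) g' by (simp_all add: h_def sesq_simps[OF F] D_add D_scl)
      have "of_real t * F f g' = 0" using fh z[OF f(1)] Ff by simp
      then have "t = 0" using hg z[OF g'] Fg by auto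
      then show False using N0 ph[of t] pN by simp
    qed
    ultimately have N: "N > 0" by simp
    define h' where "h' = scl (complex_of_real (1 / sqrt N)) (h t)"
    have h': "h' \<in> D" unfolding h'_def using h D_scl by blast
    have sq: "complex_of_real (1 / sqrt N) * (complex_of_real (1 / sqrt N) * z) = z / of_real N" for z
      using N by (simp add: field_simps flip: of_real_mult of_real_power)
    have Fh': "F h' h' = u" "p h' h' = 1"
      using N pN FN h[of t] sq by (simp_all add: h'_def sesq_simps[OF F] sesq_simps[OF sp] D_scl del: of_real_divide)
    have "E h' h' = \<alpha> + u * (\<beta> - \<alpha>)" using Fh' False by (simp add: F_def field_simps)
    also have "... = v *\<^sub>R \<alpha> + u *\<^sub>R \<beta>"
    proof -
      have v: "complex_of_real v = 1 - of_real u" using vu by (metis add_diff_cancel_right' of_real_1 of_real_diff)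
      show ?thesis unfolding scaleR_conv_of_real v by (simp add: algebra_simps)
    qed
    finally show ?thesis using h' Fh'(2) unfolding mem_Collect_eq by (intro exI[of _ h']) simp
  qed
qed

section \<open>Completeness, Riesz representation and Lax-Milgram\<close>

definition complete_for :: "('v \<Rightarrow> 'v \<Rightarrow> complex) \<Rightarrow> bool" where
  "complete_for q \<longleftrightarrow> (\<forall>X. (\<forall>n. X n \<in> D) \<and> (\<forall>e>0. \<exists>N. \<forall>m\<ge>N. \<forall>n\<ge>N. nrm q (X m - X n) < e)
     \<longrightarrow> (\<exists>x\<in>D. (\<lambda>n. nrm q (X n - x)) \<longlonglongrightarrow> 0))"

lemma bounded_sesq_tendsto:
  assumes b: "sesq b" and s: "psd s" and M: "\<And>x y. x \<in> D \<Longrightarrow> y \<in> D \<Longrightarrow> cmod (b x y) \<le> M * nrm s x * nrm s y"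
    and X: "\<And>n. X n \<in> D" and x: "x \<in> D" and lim: "(\<lambda>n. nrm s (X n - x)) \<longlonglongrightarrow> 0"
  shows "y \<in> D \<Longrightarrow> (\<lambda>n. b (X n) y) \<longlonglongrightarrow> b x y" and "(\<lambda>n. b (X n) (X n)) \<longlonglongrightarrow> b x x"
proof -
  have d: "X n - x \<in> D" for n using X x D_diff by blast
  have l: "(\<lambda>n. b (X n - x) y) \<longlonglongrightarrow> 0" if "y \<in> D" for y
    by (rule Lim_null_comparison[OF always_eventually[OF allI[OF M[OF d that]]]])
       (use tendsto_mult_right_zero[OF tendsto_mult_left_zero[OF lim, of "nrm s y"], of M] in \<open>simp add: mult.assoc\<close>)
  have r: "(\<lambda>n. b y (X n - x)) \<longlonglongrightarrow> 0" if "y \<in> D" for y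
    by (rule Lim_null_comparison[OF always_eventually[OF allI[OF M[OF that d]]]])
       (use tendsto_mult_right_zero[OF lim, of "M * nrm s y"] in \<open>simp add: mult.assoc\<close>)
  have q: "(\<lambda>n. b (X n - x) (X n - x)) \<longlonglongrightarrow> 0"
    by (rule Lim_null_comparison[OF always_eventually[OF allI[OF M[OF d d]]]])
       (use tendsto_mult_right_zero[OF tendsto_mult_zero[OF lim lim], of M] in \<open>simp add: mult.assoc\<close>)
  show "(\<lambda>n. b (X n) y) \<longlonglongrightarrow> b x y" if "y \<in> D"
    using tendsto_add[OF l[OF that] tendsto_const[of "b x y"]] that X x by (simp add: sesq_simps[OF b])
  have "b (X n) (X n) = b (X n - x) (X n - x) + b (X n - x) x + b x (X n - x) + b x x" for n
    using X x d by (simp add: sesq_simps[OF b])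
  then show "(\<lambda>n. b (X n) (X n)) \<longlonglongrightarrow> b x x"
    using tendsto_add[OF tendsto_add[OF tendsto_add[OF q l[OF x]] r[OF x]] tendsto_const[of "b x x"]] by simp
qed

text \<open>Turns minimality into a first-order condition: t = -A / K with K = |B| + 1 would make
  the quadratic negative.\<close>

lemma linear_term_zero:
  fixes A B :: real
  assumes "\<And>t. 0 \<le> 2 * t * A + t\<^sup>2 * B" shows "A = 0"
proof (rule ccontr)
  assume A: "A \<noteq> 0"
  define K where "K = \<bar>B\<bar> + 1"
  have K: "K > 0" "B \<le> K" by (auto simp: K_def)
  have "0 \<le> 2 * (- A / K) * A + (- A / K)\<^sup>2 * B" by (rule assms)
  also have "... \<le> 2 * (- A / K) * A + (- A / K)\<^sup>2 * K" using K by (intro add_left_mono mult_left_mono) auto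
  also have "... = - (A\<^sup>2 / K)" using K by (simp add: power2_eq_square field_simps)
  also have "... < 0" using A K by simp
  finally show False by simp
qed

text \<open>The functional l is conjugate-linear, matching the second slot of s. A nearly minimising
  sequence of J converges by completeness; its variational inequality, with error 1 / (n + 1),
  passes to the limit and becomes the equation.\<close>

lemma Riesz:
  assumes s: "psd s" and compl: "complete_for s"
    and l_add: "\<And>x y. x \<in> D \<Longrightarrow> y \<in> D \<Longrightarrow> l (x + y) = l x + l y"
    and l_scl: "\<And>x c. x \<in> D \<Longrightarrow> l (scl c x) = cnj c * l x"
    and l_bd: "\<And>x. x \<in> D \<Longrightarrow> cmod (l x) \<le> B * nrm s x"
    and ne: "D \<noteq> {}"
  shows "\<exists>r\<in>D. \<forall>y\<in>D. s r y = l y"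
proof -
  have ss: "sesq s" using psdD(1)[OF s] .
  define J where "J x = Re (s x x) - 2 * Re (l x)" for x
  define mid where "mid x y = scl (1/2) (x + y)" for x y
  obtain x0 where x0: "x0 \<in> D" using ne by blast
  have J_lower: "- B\<^sup>2 \<le> J x" if "x \<in> D" for x
  proof -
    have "Re (l x) \<le> B * nrm s x" using l_bd[OF that] complex_Re_le_cmod[of "l x"] by linarith
    then have "J x \<ge> (nrm s x)\<^sup>2 - 2 * (B * nrm s x)" by (simp add: J_def nrm_sq[OF s that])
    moreover have "(nrm s x - B)\<^sup>2 \<ge> 0" by simp
    ultimately show ?thesis by (simp add: power2_diff algebra_simps)
  qed
  have para: "Re (s (x - y) (x - y)) = 2 * J x + 2 * J y - 4 * J (mid x y)" if "x \<in> D" "y \<in> D" for x y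
  proof -
    have "Re (s (x + y) (x + y)) + Re (s (x - y) (x - y)) = 2 * Re (s x x) + 2 * Re (s y y)"
      using arg_cong[OF sesq_parallelogram[OF ss that], of Re] by simp
    moreover have "Re (s (mid x y) (mid x y)) = Re (s (x + y) (x + y)) / 4"
      using D_add[OF that] by (simp add: mid_def sesq_simps(3,4)[OF ss] D_scl)
    moreover have "Re (l (mid x y)) = (Re (l x) + Re (l y)) / 2"
      using that by (simp add: mid_def l_scl D_add l_add)
    ultimately show ?thesis by (simp add: J_def)
  qed
  obtain X where X: "\<And>n. X n \<in> D" "\<And>n x. x \<in> D \<Longrightarrow> J (X n) \<le> J x + 1 / real (Suc n)"
      "\<And>e. e > 0 \<Longrightarrow> \<exists>N. \<forall>m\<ge>N. \<forall>n\<ge>N. Re (s (X m - X n) (X m - X n)) < e"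
    by (rule minimising_sequence_Cauchy[of "\<lambda>_. D" "- B\<^sup>2" J "J x0" mid "\<lambda>x y. Re (s (x - y) (x - y))"])
       (use J_lower x0 para in \<open>auto simp: mid_def intro: D_add D_scl\<close>)
  have "\<exists>N. \<forall>m\<ge>N. \<forall>n\<ge>N. nrm s (X m - X n) < e" if "e > 0" for e
    using X(3)[of "e\<^sup>2"] that by (force simp: nrm_def intro: real_less_lsqrt)
  then obtain r where r: "r \<in> D" "(\<lambda>n. nrm s (X n - r)) \<longlonglongrightarrow> 0"
    using compl X(1) unfolding complete_for_def by blast
  have CS: "cmod (s x y) \<le> 1 * nrm s x * nrm s y" if "x \<in> D" "y \<in> D" for x y
    using Cauchy_Schwarz[OF s that] by simp
  have re: "Re (s r y) = Re (l y)" if y: "y \<in> D" for y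
  proof -
    have "0 \<le> 2 * t * (Re (s r y) - Re (l y)) + t\<^sup>2 * Re (s y y)" for t
    proof (rule LIMSEQ_le[of "\<lambda>n. - (1 / real (Suc n))" 0 "\<lambda>n. 2 * t * (Re (s (X n) y) - Re (l y)) + t\<^sup>2 * Re (s y y)"])
      show "(\<lambda>n. - (1 / real (Suc n))) \<longlonglongrightarrow> 0" using tendsto_minus[OF LIMSEQ_Suc[OF lim_1_over_n]] by simp
      show "(\<lambda>n. 2 * t * (Re (s (X n) y) - Re (l y)) + t\<^sup>2 * Re (s y y))
         \<longlonglongrightarrow> 2 * t * (Re (s r y) - Re (l y)) + t\<^sup>2 * Re (s y y)"
        by (intro tendsto_intros bounded_sesq_tendsto(1)[OF ss s CS X(1) r y])
      have "- (1 / real (Suc n)) \<le> 2 * t * (Re (s (X n) y) - Re (l y)) + t\<^sup>2 * Re (s y y)" for n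
      proof -
        let ?z = "X n + scl (complex_of_real t) y"
        have "?z \<in> D" using X(1) y D_add D_scl by blast
        then have "J (X n) \<le> J ?z + 1 / real (Suc n)" by (rule X(2))
        moreover have "J ?z = J (X n) + 2 * t * (Re (s (X n) y) - Re (l y)) + t\<^sup>2 * Re (s y y)"
        proof -
          have "Re (s ?z ?z) = Re (s (X n) (X n)) + 2 * t * Re (s (X n) y) + t\<^sup>2 * Re (s y y)"
            using arg_cong[OF psdD(2)[OF s X(1) y], of Re n]
            unfolding sesq_perturb[OF ss X(1) y] by (simp add: power2_eq_square)
          moreover have "Re (l ?z) = Re (l (X n)) + t * Re (l y)" using X(1) y by (simp add: l_add l_scl D_scl)
          ultimately show ?thesis by (simp add: J_def algebra_simps)
        qed
        ultimately show ?thesis by linarith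
      qed
      then show "\<exists>N. \<forall>n\<ge>N. - (1 / real (Suc n)) \<le> 2 * t * (Re (s (X n) y) - Re (l y)) + t\<^sup>2 * Re (s y y)" by blast
    qed
    then show ?thesis using linear_term_zero[of "Re (s r y) - Re (l y)" "Re (s y y)"] by simp
  qed
  \<comment> \<open>Testing with i y recovers the imaginary parts.\<close>
  have "s r y = l y" if y: "y \<in> D" for y
    using re[OF y] re[OF D_scl[OF y, of \<i>]] y r(1) by (simp add: complex_eq_iff sesq_simps[OF ss] l_scl)
  then show ?thesis using r(1) by blast
qed

text \<open>Richardson iteration: x is moved by \<rho> times the Riesz representative
  \<open>R x\<close> of the residual. The residuals contract because Re a and Re s agree on the
  diagonal, that is, a is coercive with constant 1.\<close>

lemma Lax_Milgram:
  assumes a: "sesq a" and s: "psd s" and Re: "\<And>x. x \<in> D \<Longrightarrow> Re (a x x) = Re (s x x)"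
    and M: "\<And>x y. x \<in> D \<Longrightarrow> y \<in> D \<Longrightarrow> cmod (a x y) \<le> M * nrm s x * nrm s y" and "M \<ge> 0"
    and compl: "complete_for s"
    and l_add: "\<And>x y. x \<in> D \<Longrightarrow> y \<in> D \<Longrightarrow> l (x + y) = l x + l y"
    and l_scl: "\<And>x c. x \<in> D \<Longrightarrow> l (scl c x) = cnj c * l x"
    and l_bd: "\<And>x. x \<in> D \<Longrightarrow> cmod (l x) \<le> B * nrm s x"
    and ne: "D \<noteq> {}"
  shows "\<exists>x\<in>D. \<forall>y\<in>D. a x y = l y"
proof -
  have ss: "sesq s" using psdD(1)[OF s] .
  obtain x0 where x0: "x0 \<in> D" using ne by blast
  have "\<exists>r\<in>D. \<forall>y\<in>D. s r y = l y - a x y" if x: "x \<in> D" for x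
  proof (rule Riesz[OF s compl])
    show "cmod (l y - a x y) \<le> (B + M * nrm s x) * nrm s y" if "y \<in> D" for y
      using norm_triangle_ineq4[of "l y" "a x y"] l_bd[OF that] M[OF x that] by (simp add: algebra_simps)
  qed (use x ne in \<open>simp_all add: l_add l_scl sesq_simps[OF a] algebra_simps\<close>)
  then obtain R where R: "\<And>x. x \<in> D \<Longrightarrow> R x \<in> D" "\<And>x y. x \<in> D \<Longrightarrow> y \<in> D \<Longrightarrow> s (R x) y = l y - a x y"
    by metis
  \<comment> \<open>The squared residual is multiplied by at most 1 - 2 \<rho> + \<rho>^2 M^2; this
    choice gives \<rho> M^2 <= 1 and hence the factor 1 - \<rho>.\<close>
  define \<rho> where "\<rho> = 1 / (M\<^sup>2 + 1)"
  have rho: "\<rho> > 0" "\<rho> \<le> 1" "\<rho> * M\<^sup>2 \<le> 1" by (auto simp: \<rho>_def field_simps add_pos_nonneg add_nonneg_pos)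
  define X where "X n = ((\<lambda>x. x + scl (complex_of_real \<rho>) (R x)) ^^ n) x0" for n
  have XS: "X (Suc n) = X n + scl (complex_of_real \<rho>) (R (X n))" for n by (simp add: X_def)
  have X: "X n \<in> D" for n by (induction n) (simp add: X_def x0, simp only: XS D_add D_scl R)
  define r where "r n = R (X n)" for n
  have r: "r n \<in> D" for n using X R by (simp add: r_def)
  have rS: "s (r (Suc n)) y = s (r n) y - \<rho> * a (r n) y" if "y \<in> D" for n y
  proof -
    have "a (X (Suc n)) y = a (X n) y + \<rho> * a (r n) y"
      unfolding XS r_def[symmetric] using that X r by (simp add: sesq_simps[OF a] D_scl)
    then show ?thesis using R(2)[OF X that] by (simp add: r_def)
  qed
  define q where "q = sqrt (1 - \<rho>)"
  have q: "0 \<le> q" "q < 1" using rho by (auto simp: q_def)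
  have step: "nrm s (r (Suc n)) \<le> q * nrm s (r n)" for n
  proof -
    let ?d = "r (Suc n) - r n"
    have d: "?d \<in> D" using r D_diff by blast
    have sd: "s ?d y = - \<rho> * a (r n) y" if "y \<in> D" for y
      using rS[OF that, of n] that r by (simp add: sesq_simps[OF ss])
    have "(nrm s ?d)\<^sup>2 \<le> cmod (s ?d ?d)" unfolding nrm_sq[OF s d] by (rule complex_Re_le_cmod)
    also have "... \<le> \<rho> * (M * nrm s (r n) * nrm s ?d)"
      unfolding sd[OF d] using M[OF r d, of n] rho by (simp add: norm_mult)
    finally have "nrm s ?d * nrm s ?d \<le> (\<rho> * M * nrm s (r n)) * nrm s ?d" by (simp add: power2_eq_square mult.assoc)
    then have dle: "nrm s ?d \<le> \<rho> * M * nrm s (r n)"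
      using nrm_nonneg[OF s d] nrm_nonneg[OF s r, of n] rho \<open>M \<ge> 0\<close>
      by (cases "nrm s ?d = 0") (auto simp: mult_le_cancel_right)
    have e: "r (Suc n) = r n + ?d" by simp
    have "(nrm s (r (Suc n)))\<^sup>2 = Re (s (r n + ?d) (r n + ?d))" using nrm_sq[OF s r, of "Suc n"] by simp
    also have "... = Re (s (r n) (r n) + s (r n) ?d + s ?d (r n) + s ?d ?d)"
      using r d by (simp add: sesq_simps[OF ss] D_add algebra_simps)
    also have "... = (nrm s (r n))\<^sup>2 + 2 * Re (s ?d (r n)) + (nrm s ?d)\<^sup>2"
      using psdD(2)[OF s d r, of n] by (simp add: nrm_sq[OF s r] nrm_sq[OF s d])
    also have "Re (s ?d (r n)) = - \<rho> * (nrm s (r n))\<^sup>2"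
      unfolding sd[OF r] by (simp add: Re[OF r] nrm_sq[OF s r])
    also have "(nrm s (r n))\<^sup>2 + 2 * (- \<rho> * (nrm s (r n))\<^sup>2) + (nrm s ?d)\<^sup>2
       \<le> (nrm s (r n))\<^sup>2 + 2 * (- \<rho> * (nrm s (r n))\<^sup>2) + (\<rho> * M * nrm s (r n))\<^sup>2"
      using dle nrm_nonneg[OF s d] by (intro add_left_mono power_mono) auto
    also have "... = (1 - 2 * \<rho> + \<rho> * (\<rho> * M\<^sup>2)) * (nrm s (r n))\<^sup>2"
      by (simp add: power2_eq_square algebra_simps)
    also have "... \<le> (1 - \<rho>) * (nrm s (r n))\<^sup>2"
      using mult_left_mono[OF rho(3), of \<rho>] rho by (intro mult_right_mono) auto
    finally have "nrm s (r (Suc n)) \<le> sqrt ((1 - \<rho>) * (nrm s (r n))\<^sup>2)" by (rule real_le_rsqrt)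
    then show ?thesis using nrm_nonneg[OF s r, of n] by (simp add: q_def real_sqrt_mult)
  qed
  have rq: "nrm s (r n) \<le> q ^ n * nrm s (r 0)" for n
  proof (induction n)
    case (Suc n)
    show ?case using step[of n] mult_left_mono[OF Suc q(1)] by simp
  qed simp
  have r_lim: "(\<lambda>n. nrm s (r n)) \<longlonglongrightarrow> 0"
  proof (rule tendsto_sandwich[OF _ _ tendsto_const])
    show "(\<lambda>n. q ^ n * nrm s (r 0)) \<longlonglongrightarrow> 0" using LIMSEQ_power_zero[of q] q by (simp add: tendsto_mult_left_zero)
  qed (use rq nrm_nonneg[OF s r] in auto)
  \<comment> \<open>K (q^n - q^(n+k)) is the geometric sum of the bounds on the steps n, ..., n + k
    - 1.\<close>
  define K where "K = \<rho> * nrm s (r 0) / (1 - q)"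
  have K: "K \<ge> 0" using rho q nrm_nonneg[OF s r, of 0] by (simp add: K_def)
  have dist: "nrm s (X (n + k) - X n) \<le> K * (q ^ n - q ^ (n + k))" for n k
  proof (induction k)
    case 0 show ?case using sesq_simps(7)[OF ss X X D_diff[OF X X], of n n n n] by (simp add: nrm_def)
  next
    case (Suc k)
    have e: "X (n + Suc k) - X n = (X (n + k) - X n) + scl (complex_of_real \<rho>) (r (n + k))"
      using XS[of "n + k"] by (simp add: r_def)
    have "nrm s (X (n + Suc k) - X n) \<le> nrm s (X (n + k) - X n) + \<rho> * nrm s (r (n + k))"
      unfolding e using nrm_triangle[OF s D_diff[OF X X] D_scl[OF r]] nrm_scl[OF s r] rho by (metis abs_of_pos norm_of_real)
    also have "... \<le> K * (q ^ n - q ^ (n + k)) + \<rho> * (q ^ (n + k) * nrm s (r 0))"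
      using Suc rq[of "n + k"] rho by (intro add_mono mult_left_mono) auto
    also have "\<rho> * (q ^ (n + k) * nrm s (r 0)) = K * (q ^ (n + k) - q ^ (n + Suc k))"
      using q by (simp add: K_def field_simps)
    finally show ?case by (simp add: algebra_simps)
  qed
  have qlim: "(\<lambda>n. K * q ^ n) \<longlonglongrightarrow> 0" using LIMSEQ_power_zero[of q] q by (simp add: tendsto_mult_right_zero)
  have "\<exists>N. \<forall>m\<ge>N. \<forall>n\<ge>N. nrm s (X m - X n) < e" if e: "e > 0" for e
  proof -
    obtain N where N: "\<And>n. n \<ge> N \<Longrightarrow> K * q ^ n < e"
      using order_tendstoD(2)[OF qlim e] by (auto simp: eventually_sequentially)
    have *: "nrm s (X m - X n) < e" if "n \<le> m" "N \<le> n" for m n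
    proof -
      have "nrm s (X m - X n) \<le> K * (q ^ n - q ^ m)" using dist[of n "m - n"] that by simp
      also have "... \<le> K * q ^ n" using K q by (intro mult_left_mono) auto
      also have "... < e" using N that by simp
      finally show ?thesis .
    qed
    have "nrm s (X m - X n) < e" if "N \<le> m" "N \<le> n" for m n
      using *[of n m] *[of m n] that nrm_diff_commute[OF s X X, of m n] by (cases "n \<le> m") auto
    then show ?thesis by blast
  qed
  then obtain x where x: "x \<in> D" "(\<lambda>n. nrm s (X n - x)) \<longlonglongrightarrow> 0"
    using compl X unfolding complete_for_def by blast
  have "a x y = l y" if y: "y \<in> D" for y
  proof -
    have 1: "(\<lambda>n. a (X n) y) \<longlonglongrightarrow> a x y" by (rule bounded_sesq_tendsto(1)[OF a s M X x y])
    have "(\<lambda>n. s (r n) y) \<longlonglongrightarrow> 0"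
      by (rule Lim_null_comparison[OF always_eventually[OF allI[OF Cauchy_Schwarz[OF s r y]]]])
         (use tendsto_mult_left_zero[OF r_lim] in auto)
    then have "(\<lambda>n. l y - a (X n) y) \<longlonglongrightarrow> 0" using R(2)[OF X y] by (simp add: r_def)
    from tendsto_diff[OF tendsto_const[of "l y"] this] have "(\<lambda>n. a (X n) y) \<longlonglongrightarrow> l y" by simp
    then show ?thesis using 1 LIMSEQ_unique by blast
  qed
  then show ?thesis using x by blast
qed

section \<open>Approximation of form vectors by the operator domain\<close>

lemma sesq_add_scaled:
  assumes "sesq a" "sesq b"
  shows "sesq (\<lambda>x y. a x y + of_real c * b x y)"
  using assms unfolding sesq_def by (auto simp: algebra_simps)

lemma psd_add_scaled:
  assumes s: "psd s" and p: "psd p" and "c \<ge> 0"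
  shows "psd (\<lambda>x y. s x y + of_real c * p x y)"
  unfolding psd_def
proof (intro conjI ballI)
  show "sesq (\<lambda>x y. s x y + of_real c * p x y)" using sesq_add_scaled psdD(1) s p by blast
  fix x y assume xy: "x \<in> D" "y \<in> D"
  show "s y x + of_real c * p y x = cnj (s x y + of_real c * p x y)"
    using psdD(2)[OF s xy] psdD(2)[OF p xy] by simp
next
  fix x assume x: "x \<in> D"
  show "0 \<le> Re (s x x + of_real c * p x x)" using psdD(3)[OF s x] psdD(3)[OF p x] \<open>c \<ge> 0\<close> by simp
qed

text \<open>The solutions \<open>f\<^sub>n\<close> of \<open>(A + n) f\<^sub>n = n g\<close> differ from \<open>g\<close> by an \<open>s\<close>-bounded sequence that tends
  to \<open>0\<close> in the weaker norm \<open>p\<close>; suitable convex combinations converge in \<open>s\<close>.\<close>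
lemma operator_domain_core:
  assumes a: "sesq a" and s: "psd s" and p: "psd p"
    and Re: "\<And>x. x \<in> D \<Longrightarrow> Re (a x x) = Re (s x x)"
    and M: "\<And>x y. x \<in> D \<Longrightarrow> y \<in> D \<Longrightarrow> cmod (a x y) \<le> M * nrm s x * nrm s y" and "M \<ge> 0"
    and compl: "complete_for s"
    and ps: "\<And>x. x \<in> D \<Longrightarrow> Re (p x x) \<le> Re (s x x)"
    and null: "\<And>x. x \<in> D \<Longrightarrow> Re (p x x) = 0 \<Longrightarrow> Re (s x x) = 0"
    and g: "g \<in> D"
  obtains X where "\<And>n. X n \<in> D" "\<And>n. \<exists>h\<in>D. \<forall>y\<in>D. a (X n) y = p h y"
    "(\<lambda>n. nrm s (X n - g)) \<longlonglongrightarrow> 0"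
proof -
  have ss: "sesq s" and sp: "sesq p" using psdD(1) s p by blast+
  define OD where "OD = {f\<in>D. \<exists>h\<in>D. \<forall>y\<in>D. a f y = p h y}"
  define K where "K = (M * nrm s g)\<^sup>2"
  \<comment> \<open>Corrections e that carry g into the operator domain: midpoint-convex sets
    shrinking in the p-norm. K is the bound on s(e, e) and m p(e, e) that the resolvent equation
    yields below.\<close>
  define C where "C n = {e\<in>D. g + e \<in> OD \<and> Re (p e e) \<le> K / real (Suc n)}" for n
  define mid where "mid x y = scl (1/2) (x + y)" for x y :: 'v
  have nps: "nrm p x \<le> nrm s x" if "x \<in> D" for x using ps[OF that] by (simp add: nrm_def)
  have mid_D: "mid x y \<in> D" if "x \<in> D" "y \<in> D" for x y using that by (simp add: mid_def D_add D_scl)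
  have mid_OD: "g + mid x y \<in> OD" if xy: "x \<in> D" "y \<in> D" "g + x \<in> OD" "g + y \<in> OD" for x y
  proof -
    obtain h k where h: "h \<in> D" "\<And>z. z \<in> D \<Longrightarrow> a (g + x) z = p h z"
      and k: "k \<in> D" "\<And>z. z \<in> D \<Longrightarrow> a (g + y) z = p k z"
      using xy by (auto simp: OD_def)
    have "a (g + mid x y) z = p (mid h k) z" if z: "z \<in> D" for z
    proof -
      have "a (g + mid x y) z = (a (g + x) z + a (g + y) z) / 2"
        using g xy z by (simp add: mid_def sesq_simps(1,3)[OF a] D_add D_scl field_simps)
      also have "... = p (mid h k) z"
        using h(1) k(1) z by (simp add: h(2) k(2) mid_def sesq_simps(1,3)[OF sp] D_add)
      finally show ?thesis .
    qed
    then show ?thesis unfolding OD_def using mid_D[OF h(1) k(1)] D_add[OF g mid_D[OF xy(1,2)]] by blast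
  qed
  have nonempty: "\<exists>e\<in>C n. Re (s e e) \<le> K" for n
  proof -
    define m where "m = real (Suc n)"
    have m: "m > 0" by (simp add: m_def)
    define b where "b x y = a x y + of_real m * p x y" for x y
    define t where "t x y = s x y + of_real m * p x y" for x y
    have b: "sesq b" unfolding b_def by (rule sesq_add_scaled[OF a sp])
    have t: "psd t" unfolding t_def by (rule psd_add_scaled[OF s p]) (use m in simp)
    have t1: "nrm s x \<le> nrm t x" if "x \<in> D" for x
      using psdD(3)[OF p that] m by (simp add: nrm_def t_def)
    have t2: "nrm t x \<le> sqrt (1 + m) * nrm s x" if "x \<in> D" for x
      using mult_left_mono[OF ps[OF that], of m] m
      by (simp add: nrm_def t_def real_sqrt_mult[symmetric] algebra_simps)
    have tc: "complete_for t"
      unfolding complete_for_def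
    proof (intro allI impI, elim conjE)
      fix X :: "nat \<Rightarrow> 'v" assume X: "\<forall>n. X n \<in> D" and C: "\<forall>e>0. \<exists>N. \<forall>m\<ge>N. \<forall>n\<ge>N. nrm t (X m - X n) < e"
      have "\<forall>e>0. \<exists>N. \<forall>m\<ge>N. \<forall>n\<ge>N. nrm s (X m - X n) < e"
        using C t1[OF D_diff[OF X[rule_format] X[rule_format]]] by (meson order_le_less_trans)
      then obtain x where x: "x \<in> D" "(\<lambda>n. nrm s (X n - x)) \<longlonglongrightarrow> 0"
        using compl X unfolding complete_for_def by blast
      have d: "X n - x \<in> D" for n using X x D_diff by blast
      have "(\<lambda>n. nrm t (X n - x)) \<longlonglongrightarrow> 0"
        by (rule tendsto_sandwich[OF _ _ tendsto_const tendsto_mult_right_zero[OF x(2), of "sqrt (1 + m)"]])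
           (use t2[OF d] nrm_nonneg[OF t d] in auto)
      then show "\<exists>x\<in>D. (\<lambda>n. nrm t (X n - x)) \<longlonglongrightarrow> 0" using x by blast
    qed
    have "\<exists>f\<in>D. \<forall>y\<in>D. b f y = of_real m * p g y"
    proof (rule Lax_Milgram[OF b t _ _ _ tc])
      show "Re (b x x) = Re (t x x)" if "x \<in> D" for x using Re[OF that] by (simp add: b_def t_def)
      show "cmod (b x y) \<le> (M + m) * nrm t x * nrm t y" if x: "x \<in> D" and y: "y \<in> D" for x y
      proof -
        have "cmod (b x y) \<le> cmod (a x y) + m * cmod (p x y)"
          unfolding b_def using norm_triangle_ineq[of "a x y" "of_real m * p x y"] m by (simp add: norm_mult)
        also have "... \<le> M * nrm s x * nrm s y + m * (nrm p x * nrm p y)"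
          using M[OF x y] Cauchy_Schwarz[OF p x y] m by (intro add_mono mult_left_mono) auto
        also have "... \<le> M * (nrm t x * nrm t y) + m * (nrm t x * nrm t y)"
          using t1[OF x] t1[OF y] nps[OF x] nps[OF y] nrm_nonneg[OF s x] nrm_nonneg[OF s y] nrm_nonneg[OF p y]
            nrm_nonneg[OF t x] m \<open>M \<ge> 0\<close>
          unfolding mult.assoc by (intro add_mono mult_left_mono mult_mono) linarith+
        finally show ?thesis by (simp add: algebra_simps)
      qed
      show "cmod (of_real m * p g y) \<le> (m * nrm p g) * nrm t y" if y: "y \<in> D" for y
      proof -
        have "cmod (p g y) \<le> nrm p g * nrm t y"
          using Cauchy_Schwarz[OF p g y] mult_left_mono[of "nrm p y" "nrm t y" "nrm p g"]
            nps[OF y] t1[OF y] nrm_nonneg[OF p g] by linarith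
        then show ?thesis using m by (simp add: norm_mult)
      qed
    qed (use g m \<open>M \<ge> 0\<close> in \<open>auto simp: sesq_simps[OF sp] algebra_simps\<close>)
    then obtain f where f: "f \<in> D" and fy: "\<And>y. y \<in> D \<Longrightarrow> b f y = of_real m * p g y" by blast
    have "a f y = p (scl (of_real m) (g - f)) y" if "y \<in> D" for y
      using fy[OF that] f g that by (simp add: b_def sesq_simps[OF sp] D_diff algebra_simps)
    then have fOD: "f \<in> OD" using f g D_diff D_scl unfolding OD_def by blast
    define e where "e = f - g"
    have e: "e \<in> D" using f g D_diff by (simp add: e_def)
    \<comment> \<open>Subtracting b(g, .) from the equation cancels m p(g, .) and leaves -a(g, .).
      Hence |e|^2 + m p(e, e) <= M |g| |e| <= (|e|^2 + K) / 2, which bounds both terms by K.\<close>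
    have "b e e = - a g e"
      using fy[OF e] f g e unfolding e_def by (simp add: b_def sesq_simps(7,8)[OF a] sesq_simps(7,8)[OF sp] D_diff algebra_simps)
    then have "Re (b e e) \<le> cmod (a g e)" using complex_Re_le_cmod[of "- a g e"] by simp
    also have "... \<le> M * nrm s g * nrm s e" by (rule M[OF g e])
    finally have 1: "(nrm s e)\<^sup>2 + m * Re (p e e) \<le> (M * nrm s g) * nrm s e"
      by (simp add: b_def Re[OF e] nrm_sq[OF s e])
    have "(nrm s e - M * nrm s g)\<^sup>2 \<ge> 0" by simp
    then have 2: "2 * (M * nrm s g * nrm s e) \<le> (nrm s e)\<^sup>2 + K" unfolding K_def by (simp add: power2_diff algebra_simps)
    have 3: "m * Re (p e e) \<ge> 0" using psdD(3)[OF p e] m by simp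
    have "(nrm s e)\<^sup>2 \<le> K" using 1 2 3 by linarith
    moreover have "m * Re (p e e) \<le> K" using 1 2 3 by (smt (verit) zero_le_power2)
    then have "Re (p e e) \<le> K / real (Suc n)" using m unfolding m_def[symmetric] by (simp add: field_simps)
    moreover have "g + e \<in> OD" using fOD by (simp add: e_def)
    ultimately have "e \<in> C n" "Re (s e e) \<le> K" using e by (simp_all add: C_def nrm_sq[OF s e])
    then show ?thesis by blast
  qed
  obtain Y where Y: "\<And>n. Y n \<in> C n" "\<And>e. e > 0 \<Longrightarrow> \<exists>N. \<forall>m\<ge>N. \<forall>n\<ge>N. Re (s (Y m - Y n) (Y m - Y n)) < e"
  proof (rule minimising_sequence_Cauchy[of C 0 "\<lambda>x. Re (s x x)" K mid "\<lambda>x y. Re (s (x - y) (x - y))"])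
    fix m n :: nat assume "m \<le> n"
    then have "K / real (Suc n) \<le> K / real (Suc m)" by (intro divide_left_mono) (auto simp: K_def)
    then show "C n \<subseteq> C m" by (auto simp: C_def)
  next
    fix n x y assume "x \<in> C n" "y \<in> C n"
    then have x: "x \<in> D" "g + x \<in> OD" "Re (p x x) \<le> K / real (Suc n)"
      and y: "y \<in> D" "g + y \<in> OD" "Re (p y y) \<le> K / real (Suc n)" by (auto simp: C_def)
    show "Re (s (x - y) (x - y)) = 2 * Re (s x x) + 2 * Re (s y y) - 4 * Re (s (mid x y) (mid x y))"
      unfolding mid_def by (rule sesq_midpoint[OF ss x(1) y(1)])
    have "Re (p (mid x y) (mid x y)) \<le> K / real (Suc n)"
      using sesq_midpoint[OF sp x(1) y(1), folded mid_def] psdD(3)[OF p D_diff[OF x(1) y(1)]] x(3) y(3) by linarith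
    then show "mid x y \<in> C n" using mid_OD x y mid_D by (simp add: C_def)
  qed (use nonempty psdD(3)[OF s] in \<open>auto simp: C_def\<close>)
  have YD: "Y n \<in> D" for n using Y(1)[of n] by (simp add: C_def)
  have "\<exists>N. \<forall>m\<ge>N. \<forall>n\<ge>N. nrm s (Y m - Y n) < e" if "e > 0" for e
    using Y(2)[of "e\<^sup>2"] that by (force simp: nrm_def intro: real_less_lsqrt)
  then obtain z where z: "z \<in> D" "(\<lambda>n. nrm s (Y n - z)) \<longlonglongrightarrow> 0"
    using compl YD unfolding complete_for_def by blast
  have dz: "Y n - z \<in> D" for n using YD z D_diff by blast
  have bd: "cmod (p x y) \<le> 1 * nrm s x * nrm s y" if "x \<in> D" "y \<in> D" for x y
    using Cauchy_Schwarz[OF p that] mult_mono[OF nps[OF that(1)] nps[OF that(2)]] nrm_nonneg[OF s that(1)]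
      nrm_nonneg[OF p that(2)] by simp
  have "(\<lambda>n. Re (p (Y n) (Y n))) \<longlonglongrightarrow> Re (p z z)"
    by (intro tendsto_Re bounded_sesq_tendsto(2)[OF sp s bd YD z])
  moreover have "(\<lambda>n. Re (p (Y n) (Y n))) \<longlonglongrightarrow> 0"
  proof (rule tendsto_sandwich[OF _ _ tendsto_const])
    show "(\<lambda>n. K / real (Suc n)) \<longlonglongrightarrow> 0"
      using tendsto_mult_right_zero[OF LIMSEQ_Suc[OF lim_1_over_n], of K] by simp
  qed (use Y(1) YD psdD(3)[OF p] in \<open>auto simp: C_def\<close>)
  \<comment> \<open>The limit z is null for p, hence for s by \<open>null\<close>, so Y itself tends
    to 0 in the s-norm.\<close>
  ultimately have "Re (p z z) = 0" using LIMSEQ_unique by blast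
  then have "nrm s z = 0" using null[OF z(1)] by (simp add: nrm_def)
  then have le: "nrm s (Y n) \<le> nrm s (Y n - z)" for n
    using nrm_triangle[OF s dz z(1), of n] by simp
  show thesis
  proof (rule that)
    show "g + Y n \<in> D" for n using g YD D_add by blast
    show "\<exists>h\<in>D. \<forall>y\<in>D. a (g + Y n) y = p h y" for n using Y(1)[of n] by (auto simp: C_def OD_def)
    show "(\<lambda>n. nrm s (g + Y n - g)) \<longlonglongrightarrow> 0"
      by (rule tendsto_sandwich[OF _ _ tendsto_const z(2)]) (use le nrm_nonneg[OF s YD] in auto)
  qed
qed

end

section \<open>Square-integrable functions\<close>

lemma lebesgue_distr_translation: "distr lebesgue lebesgue (\<lambda>x. x + c) = (lebesgue :: 'a::euclidean_space measure)"
  and lebesgue_measurable_translation: "(\<lambda>x. x + c) \<in> lebesgue \<rightarrow>\<^sub>M (lebesgue :: 'a measure)"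
proof -
  have e: "(\<lambda>x. c + (\<Sum>j\<in>Basis. (1 * (x \<bullet> j)) *\<^sub>R j)) = (\<lambda>x::'a. x + c)"
    by (simp add: euclidean_representation add.commute)
  show "(\<lambda>x. x + c) \<in> lebesgue \<rightarrow>\<^sub>M (lebesgue :: 'a measure)"
    using lebesgue_affine_measurable[of "\<lambda>_. 1" c] unfolding e by simp
  have "lebesgue = density (distr lebesgue lebesgue (\<lambda>x::'a. x + c)) (\<lambda>_. ennreal (\<Prod>j\<in>(Basis::'a set). \<bar>1\<bar>))"
    using lebesgue_affine_euclidean[of "\<lambda>_. 1" c] unfolding e by simp
  then show "distr lebesgue lebesgue (\<lambda>x. x + c) = (lebesgue :: 'a measure)" by (simp add: density_1)
qed

lemma borel_measurable_translate:
  fixes f :: "'a::euclidean_space \<Rightarrow> _"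
  assumes "f \<in> measurable lebesgue M"
  shows "(\<lambda>x. f (x + c)) \<in> measurable lebesgue M"
  using measurable_compose[OF lebesgue_measurable_translation assms] .

lemma integrable_translate:
  fixes f :: "'a::euclidean_space \<Rightarrow> 'b::{banach, second_countable_topology}"
  assumes "integrable lebesgue f"
  shows "integrable lebesgue (\<lambda>x. f (x + c))"
  using assms integrable_distr_eq[OF lebesgue_measurable_translation, of f c]
  by (simp add: lebesgue_distr_translation)

lemma integral_translate:
  fixes f :: "'a::euclidean_space \<Rightarrow> 'b::{banach, second_countable_topology}"
  assumes "f \<in> borel_measurable lebesgue"
  shows "(LINT x|lebesgue. f (x + c)) = (LINT x|lebesgue. f x)"
  using integral_distr[OF lebesgue_measurable_translation assms, of c]
  by (simp add: lebesgue_distr_translation)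

lemma AE_translate:
  fixes P :: "'a::euclidean_space \<Rightarrow> bool"
  assumes "AE x in lebesgue. P x" shows "AE x in lebesgue. P (x + c)"
proof -
  obtain N where N: "{x. \<not> P x} \<subseteq> N" "N \<in> null_sets lebesgue"
    using assms by (auto elim!: AE_E simp: null_sets_def)
  have "(\<lambda>x. x + c) -` N \<inter> space lebesgue \<in> null_sets lebesgue"
    using N(2) lebesgue_distr_translation[of c] null_sets_distr_iff[OF lebesgue_measurable_translation, of N c] by simp
  then show ?thesis by (rule AE_I') (use N in auto)
qed

section \<open>L2 as a complete semi-inner-product space\<close>

abbreviation (input) cscl :: "complex \<Rightarrow> ('a \<Rightarrow> complex) \<Rightarrow> 'a \<Rightarrow> complex" where
  "cscl c f \<equiv> \<lambda>x. c * f x"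

lemma L2_measurable: "L2 f \<Longrightarrow> f \<in> borel_measurable lebesgue" by (simp add: L2_def)

lemma integrable_mult_L2:
  assumes "L2 f" "L2 g" shows "integrable lebesgue (\<lambda>x. f x * cnj (g x))"
proof (rule Bochner_Integration.integrable_bound)
  show "integrable lebesgue (\<lambda>x. (cmod (f x))\<^sup>2 + (cmod (g x))\<^sup>2)" using assms by (auto simp: L2_def)
  show "(\<lambda>x. f x * cnj (g x)) \<in> borel_measurable lebesgue"
    using assms unfolding L2_def by (intro borel_measurable_times borel_measurable_continuous_on[OF continuous_on_cnj[OF continuous_on_id]]) auto
  show "AE x in lebesgue. cmod (f x * cnj (g x)) \<le> norm ((cmod (f x))\<^sup>2 + (cmod (g x))\<^sup>2)"
  proof (rule AE_I2)
    fix x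
    have "0 \<le> (cmod (f x) - cmod (g x))\<^sup>2 + (cmod (f x))\<^sup>2 + (cmod (g x))\<^sup>2" by simp
    then show "cmod (f x * cnj (g x)) \<le> norm ((cmod (f x))\<^sup>2 + (cmod (g x))\<^sup>2)"
      by (simp add: norm_mult power2_diff)
  qed
qed

lemma L2_bound:
  assumes g: "L2 g" and f: "f \<in> borel_measurable lebesgue" and le: "\<And>x. cmod (f x) \<le> C * cmod (g x)"
  shows "L2 f"
  unfolding L2_def
proof (intro conjI f, rule Bochner_Integration.integrable_bound)
  show "integrable lebesgue (\<lambda>x. C\<^sup>2 * (cmod (g x))\<^sup>2)" using g by (auto simp: L2_def)
  show "(\<lambda>x. (cmod (f x))\<^sup>2) \<in> borel_measurable lebesgue" using f by simp
  show "AE x in lebesgue. norm ((cmod (f x))\<^sup>2) \<le> norm (C\<^sup>2 * (cmod (g x))\<^sup>2)"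
    using power_mono[OF le, of _ 2] by (intro AE_I2) (simp add: power_mult_distrib)
qed

lemma L2_scl: "L2 f \<Longrightarrow> L2 (\<lambda>x. c * f x)"
  by (rule L2_bound[of f _ "cmod c"]) (auto simp: L2_def norm_mult)

lemma cmod_add_sq: "(cmod (a + b))\<^sup>2 \<le> 2 * ((cmod a)\<^sup>2 + (cmod b)\<^sup>2)"
proof -
  have "(cmod (a + b))\<^sup>2 \<le> (cmod a + cmod b)\<^sup>2" by (intro power_mono norm_triangle_ineq) auto
  also have "... \<le> 2 * ((cmod a)\<^sup>2 + (cmod b)\<^sup>2)"
    using sum_squares_bound[of "cmod a" "cmod b"] by (simp add: power2_sum)
  finally show ?thesis .
qed

lemma L2_add:
  assumes f: "L2 f" and g: "L2 g" shows "L2 (\<lambda>x. f x + g x)"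
  unfolding L2_def
proof
  note [measurable] = L2_measurable[OF f] L2_measurable[OF g]
  show "(\<lambda>x. f x + g x) \<in> borel_measurable lebesgue" by measurable
  show "integrable lebesgue (\<lambda>x. (cmod (f x + g x))\<^sup>2)"
  proof (rule Bochner_Integration.integrable_bound)
    show "integrable lebesgue (\<lambda>x. 2 * ((cmod (f x))\<^sup>2 + (cmod (g x))\<^sup>2))" using f g by (auto simp: L2_def)
    show "AE x in lebesgue. norm ((cmod (f x + g x))\<^sup>2) \<le> norm (2 * ((cmod (f x))\<^sup>2 + (cmod (g x))\<^sup>2))"
      by (rule AE_I2) (use cmod_add_sq in simp)
  qed measurable
qed

lemma L2_diff: "L2 f \<Longrightarrow> L2 g \<Longrightarrow> L2 (\<lambda>x. f x - g x)"
  using L2_add[of f "\<lambda>x. (-1) * g x"] L2_scl[of g "-1"] by simp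

lemma L2_translate: "L2 f \<Longrightarrow> L2 (\<lambda>x. f (x + c))"
  unfolding L2_def using borel_measurable_translate[of f borel c] integrable_translate[of "\<lambda>x. (cmod (f x))\<^sup>2" c] by blast

interpretation L2: cspace "Collect (L2 :: ('a::euclidean_space \<Rightarrow> complex) \<Rightarrow> bool)" cscl
  by standard (auto simp: plus_fun_def L2_add L2_scl fun_eq_iff)

lemma L2_inner_self: "L2_inner f f = complex_of_real (LINT x|lebesgue. (cmod (f x))\<^sup>2)"
  unfolding L2_inner_def complex_norm_square[symmetric] integral_complex_of_real ..

lemma L2_inner_psd: "L2.psd L2_inner"
  unfolding L2.psd_def L2.sesq_def
proof (intro conjI ballI allI)
  fix f g h :: "'a \<Rightarrow> complex" and c
  assume "f \<in> Collect L2" "g \<in> Collect L2"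
  note i = this[simplified]
  have ii: "integrable lebesgue (\<lambda>x. f x * cnj (g x))" using integrable_mult_L2 i by blast
  show "L2_inner (\<lambda>x. c * f x) g = c * L2_inner f g" "L2_inner f (\<lambda>x. c * g x) = cnj c * L2_inner f g"
    using ii by (simp_all add: L2_inner_def mult.assoc mult.left_commute[of _ "cnj c"])
  show "L2_inner g f = cnj (L2_inner f g)"
    using Bochner_Integration.integral_cnj[of lebesgue "\<lambda>x. f x * cnj (g x)"] by (simp add: L2_inner_def mult.commute)
  assume "h \<in> Collect L2"
  then have "integrable lebesgue (\<lambda>x. f x * cnj (h x))" "integrable lebesgue (\<lambda>x. g x * cnj (h x))"
    using integrable_mult_L2 i by blast+
  then show "L2_inner (f + g) h = L2_inner f h + L2_inner g h" "L2_inner f (g + h) = L2_inner f g + L2_inner f h"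
    using ii by (simp_all add: L2_inner_def algebra_simps)
next
  fix f :: "'a \<Rightarrow> complex" show "0 \<le> Re (L2_inner f f)" by (simp add: L2_inner_self)
qed

lemma L2_norm_eq_nrm: "L2_norm f = L2.nrm L2_inner f"
  by (simp add: L2_norm_def L2.nrm_def L2_inner_self)

lemma L2_inner_sesq: "L2.sesq L2_inner" using L2.psdD(1)[OF L2_inner_psd] .

lemma L2_inner_linear:
  assumes "L2 f" "L2 g" "L2 h"
  shows "L2_inner (\<lambda>x. f x + g x) h = L2_inner f h + L2_inner g h"
    "L2_inner f (\<lambda>x. g x + h x) = L2_inner f g + L2_inner f h"
    "L2_inner (\<lambda>x. c * f x) g = c * L2_inner f g" "L2_inner f (\<lambda>x. c * g x) = cnj c * L2_inner f g"
  using L2_inner_sesq assms unfolding L2.sesq_def plus_fun_def by auto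

lemma L2_inner_commute: "L2 f \<Longrightarrow> L2 g \<Longrightarrow> L2_inner g f = cnj (L2_inner f g)"
  using L2.psdD(2)[OF L2_inner_psd] by blast

lemma L2_norm_sq: "(L2_norm f)\<^sup>2 = (LINT x|lebesgue. (cmod (f x))\<^sup>2)"
  by (simp add: L2_norm_def)

lemma L2_norm_nonneg: "0 \<le> L2_norm f" by (simp add: L2_norm_def)

lemma L2_Cauchy_Schwarz: "L2 f \<Longrightarrow> L2 g \<Longrightarrow> cmod (L2_inner f g) \<le> L2_norm f * L2_norm g"
  using L2.Cauchy_Schwarz[OF L2_inner_psd] by (simp add: L2_norm_eq_nrm)

lemma L2_inner_cong_AE:
  assumes "AE x in lebesgue. f x = f' x" "AE x in lebesgue. g x = g' x" "L2 f" "L2 f'" "L2 g" "L2 g'"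
  shows "L2_inner f g = L2_inner f' g'"
  unfolding L2_inner_def
  by (rule integral_cong_AE) (use assms in \<open>auto dest!: L2_measurable intro!: borel_measurable_times borel_measurable_continuous_on[OF continuous_on_cnj[OF continuous_on_id]]\<close>)

lemma L2_norm_zero_AE: "L2 f \<Longrightarrow> L2_norm f = 0 \<Longrightarrow> AE x in lebesgue. f x = 0"
  unfolding L2_norm_def L2_def by (auto simp: integral_nonneg_eq_0_iff_AE)

text \<open>If \<open>\<Sum> 2\<^sup>k \<parallel>d\<^sub>k\<parallel>\<^sup>2\<close> is finite for the successive differences \<open>d\<^sub>k\<close> of a subsequence, then
  \<open>\<bar>d\<^sub>k(x)\<bar>\<^sup>2 \<le> C(x) 2\<^sup>-\<^sup>k\<close> almost everywhere.\<close>
lemma L2_complete: "L2.complete_for L2_inner"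
  unfolding L2.complete_for_def
proof (intro allI impI, elim conjE)
  fix X :: "nat \<Rightarrow> 'a \<Rightarrow> complex"
  assume X: "\<forall>n. X n \<in> Collect L2" and C: "\<forall>e>0. \<exists>N. \<forall>m\<ge>N. \<forall>n\<ge>N. L2.nrm L2_inner (X m - X n) < e"
  then have X: "L2 (X n)" for n by auto
  note [measurable] = L2_measurable[OF X]
  have Xd: "L2 (X m - X n)" for m n using L2_diff[OF X X, of m n] by (simp add: fun_diff_def)
  have nn: "(\<integral>\<^sup>+x. ennreal ((cmod (X m x - X n x))\<^sup>2) \<partial>lebesgue) = ennreal ((L2_norm (X m - X n))\<^sup>2)" for m n
    using Xd[of m n] unfolding L2_norm_sq by (subst nn_integral_eq_integral) (auto simp: L2_def)
  have C: "\<exists>N. \<forall>m\<ge>N. \<forall>n\<ge>N. L2_norm (X m - X n) < e" if "e > 0" for e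
    using C that by (simp add: L2_norm_eq_nrm)
  have "\<exists>N. \<forall>k. (\<forall>n\<ge>N k. \<forall>m\<ge>N k. L2_norm (X m - X n) < (1/2)^k)" using C by (meson zero_less_power half_gt_zero zero_less_one)
  then obtain N where N: "\<And>k m n. n \<ge> N k \<Longrightarrow> m \<ge> N k \<Longrightarrow> L2_norm (X m - X n) < (1/2)^k" by metis
  \<comment> \<open>The sum makes \<open>r k\<close> at least \<open>N j\<close> for every j <= k,
    not only for j = k.\<close>
  define r where "r k = (\<Sum>j\<le>k. N j) + k" for k
  have rN: "r k \<ge> N k" for k unfolding r_def by (metis atMost_iff finite_atMost le_add1 member_le_sum order_refl order_trans zero_le)
  have rS: "r (Suc k) \<ge> N k" for k using rN[of k] by (simp add: r_def)
  define d where "d k x = X (r (Suc k)) x - X (r k) x" for k x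
  have [measurable]: "d k \<in> borel_measurable lebesgue" for k unfolding d_def[abs_def] by measurable
  have dk: "(\<integral>\<^sup>+x. ennreal ((cmod (d k x))\<^sup>2) \<partial>lebesgue) \<le> ennreal ((1/4)^k)" for k
  proof -
    have "(L2_norm (X (r (Suc k)) - X (r k)))\<^sup>2 \<le> ((1/2)^k)\<^sup>2"
      using N[OF rN rS, of k] L2_norm_nonneg by (intro power_mono) auto
    also have "((1/2)^k)\<^sup>2 = ((1/4::real)^k)" by (simp add: power2_eq_square power_mult_distrib[symmetric])
    finally show ?thesis unfolding d_def nn by (rule ennreal_leI)
  qed
  have "(\<integral>\<^sup>+x. (\<Sum>k. ennreal (2^k * (cmod (d k x))\<^sup>2)) \<partial>lebesgue) = (\<Sum>k. \<integral>\<^sup>+x. ennreal (2^k * (cmod (d k x))\<^sup>2) \<partial>lebesgue)"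
    by (rule nn_integral_suminf) measurable
  also have "... \<le> (\<Sum>k. ennreal ((1/2)^k))"
  proof (intro suminf_le)
    fix k
    have "(\<integral>\<^sup>+x. ennreal (2^k * (cmod (d k x))\<^sup>2) \<partial>lebesgue) = ennreal (2^k) * (\<integral>\<^sup>+x. ennreal ((cmod (d k x))\<^sup>2) \<partial>lebesgue)"
      by (simp add: ennreal_mult' nn_integral_cmult)
    also have "... \<le> ennreal (2^k) * ennreal ((1/4)^k)" by (intro mult_left_mono dk) auto
    also have "... = ennreal ((1/2)^k)" by (simp add: ennreal_mult[symmetric] power_mult_distrib[symmetric])
    finally show "(\<integral>\<^sup>+x. ennreal (2^k * (cmod (d k x))\<^sup>2) \<partial>lebesgue) \<le> ennreal ((1/2)^k)" .
  qed auto
  also have "... = ennreal (\<Sum>k. (1/2)^k)" by (rule suminf_ennreal2) (auto intro: summable_geometric)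
  also have "... < \<infinity>" by simp
  finally have fin: "(\<integral>\<^sup>+x. (\<Sum>k. ennreal (2^k * (cmod (d k x))\<^sup>2)) \<partial>lebesgue) \<noteq> \<infinity>" by simp
  have "AE x in lebesgue. (\<Sum>k. ennreal (2^k * (cmod (d k x))\<^sup>2)) \<noteq> \<infinity>"
    by (rule nn_integral_PInf_AE[OF _ fin]) measurable
  then have conv: "AE x in lebesgue. convergent (\<lambda>k. X (r k) x)"
  proof eventually_elim
    fix x assume "(\<Sum>k. ennreal (2^k * (cmod (d k x))\<^sup>2)) \<noteq> \<infinity>"
    then have sm: "summable (\<lambda>k. 2^k * (cmod (d k x))\<^sup>2)" by (intro summable_suminf_not_top) auto
    define S where "S = (\<Sum>k. 2^k * (cmod (d k x))\<^sup>2)"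
    have S: "2^k * (cmod (d k x))\<^sup>2 \<le> S" for k
      unfolding S_def using sum_le_suminf[OF sm, of "{k}"] by simp
    have "summable (\<lambda>k. d k x)"
    proof (rule summable_comparison_test')
      show "summable (\<lambda>k. sqrt S * (sqrt (1/2))^k)" by (intro summable_mult summable_geometric) (simp add: real_sqrt_lt_1_iff)
      fix k :: nat
      have "(cmod (d k x))\<^sup>2 \<le> S * (1/2)^k" using S[of k] by (simp add: field_simps power_one_over)
      then have "cmod (d k x) \<le> sqrt (S * (1/2)^k)" by (rule real_le_rsqrt)
      then show "norm (d k x) \<le> sqrt S * (sqrt (1/2))^k" by (simp add: real_sqrt_mult real_sqrt_power)
    qed
    then have "convergent (\<lambda>n. (\<Sum>k<n. d k x) + X (r 0) x)"
      using summable_iff_convergent convergent_add convergent_const by blast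
    moreover have "(\<Sum>k<n. d k x) = X (r n) x - X (r 0) x" for n
      unfolding d_def by (rule sum_lessThan_telescope)
    ultimately show "convergent (\<lambda>k. X (r k) x)" by simp
  qed
  define f where "f x = lim (\<lambda>k. X (r k) x)" for x
  have [measurable]: "f \<in> borel_measurable lebesgue" unfolding f_def[abs_def] by measurable
  \<comment> \<open>Fatou's lemma along the subsequence bounds the distance from the limit to every
    late \<open>X n\<close>.\<close>
  have est: "(\<integral>\<^sup>+x. ennreal ((cmod (f x - X n x))\<^sup>2) \<partial>lebesgue) \<le> ennreal ((1/4)^k)" if "n \<ge> N k" for n k
  proof -
    have "(\<integral>\<^sup>+x. ennreal ((cmod (f x - X n x))\<^sup>2) \<partial>lebesgue)
        = (\<integral>\<^sup>+x. liminf (\<lambda>j. ennreal ((cmod (X (r j) x - X n x))\<^sup>2)) \<partial>lebesgue)"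
    proof (rule nn_integral_cong_AE, use conv in eventually_elim)
      fix x assume "convergent (\<lambda>k. X (r k) x)"
      then have "(\<lambda>j. X (r j) x) \<longlonglongrightarrow> f x" unfolding f_def convergent_LIMSEQ_iff .
      then have "(\<lambda>j. ennreal ((cmod (X (r j) x - X n x))\<^sup>2)) \<longlonglongrightarrow> ennreal ((cmod (f x - X n x))\<^sup>2)"
        by (intro tendsto_intros)
      then show "ennreal ((cmod (f x - X n x))\<^sup>2) = liminf (\<lambda>j. ennreal ((cmod (X (r j) x - X n x))\<^sup>2))"
        using lim_imp_Liminf[OF sequentially_bot] by metis
    qed
    also have "... \<le> liminf (\<lambda>j. \<integral>\<^sup>+x. ennreal ((cmod (X (r j) x - X n x))\<^sup>2) \<partial>lebesgue)"
      by (rule nn_integral_liminf) measurable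
    also have "... \<le> liminf (\<lambda>j. ennreal ((1/4)^k))"
    proof (rule Liminf_mono, rule eventually_sequentiallyI[of k])
      fix j assume "k \<le> j"
      then have "r j \<ge> N k" by (auto simp: r_def intro!: trans_le_add1 member_le_sum)
      then have "(L2_norm (X (r j) - X n))\<^sup>2 \<le> ((1/2)^k)\<^sup>2"
        using N[OF that, of "r j"] L2_norm_nonneg by (intro power_mono) auto
      also have "((1/2)^k)\<^sup>2 = ((1/4::real)^k)" by (simp add: power2_eq_square power_mult_distrib[symmetric])
      finally show "(\<integral>\<^sup>+x. ennreal ((cmod (X (r j) x - X n x))\<^sup>2) \<partial>lebesgue) \<le> ennreal ((1/4)^k)"
        unfolding nn by (rule ennreal_leI)
    qed
    also have "... = ennreal ((1/4)^k)" by (simp add: Liminf_const)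
    finally show ?thesis .
  qed
  have int: "integrable lebesgue (\<lambda>x. (cmod (f x - X n x))\<^sup>2)" if "n \<ge> N k" for n k
    using est[OF that] by (intro integrableI_bounded) (auto simp: less_top[symmetric] top_unique)
  have "L2 (\<lambda>x. f x - X (N 0) x)" using int[of 0 "N 0"] by (simp add: L2_def)
  from L2_add[OF this X, of "N 0"] have f: "L2 f" by simp
  have "L2_norm (X n - f) \<le> (1/2)^k" if "n \<ge> N k" for n k
  proof -
    have "ennreal (LINT x|lebesgue. (cmod (f x - X n x))\<^sup>2) \<le> ennreal ((1/4)^k)"
      using est[OF that] nn_integral_eq_integral[OF int[OF that]] by simp
    then have "(L2_norm (X n - f))\<^sup>2 \<le> (1/4)^k" unfolding L2_norm_sq by (simp add: norm_minus_commute)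
    also have "... = ((1/2)^k)\<^sup>2" by (simp add: power2_eq_square power_mult_distrib[symmetric])
    finally show ?thesis by (rule power2_le_imp_le) simp
  qed
  note le = this
  have "(\<lambda>n. L2_norm (X n - f)) \<longlonglongrightarrow> 0"
  proof (rule LIMSEQ_I)
    fix e :: real assume "0 < e"
    then obtain k where "(1/2::real)^k < e" using real_arch_pow_inv[of e "1/2"] by auto
    then have "norm (L2_norm (X n - f) - 0) < e" if "n \<ge> N k" for n
      using le[OF that] L2_norm_nonneg[of "X n - f"] by simp
    then show "\<exists>no. \<forall>n\<ge>no. norm (L2_norm (X n - f) - 0) < e" by blast
  qed
  then show "\<exists>f\<in>Collect L2. (\<lambda>n. L2.nrm L2_inner (X n - f)) \<longlonglongrightarrow> 0"
    using f by (auto simp: L2_norm_eq_nrm)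
qed

section \<open>Test functions\<close>

text \<open>The flat function exp(-1/s) and its quotients by powers of s, of which its derivatives
  are linear combinations; all are continued by 0 to s <= 0.\<close>

definition eta :: "nat \<Rightarrow> real \<Rightarrow> real" where
  "eta k s = (if s \<le> 0 then 0 else exp (- 1 / s) / s ^ k)"

lemma eta_tendsto_0: "(eta k \<longlongrightarrow> 0) (at_right 0)"
proof -
  have "((\<lambda>y. y ^ k / exp y) \<longlongrightarrow> 0) (at_top :: real filter)" by (rule tendsto_power_div_exp_0)
  then have "((\<lambda>s. inverse s ^ k / exp (inverse s)) \<longlongrightarrow> (0::real)) (at_right 0)"
    by (rule filterlim_compose[OF _ filterlim_inverse_at_top_right])
  moreover have "eventually (\<lambda>s. inverse s ^ k / exp (inverse s) = eta k s) (at_right 0)"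
    using eventually_at_right_less[of 0]
    by eventually_elim (simp add: eta_def field_simps exp_minus)
  ultimately show ?thesis by (rule Lim_transform_eventually)
qed

lemma eta_has_derivative:
  "(eta k has_real_derivative (eta (k + 2) s - real k * eta (k + 1) s)) (at s)"
proof -
  consider "s < 0" | "s > 0" | "s = 0" by linarith
  then show ?thesis
  proof cases
    case 1
    have d: "((\<lambda>_. 0) has_real_derivative 0) (at s)" by simp
    have "eventually (\<lambda>t. 0 = eta k t) (nhds s)"
      using eventually_nhds_in_open[of "{..<0}" s] 1 by (auto elim!: eventually_mono simp: eta_def)
    then have "(eta k has_real_derivative 0) (at s)" using DERIV_cong_ev[OF refl _ refl, THEN iffD1, OF _ d] by blast
    then show ?thesis using 1 by (simp add: eta_def)
  next
    case 2
    have "((\<lambda>s. exp (- 1 / s) / s ^ k) has_real_derivative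
       (exp (- 1 / s) * (1 / s\<^sup>2) * s ^ k - exp (- 1 / s) * (real k * s ^ (k - 1))) / (s ^ k)\<^sup>2) (at s)"
      using 2 by (auto intro!: derivative_eq_intros simp: power2_eq_square)
    also have "(exp (- 1 / s) * (1 / s\<^sup>2) * s ^ k - exp (- 1 / s) * (real k * s ^ (k - 1))) / (s ^ k)\<^sup>2
       = eta (k + 2) s - real k * eta (k + 1) s"
      using 2 by (cases k) (simp_all add: eta_def field_simps power2_eq_square)
    finally have d: "((\<lambda>s. exp (- 1 / s) / s ^ k) has_real_derivative (eta (k + 2) s - real k * eta (k + 1) s)) (at s)" .
    have "eventually (\<lambda>t. exp (- 1 / t) / t ^ k = eta k t) (nhds s)"
      using eventually_nhds_in_open[of "{0<..}" s] 2 by (auto elim!: eventually_mono simp: eta_def)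
    then show ?thesis using DERIV_cong_ev[OF refl _ refl, THEN iffD1, OF _ d] by blast
  next
    case 3
    \<comment> \<open>As \<open>eta k 0\<close> is 0, this is the difference quotient at 0; from the
      right it is \<open>eta (Suc k)\<close>, which tends to 0.\<close>
    have "((\<lambda>h. eta k h / h) \<longlongrightarrow> 0) (at 0)"
      unfolding filterlim_at_split
    proof
      show "((\<lambda>h. eta k h / h) \<longlongrightarrow> 0) (at_left 0)"
        by (rule tendsto_eventually) (auto simp: eta_def eventually_at_left_field intro!: exI[of _ "-1"])
      show "((\<lambda>h. eta k h / h) \<longlongrightarrow> 0) (at_right 0)"
        by (rule Lim_transform_eventually[OF eta_tendsto_0[of "Suc k"]])
           (use eventually_at_right_less[of 0] in eventually_elim, simp add: eta_def)
    qed
    then show ?thesis using 3 by (simp add: has_field_derivative_iff eta_def)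
  qed
qed

text \<open>An algebra of functions that is closed under partial derivatives, hence consists of smooth functions.\<close>
inductive eta_algebra :: "('a::euclidean_space \<Rightarrow> complex) \<Rightarrow> bool" where
  const: "eta_algebra (\<lambda>x. c)"
| eta: "eta_algebra (\<lambda>x. complex_of_real (eta k (x \<bullet> v + r)))"
| add: "eta_algebra f \<Longrightarrow> eta_algebra g \<Longrightarrow> eta_algebra (\<lambda>x. f x + g x)"
| mult: "eta_algebra f \<Longrightarrow> eta_algebra g \<Longrightarrow> eta_algebra (\<lambda>x. f x * g x)"

lemma eta_algebra_derivative:
  "eta_algebra f \<Longrightarrow> \<exists>f'. (\<forall>x. (f has_derivative f' x) (at x)) \<and> (\<forall>b. eta_algebra (\<lambda>x. f' x b))"
proof (induction rule: eta_algebra.induct)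
  case (const c)
  show ?case by (intro exI[of _ "\<lambda>_ _. 0"]) (auto intro: eta_algebra.const)
next
  case (eta k v r)
  define e' where "e' s = eta (k + 2) s - real k * eta (k + 1) s" for s
  have "((\<lambda>x. complex_of_real (eta k (x \<bullet> v + r))) has_derivative (\<lambda>h. complex_of_real (e' (x \<bullet> v + r) * (h \<bullet> v)))) (at x)" for x
  proof -
    have "(eta k has_derivative (\<lambda>h. h * e' (x \<bullet> v + r))) (at (x \<bullet> v + r))"
      using eta_has_derivative[of k "x \<bullet> v + r"]
      unfolding e'_def[symmetric] has_field_derivative_def
      by (simp add: mult.commute[of _ "e' (x \<bullet> v + r)"])
    then have "((\<lambda>x. eta k (x \<bullet> v + r)) has_derivative (\<lambda>h. (h \<bullet> v) * e' (x \<bullet> v + r))) (at x)"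
      by (rule has_derivative_compose[rotated]) (auto intro!: derivative_eq_intros)
    from has_derivative_of_real[OF this, where 'a=complex] show ?thesis by (simp add: mult.commute)
  qed
  moreover have "eta_algebra (\<lambda>x. complex_of_real (e' (x \<bullet> v + r) * (b \<bullet> v)))" for b
  proof -
    have "eta_algebra (\<lambda>x. (complex_of_real (eta (k + 2) (x \<bullet> v + r))
       + complex_of_real (- real k) * complex_of_real (eta (k + 1) (x \<bullet> v + r))) * complex_of_real (b \<bullet> v))"
      by (intro eta_algebra.intros)
    then show ?thesis by (simp add: e'_def)
  qed
  ultimately show ?case by (intro exI[of _ "\<lambda>x h. complex_of_real (e' (x \<bullet> v + r) * (h \<bullet> v))"]) blast
next
  case (add f g)
  then obtain f' g' where "\<And>x. (f has_derivative f' x) (at x)" "\<And>b. eta_algebra (\<lambda>x. f' x b)"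
    "\<And>x. (g has_derivative g' x) (at x)" "\<And>b. eta_algebra (\<lambda>x. g' x b)" by blast
  then show ?case
    by (intro exI[of _ "\<lambda>x h. f' x h + g' x h"]) (auto intro: has_derivative_add eta_algebra.add)
next
  case (mult f g)
  then obtain f' g' where d: "\<And>x. (f has_derivative f' x) (at x)" "\<And>b. eta_algebra (\<lambda>x. f' x b)"
    "\<And>x. (g has_derivative g' x) (at x)" "\<And>b. eta_algebra (\<lambda>x. g' x b)" by blast
  then show ?case using mult.hyps
    by (intro exI[of _ "\<lambda>x h. f x * g' x h + f' x h * g x"])
       (auto intro!: has_derivative_mult eta_algebra.add eta_algebra.mult)
qed

lemma eta_algebra_smooth: "eta_algebra f \<Longrightarrow> smooth_fun f"
proof (coinduction arbitrary: f)
  case smooth_fun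
  then obtain f' where f': "\<And>x. (f has_derivative f' x) (at x)" "\<And>b. eta_algebra (\<lambda>x. f' x b)"
    using eta_algebra_derivative by blast
  then have "frechet_derivative f (at x) = f' x" for x by (metis frechet_derivative_at)
  then show ?case using f' by (auto simp: differentiable_def)
qed

lemma smooth_funD:
  assumes "smooth_fun f"
  shows "f differentiable (at x)" "b \<in> Basis \<Longrightarrow> smooth_fun (pderiv_cl f b)"
  using assms by (auto elim: smooth_fun.cases simp: pderiv_cl_def[abs_def])

lemma smooth_fun_has_derivative: "smooth_fun f \<Longrightarrow> (f has_derivative frechet_derivative f (at x)) (at x)"
  using smooth_funD(1) frechet_derivative_works by blast

lemma has_derivative_shift:
  assumes "(f has_derivative f') (at (x + c))" shows "((\<lambda>x. f (x + c)) has_derivative f') (at x)"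
proof -
  have "((\<lambda>x. x + c) has_derivative (\<lambda>h. h)) (at x)" by (auto intro!: derivative_eq_intros)
  from has_derivative_compose[OF this assms] show ?thesis .
qed

lemma pderiv_cl_translate:
  assumes "smooth_fun f" shows "pderiv_cl (\<lambda>x. f (x + c)) b x = pderiv_cl f b (x + c)"
  unfolding pderiv_cl_def
  using has_derivative_shift[OF smooth_fun_has_derivative[OF assms, of "x + c"]] by (metis frechet_derivative_at)

lemma smooth_fun_translate: "smooth_fun f \<Longrightarrow> smooth_fun (\<lambda>x. f (x + c))"
proof (coinduction arbitrary: f)
  case smooth_fun
  have "(\<lambda>x. frechet_derivative (\<lambda>x. f (x + c)) (at x) b) = (\<lambda>x. pderiv_cl f b (x + c))" for b
    using pderiv_cl_translate[OF smooth_fun, of c b] by (auto simp: pderiv_cl_def)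
  moreover have "(\<lambda>x. f (x + c)) differentiable at x" for x
    using has_derivative_shift[OF smooth_fun_has_derivative[OF smooth_fun]] by (auto simp: differentiable_def)
  ultimately show ?case using smooth_funD(2)[OF smooth_fun] by auto
qed

lemma smooth_fun_continuous: "smooth_fun f \<Longrightarrow> continuous_on S f"
  by (intro continuous_at_imp_continuous_on ballI differentiable_imp_continuous_within smooth_funD(1))

lemma test_fun_support:
  assumes "test_fun \<phi>"
  obtains K where "compact K" "\<And>x. x \<notin> K \<Longrightarrow> \<phi> x = 0" "\<And>x b. x \<notin> K \<Longrightarrow> pderiv_cl \<phi> b x = 0"
proof
  let ?K = "closure {x. \<phi> x \<noteq> 0}"
  show "compact ?K" using assms by (simp add: test_fun_def)
  show z: "\<phi> x = 0" if "x \<notin> ?K" for x using that closure_subset[of "{x. \<phi> x \<noteq> 0}"] by auto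
  fix x b assume x: "x \<notin> ?K"
  have "(\<phi> has_derivative (\<lambda>_. 0)) (at x)"
  proof (rule has_derivative_transform_within_open[of "\<lambda>_. 0" _ _ _ "- ?K"])
    show "0 = \<phi> y" if "y \<in> - ?K" for y using z[of y] that by simp
  qed (use x in \<open>simp_all add: open_Compl\<close>)
  then show "pderiv_cl \<phi> b x = 0" unfolding pderiv_cl_def by (metis frechet_derivative_at)
qed

lemma continuous_compact_support_bounded:
  fixes f :: "'a::euclidean_space \<Rightarrow> complex"
  assumes "continuous_on UNIV f" "compact K" "\<And>x. x \<notin> K \<Longrightarrow> f x = 0"
  obtains C where "C > 0" "\<And>x. cmod (f x) \<le> C"
proof -
  have "bounded (f ` K)"
    by (rule compact_imp_bounded[OF compact_continuous_image[OF continuous_on_subset[OF assms(1)] assms(2)]]) auto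
  then obtain C where C: "C > 0" "\<And>x. x \<in> K \<Longrightarrow> cmod (f x) \<le> C" by (auto simp: bounded_pos)
  then have "cmod (f x) \<le> C" for x using assms(3)[of x] by (cases "x \<in> K") (auto simp: C less_imp_le)
  then show ?thesis using that C(1) by blast
qed

lemma test_fun_bounded:
  assumes "test_fun \<phi>" "b \<in> Basis"
  obtains K C where "compact K" "\<And>x. x \<notin> K \<Longrightarrow> \<phi> x = 0" "\<And>x. x \<notin> K \<Longrightarrow> pderiv_cl \<phi> b x = 0"
    "C > 0" "\<And>x. cmod (\<phi> x) \<le> C" "\<And>x. cmod (pderiv_cl \<phi> b x) \<le> C"
proof -
  obtain K where K: "compact K" "\<And>x. x \<notin> K \<Longrightarrow> \<phi> x = 0" "\<And>x. x \<notin> K \<Longrightarrow> pderiv_cl \<phi> b x = 0"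
    using test_fun_support[OF assms(1)] by metis
  have s: "smooth_fun \<phi>" using assms by (simp add: test_fun_def)
  obtain C1 where C1: "C1 > 0" "\<And>x. cmod (\<phi> x) \<le> C1"
    using continuous_compact_support_bounded[OF smooth_fun_continuous[OF s] K(1,2)] by metis
  obtain C2 where C2: "C2 > 0" "\<And>x. cmod (pderiv_cl \<phi> b x) \<le> C2"
    using continuous_compact_support_bounded[OF smooth_fun_continuous[OF smooth_funD(2)[OF s assms(2)]] K(1,3)] by metis
  show ?thesis
    by (rule that[OF K, of "max C1 C2"]) (use C1 C2 in \<open>auto intro: max.coboundedI1 max.coboundedI2\<close>)
qed

lemma test_fun_translate: "test_fun \<phi> \<Longrightarrow> test_fun (\<lambda>x. \<phi> (x + c))"
proof -
  assume t: "test_fun \<phi>"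
  have "{x. \<phi> (x + c) \<noteq> 0} = (\<lambda>x. - c + x) ` {x. \<phi> x \<noteq> 0}"
  proof (intro set_eqI iffI)
    fix x assume "x \<in> {x. \<phi> (x + c) \<noteq> 0}"
    then show "x \<in> (\<lambda>x. - c + x) ` {x. \<phi> x \<noteq> 0}" by (intro image_eqI[of _ _ "x + c"]) auto
  qed auto
  then have "closure {x. \<phi> (x + c) \<noteq> 0} = (\<lambda>x. - c + x) ` closure {x. \<phi> x \<noteq> 0}"
    using closure_translation by metis
  then show ?thesis using t compact_translation smooth_fun_translate unfolding test_fun_def by metis
qed

text \<open>The factors are \<open>eta 0\<close> at n (x_b - l_b) and at n (u_b - x_b), written in
  the shape that \<open>eta_algebra\<close> accepts. As n grows each tends to 1 inside the open box,
  so these test functions approximate its indicator.\<close>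

definition box_bump :: "'a::euclidean_space \<Rightarrow> 'a \<Rightarrow> nat \<Rightarrow> 'a \<Rightarrow> complex" where
  "box_bump l u n x = (\<Prod>b\<in>Basis. complex_of_real (eta 0 (x \<bullet> (real n *\<^sub>R b) + (- (real n * (l \<bullet> b)))))
      * complex_of_real (eta 0 (x \<bullet> (- real n *\<^sub>R b) + real n * (u \<bullet> b))))"

lemma eta0_pos: "s > 0 \<Longrightarrow> eta 0 s = exp (- 1 / s)" and eta0_nonpos: "s \<le> 0 \<Longrightarrow> eta 0 s = 0"
  and eta0_le_1: "0 \<le> eta 0 s \<and> eta 0 s \<le> 1"
  by (auto simp: eta_def)

lemma box_bump_support: "box_bump l u n x \<noteq> 0 \<Longrightarrow> x \<in> cbox l u"
proof (rule ccontr)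
  assume nz: "box_bump l u n x \<noteq> 0" and "x \<notin> cbox l u"
  then obtain b where b: "b \<in> Basis" "x \<bullet> b < l \<bullet> b \<or> u \<bullet> b < x \<bullet> b" by (auto simp: mem_box not_le)
  then have "real n * (x \<bullet> b) \<le> real n * (l \<bullet> b) \<or> real n * (u \<bullet> b) \<le> real n * (x \<bullet> b)"
    by (auto intro: mult_left_mono)
  then have "\<exists>b\<in>Basis. complex_of_real (eta 0 (x \<bullet> (real n *\<^sub>R b) + (- (real n * (l \<bullet> b)))))
      * complex_of_real (eta 0 (x \<bullet> (- real n *\<^sub>R b) + real n * (u \<bullet> b))) = 0"
    using b by (intro bexI[of _ b]) (auto simp: eta0_nonpos)
  then have "box_bump l u n x = 0" unfolding box_bump_def by (intro prod_zero) auto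
  then show False using nz by simp
qed

lemma box_bump_test_fun: "test_fun (box_bump l u n)"
proof -
  have "eta_algebra (\<lambda>x. \<Prod>b\<in>S. complex_of_real (eta 0 (x \<bullet> (real n *\<^sub>R b) + (- (real n * (l \<bullet> b)))))
      * complex_of_real (eta 0 (x \<bullet> (- real n *\<^sub>R b) + real n * (u \<bullet> b))))" if "finite S" for S
    using that
  proof (induction S)
    case empty
    show ?case by (simp add: eta_algebra.const)
  next
    case (insert b S)
    show ?case unfolding prod.insert[OF insert(1,2)] by (intro eta_algebra.mult eta_algebra.eta insert)
  qed
  then have "smooth_fun (box_bump l u n)"
    unfolding box_bump_def[abs_def] by (intro eta_algebra_smooth) auto
  moreover have "closure {x. box_bump l u n x \<noteq> 0} \<subseteq> cbox l u"
    by (intro closure_minimal) (auto dest: box_bump_support)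
  ultimately show ?thesis unfolding test_fun_def
    by (meson bounded_cbox bounded_subset closed_closure compact_eq_bounded_closed)
qed

lemma box_bump_le_1: "cmod (box_bump l u n x) \<le> 1"
  unfolding box_bump_def prod_norm[symmetric] norm_mult
  by (intro prod_le_1) (use eta0_le_1 in \<open>auto intro!: mult_le_one\<close>)

lemma box_bump_tendsto: "(\<lambda>n. box_bump l u n x) \<longlonglongrightarrow> indicator (box l u) x"
proof (cases "x \<in> box l u")
  case False
  have "box_bump l u n x = 0" for n
  proof -
    obtain b where b: "b \<in> Basis" "x \<bullet> b \<le> l \<bullet> b \<or> u \<bullet> b \<le> x \<bullet> b" using False by (auto simp: mem_box not_less)
    then have "real n * (x \<bullet> b) \<le> real n * (l \<bullet> b) \<or> real n * (u \<bullet> b) \<le> real n * (x \<bullet> b)"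
      by (auto intro: mult_left_mono)
    then have "\<exists>b\<in>Basis. complex_of_real (eta 0 (x \<bullet> (real n *\<^sub>R b) + (- (real n * (l \<bullet> b)))))
        * complex_of_real (eta 0 (x \<bullet> (- real n *\<^sub>R b) + real n * (u \<bullet> b))) = 0"
      using b by (intro bexI[of _ b]) (auto simp: eta0_nonpos)
    then show ?thesis unfolding box_bump_def by (intro prod_zero) auto
  qed
  then show ?thesis using False by simp
next
  case True
  have lim: "(\<lambda>n. eta 0 (real n * s)) \<longlonglongrightarrow> 1" if s: "s > 0" for s
  proof -
    have "(\<lambda>n. exp (- ((1 / s) * (1 / real n)))) \<longlonglongrightarrow> exp (- ((1 / s) * 0))"
      by (intro tendsto_intros lim_1_over_n)
    then have "(\<lambda>n. exp (- ((1 / s) * (1 / real n)))) \<longlonglongrightarrow> 1" by simp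
    moreover have "eventually (\<lambda>n. exp (- ((1 / s) * (1 / real n))) = eta 0 (real n * s)) sequentially"
      using eventually_gt_at_top[of 0] by eventually_elim (use s in \<open>simp add: eta0_pos field_simps\<close>)
    ultimately show ?thesis by (rule Lim_transform_eventually)
  qed
  have "(\<lambda>n. box_bump l u n x) \<longlonglongrightarrow> (\<Prod>b\<in>(Basis::'a set). complex_of_real 1 * complex_of_real 1)"
    unfolding box_bump_def
  proof (intro tendsto_prod tendsto_mult tendsto_of_real)
    fix b :: 'a assume "b \<in> Basis"
    then have b: "x \<bullet> b - l \<bullet> b > 0" "u \<bullet> b - x \<bullet> b > 0" using True by (auto simp: mem_box)
    show "(\<lambda>n. eta 0 (x \<bullet> (real n *\<^sub>R b) + (- (real n * (l \<bullet> b))))) \<longlonglongrightarrow> 1"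
      using lim[OF b(1)] by (simp add: algebra_simps)
    show "(\<lambda>n. eta 0 (x \<bullet> (- real n *\<^sub>R b) + real n * (u \<bullet> b))) \<longlonglongrightarrow> 1"
      using lim[OF b(2)] by (simp add: algebra_simps)
  qed
  then show ?thesis using True by simp
qed

lemma lebesgue_ex_borel_complex:
  fixes f :: "'a::euclidean_space \<Rightarrow> complex"
  assumes "f \<in> borel_measurable lebesgue"
  obtains f' where "f' \<in> borel_measurable borel" "AE x in lebesgue. f x = f' x"
proof -
  have "(\<lambda>x. Re (f x)) \<in> borel_measurable lebesgue" "(\<lambda>x. Im (f x)) \<in> borel_measurable lebesgue" using assms by auto
  then obtain r i where "r \<in> borel_measurable lborel" "AE x in lborel. Re (f x) = r x"
    "i \<in> borel_measurable lborel" "AE x in lborel. Im (f x) = i x"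
    using completion_ex_borel_measurable_real by metis
  then have "(\<lambda>x. Complex (r x) (i x)) \<in> borel_measurable borel" "AE x in lborel. f x = Complex (r x) (i x)"
    by (auto simp: complex_eq_iff borel_measurable_complex_iff)
  then show ?thesis using that AE_completion by blast
qed

text \<open>Boxes are an intersection-stable generator of the Borel sets, so the integral vanishes
  on every Borel set. The whole space is not a box, hence the assumption \<open>UNIV\<close>, which
  serves the complement step.\<close>

lemma AE_eq_0_if_integral_box_0:
  fixes h :: "'a::euclidean_space \<Rightarrow> complex"
  assumes h: "integrable lborel h" and 0: "\<And>l u. set_lebesgue_integral lborel (box l u) h = 0"
    and UNIV: "(LINT x|lborel. h x) = 0"
  shows "AE x in lborel. h x = 0"
proof (rule sigma_finite_measure.density_zero[OF sigma_finite_lborel h])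
  fix A assume "A \<in> sets (lborel :: 'a measure)"
  then have A: "A \<in> sigma_sets UNIV (range (\<lambda>(a, b). box a b::'a set))" by (simp add: borel_eq_box)
  have "Int_stable (range (\<lambda>(a, b). box a b::'a set))" by (auto simp: Int_stable_def box_Int_box)
  moreover have "range (\<lambda>(a, b). box a b::'a set) \<subseteq> Pow UNIV" by simp
  ultimately show "set_lebesgue_integral lborel A h = 0" using A
  proof (induct rule: sigma_sets_induct_disjoint)
    case (basic A) then show ?case using 0 by auto
  next
    case empty show ?case by (simp add: set_lebesgue_integral_def)
  next
    case (compl A)
    then have A: "A \<in> sets lborel" by (simp add: borel_eq_box)
    have "set_lebesgue_integral lborel (UNIV - A) h + set_lebesgue_integral lborel A h = set_lebesgue_integral lborel UNIV h"
      using A h by (subst set_integral_Un[symmetric]) (auto simp: set_integrable_def integrable_mult_indicator)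
    then show ?case using compl UNIV by (simp add: set_lebesgue_integral_def)
  next
    case (union A)
    then have A: "A i \<in> sets lborel" for i by (auto simp: borel_eq_box)
    have "set_lebesgue_integral lborel (\<Union>i. A i) h = (\<Sum>i. set_lebesgue_integral lborel (A i) h)"
      using union A h
      by (intro lebesgue_integral_countable_add) (auto simp: disjoint_family_on_def set_integrable_def integrable_mult_indicator)
    then show ?case using union by simp
  qed
qed

text \<open>Dominated convergence along \<open>box_bump\<close> shows that g integrates to 0 over
  every box; this is then localised to an exhausting sequence of boxes.\<close>

lemma fundamental_lemma:
  assumes g: "loc_integrable g" and 0: "\<And>\<phi>. test_fun \<phi> \<Longrightarrow> (LINT x|lebesgue. g x * \<phi> x) = 0"
  shows "AE x in lebesgue. g x = 0"
proof -
  have gm: "g \<in> borel_measurable lebesgue" using g by (simp add: loc_integrable_def)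
  have box0: "set_lebesgue_integral lebesgue (box l u) g = 0" for l u
  proof -
    have ib: "integrable lebesgue (\<lambda>x. indicat_real (cbox l u) x *\<^sub>R g x)"
      using g by (auto simp: loc_integrable_def set_integrable_def)
    have "(\<lambda>n. LINT x|lebesgue. g x * box_bump l u n x) \<longlonglongrightarrow> (LINT x|lebesgue. indicat_real (box l u) x *\<^sub>R g x)"
    proof (rule integral_dominated_convergence[OF _ _ integrable_norm[OF ib]])
      show "(\<lambda>x. indicat_real (box l u) x *\<^sub>R g x) \<in> borel_measurable lebesgue"
        by (intro borel_measurable_scaleR borel_measurable_indicator gm) auto
      show "(\<lambda>x. g x * box_bump l u n x) \<in> borel_measurable lebesgue" for n
        using gm smooth_fun_continuous[of "box_bump l u n" UNIV] box_bump_test_fun[of l u n]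
        by (intro borel_measurable_times) (auto simp: test_fun_def intro!: measurable_completion borel_measurable_continuous_onI)
      show "AE x in lebesgue. (\<lambda>n. g x * box_bump l u n x) \<longlonglongrightarrow> indicat_real (box l u) x *\<^sub>R g x"
      proof (rule AE_I2)
        fix x
        show "(\<lambda>n. g x * box_bump l u n x) \<longlonglongrightarrow> indicat_real (box l u) x *\<^sub>R g x"
          using tendsto_mult_left[OF box_bump_tendsto[of l u x], of "g x"] by (cases "x \<in> box l u") auto
      qed
      show "AE x in lebesgue. cmod (g x * box_bump l u n x) \<le> norm (indicat_real (cbox l u) x *\<^sub>R g x)" for n
      proof (rule AE_I2)
        fix x
        show "cmod (g x * box_bump l u n x) \<le> norm (indicat_real (cbox l u) x *\<^sub>R g x)"
          using box_bump_support[of l u n x] mult_left_mono[OF box_bump_le_1[of l u n x], of "cmod (g x)"]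
          by (cases "box_bump l u n x = 0") (auto simp: norm_mult)
      qed
    qed
    then show ?thesis by (simp add: 0[OF box_bump_test_fun] set_lebesgue_integral_def LIMSEQ_const_iff)
  qed
  have "AE x in lebesgue. x \<in> box (- real n *\<^sub>R One) (real n *\<^sub>R One) \<longrightarrow> g x = 0" for n
  proof -
    define B :: "'a set" where "B = box (- real n *\<^sub>R One) (real n *\<^sub>R One)"
    \<comment> \<open>The box criterion lives on \<open>lborel\<close>, so g is replaced by a Borel
      representative, cut off to B to become integrable.\<close>
    obtain g' where g': "g' \<in> borel_measurable borel" "AE x in lebesgue. g x = g' x"
      using lebesgue_ex_borel_complex[OF gm] .
    have gB: "integrable lebesgue (\<lambda>x. indicat_real (cbox (- real n *\<^sub>R One) (real n *\<^sub>R One)) x *\<^sub>R g x)"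
      using g by (auto simp: loc_integrable_def set_integrable_def)
    have "integrable lebesgue (\<lambda>x. indicat_real B x *\<^sub>R g x)"
    proof (rule Bochner_Integration.integrable_bound[OF gB])
      show "(\<lambda>x. indicat_real B x *\<^sub>R g x) \<in> borel_measurable lebesgue"
        unfolding B_def by (intro borel_measurable_scaleR borel_measurable_indicator gm) auto
      have "B \<subseteq> cbox (- real n *\<^sub>R One) (real n *\<^sub>R One)" unfolding B_def by (rule box_subset_cbox)
      then have "indicat_real B x \<le> indicat_real (cbox (- real n *\<^sub>R One) (real n *\<^sub>R One)) x" for x
        by (auto simp: indicator_def)
      then show "AE x in lebesgue. norm (indicat_real B x *\<^sub>R g x)
          \<le> norm (indicat_real (cbox (- real n *\<^sub>R One) (real n *\<^sub>R One)) x *\<^sub>R g x)"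
        by (intro AE_I2) (simp add: mult_right_mono)
    qed
    then have "integrable lebesgue (\<lambda>x. indicat_real B x *\<^sub>R g' x)"
      by (rule integrable_cong_AE_imp) (use g' gm in \<open>auto simp: B_def intro!: borel_measurable_scaleR measurable_completion\<close>)
    then have ib: "integrable lborel (\<lambda>x. indicat_real B x *\<^sub>R g' x)"
      by (subst (asm) integrable_completion) (use g' in \<open>auto simp: B_def intro!: borel_measurable_scaleR\<close>)
    have i0: "set_lebesgue_integral lborel (box l u) (\<lambda>x. indicat_real B x *\<^sub>R g' x) = 0" for l u
    proof -
      have m: "(\<lambda>x. indicat_real (box l' u') x *\<^sub>R g' x) \<in> borel_measurable borel" for l' u'
        by (intro borel_measurable_scaleR borel_measurable_indicator g'(1)) auto
      \<comment> \<open>Boxes are closed under intersection, so the cut-off is absorbed into the box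
        of integration.\<close>
      obtain l' u' where lu: "box l u \<inter> B = box l' u'" unfolding B_def box_Int_box by blast
      have "set_lebesgue_integral lborel (box l u) (\<lambda>x. indicat_real B x *\<^sub>R g' x) = set_lebesgue_integral lborel (box l' u') g'"
        unfolding set_lebesgue_integral_def lu[symmetric] indicator_inter_arith scaleR_scaleR ..
      also have "... = set_lebesgue_integral lebesgue (box l' u') g'"
        unfolding set_lebesgue_integral_def
        by (rule integral_completion[symmetric]) (subst measurable_lborel2, rule m)
      also have "... = set_lebesgue_integral lebesgue (box l' u') g"
        unfolding set_lebesgue_integral_def
      proof (rule integral_cong_AE)
        show "(\<lambda>x. indicat_real (box l' u') x *\<^sub>R g' x) \<in> borel_measurable lebesgue"
          by (rule measurable_completion) (subst measurable_lborel2, rule m)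
        show "(\<lambda>x. indicat_real (box l' u') x *\<^sub>R g x) \<in> borel_measurable lebesgue"
          by (intro borel_measurable_scaleR borel_measurable_indicator gm) auto
      qed (use g'(2) in \<open>eventually_elim, simp\<close>)
      finally show ?thesis using box0 by simp
    qed
    have "AE x in lborel. indicat_real B x *\<^sub>R g' x = 0"
    proof (rule AE_eq_0_if_integral_box_0[OF ib i0])
      have "(LINT x|lborel. indicat_real B x *\<^sub>R g' x) = set_lebesgue_integral lborel B (\<lambda>x. indicat_real B x *\<^sub>R g' x)"
        unfolding set_lebesgue_integral_def by (auto intro!: Bochner_Integration.integral_cong simp: indicator_def)
      then show "(LINT x|lborel. indicat_real B x *\<^sub>R g' x) = 0" using i0 unfolding B_def by simp
    qed
    then have "AE x in lebesgue. indicat_real B x *\<^sub>R g' x = 0" by (rule AE_completion)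
    then show ?thesis using g'(2) unfolding B_def[symmetric] by eventually_elim (auto simp: indicator_def)
  qed
  then have "AE x in lebesgue. \<forall>n. x \<in> box (- real n *\<^sub>R One) (real n *\<^sub>R One) \<longrightarrow> g x = 0"
    by (subst AE_all_countable) blast
  then show ?thesis
  proof eventually_elim
    fix x assume *: "\<forall>n. x \<in> box (- real n *\<^sub>R One) (real n *\<^sub>R One) \<longrightarrow> g x = 0"
    have "x \<in> (\<Union>n. box (- (real n *\<^sub>R One)) (real n *\<^sub>R One))" unfolding UN_box_eq_UNIV by simp
    then show "g x = 0" using * by (auto simp: scaleR_minus_left)
  qed
qed

section \<open>Weak derivatives and difference quotients\<close>

text \<open>The bilinear distributional pairing. The conjugate turns it into an inner product, so
  that Cauchy-Schwarz and continuity in L2 apply.\<close>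

definition pairing :: "('a::euclidean_space \<Rightarrow> complex) \<Rightarrow> ('a \<Rightarrow> complex) \<Rightarrow> complex" where
  "pairing f \<phi> = L2_inner f (\<lambda>x. cnj (\<phi> x))"

lemma pairing_eq: "pairing f \<phi> = (LINT x|lebesgue. f x * \<phi> x)"
  by (simp add: pairing_def L2_inner_def)

lemma borel_measurable_cnj: "f \<in> borel_measurable M \<Longrightarrow> (\<lambda>x. cnj (f x)) \<in> borel_measurable M"
  by (rule borel_measurable_continuous_on[OF continuous_on_cnj[OF continuous_on_id]])

lemma continuous_borel_measurable_lebesgue:
  fixes f :: "'a::euclidean_space \<Rightarrow> 'b::topological_space"
  assumes "continuous_on UNIV f" shows "f \<in> borel_measurable lebesgue"
  by (rule measurable_completion) (use borel_measurable_continuous_onI[OF assms] in simp)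

lemma lmeasurable_integrable_indicator: "K \<in> lmeasurable \<Longrightarrow> integrable lebesgue (indicat_real K)"
  unfolding fmeasurable_def by (intro integrable_real_indicator) auto

lemma L2_bounded_compact_support:
  fixes f :: "'a::euclidean_space \<Rightarrow> complex"
  assumes f: "f \<in> borel_measurable lebesgue" and K: "compact K" and 0: "\<And>x. x \<notin> K \<Longrightarrow> f x = 0"
    and C: "\<And>x. cmod (f x) \<le> C"
  shows "L2 f" "(L2_norm f)\<^sup>2 \<le> C\<^sup>2 * measure lebesgue K"
proof -
  have le: "(cmod (f x))\<^sup>2 \<le> C\<^sup>2 * indicat_real K x" for x
    using power_mono[OF C, of x 2] 0[of x] by (cases "x \<in> K") auto
  have i: "integrable lebesgue (\<lambda>x. C\<^sup>2 * indicat_real K x)"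
    using lmeasurable_integrable_indicator[OF lmeasurable_compact[OF K]] by simp
  have "integrable lebesgue (\<lambda>x. (cmod (f x))\<^sup>2)"
    by (rule Bochner_Integration.integrable_bound[OF i]) (use f le in auto)
  then show "L2 f" using f by (simp add: L2_def)
  have "(L2_norm f)\<^sup>2 \<le> (LINT x|lebesgue. C\<^sup>2 * indicat_real K x)"
    unfolding L2_norm_sq by (rule integral_mono[OF \<open>integrable lebesgue (\<lambda>x. (cmod (f x))\<^sup>2)\<close> i le])
  then show "(L2_norm f)\<^sup>2 \<le> C\<^sup>2 * measure lebesgue K"
    using lmeasurable_compact[OF K] by (simp add: fmeasurable_def)
qed

lemma test_fun_L2: assumes "test_fun \<phi>" shows "L2 \<phi>" "L2 (\<lambda>x. cnj (\<phi> x))"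
proof -
  obtain K where K: "compact K" "\<And>x. x \<notin> K \<Longrightarrow> \<phi> x = 0" using test_fun_support[OF assms] by metis
  have c: "continuous_on UNIV \<phi>" using assms by (simp add: test_fun_def smooth_fun_continuous)
  obtain C where C: "\<And>x. cmod (\<phi> x) \<le> C" using continuous_compact_support_bounded[OF c K] by metis
  show "L2 \<phi>" by (rule L2_bounded_compact_support[OF continuous_borel_measurable_lebesgue[OF c] K C])
  then show "L2 (\<lambda>x. cnj (\<phi> x))" by (simp add: L2_def borel_measurable_cnj)
qed

lemma test_fun_pderiv:
  assumes "test_fun \<phi>" "b \<in> Basis" shows "test_fun (pderiv_cl \<phi> b)"
proof -
  obtain K where K: "compact K" "\<And>x. x \<notin> K \<Longrightarrow> pderiv_cl \<phi> b x = 0"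
    using test_fun_support[OF assms(1)] by metis
  have "closure {x. pderiv_cl \<phi> b x \<noteq> 0} \<subseteq> K"
    by (rule closure_minimal) (use K in \<open>auto simp: compact_imp_closed\<close>)
  then have "compact (closure {x. pderiv_cl \<phi> b x \<noteq> 0})"
    by (meson K(1) bounded_subset closed_closure compact_eq_bounded_closed)
  then show ?thesis using smooth_funD(2) assms by (auto simp: test_fun_def)
qed

lemma L2_loc_integrable: assumes "L2 f" shows "loc_integrable f"
  unfolding loc_integrable_def
proof (intro conjI allI impI)
  show f: "f \<in> borel_measurable lebesgue" using assms by (rule L2_measurable)
  fix K :: "'a set" assume K: "compact K"
  have Km: "K \<in> sets lebesgue" using lmeasurable_compact[OF K] by (simp add: fmeasurable_def)
  have i: "integrable lebesgue (\<lambda>x. (cmod (f x))\<^sup>2 + indicat_real K x)"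
    using assms lmeasurable_integrable_indicator[OF lmeasurable_compact[OF K]] by (simp add: L2_def)
  show "set_integrable lebesgue K f"
    unfolding set_integrable_def
  proof (rule Bochner_Integration.integrable_bound[OF i])
    show "(\<lambda>x. indicat_real K x *\<^sub>R f x) \<in> borel_measurable lebesgue"
      using Km by (intro borel_measurable_scaleR borel_measurable_indicator f)
    have "cmod (f x) \<le> (cmod (f x))\<^sup>2 + 1" for x
    proof -
      have "2 * cmod (f x) \<le> (cmod (f x))\<^sup>2 + 1"
        using zero_le_power2[of "cmod (f x) - 1"] unfolding power2_diff by simp
      then show ?thesis using norm_ge_zero[of "f x"] by linarith
    qed
    then show "AE x in lebesgue. norm (indicat_real K x *\<^sub>R f x) \<le> norm ((cmod (f x))\<^sup>2 + indicat_real K x)"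
      by (intro AE_I2) (auto simp: indicator_def)
  qed
qed

lemma loc_integrable_mult_test:
  assumes g: "loc_integrable g" and "test_fun \<phi>" shows "integrable lebesgue (\<lambda>x. g x * \<phi> x)"
proof -
  obtain K where K: "compact K" "\<And>x. x \<notin> K \<Longrightarrow> \<phi> x = 0" using test_fun_support[OF assms(2)] by metis
  have c: "continuous_on UNIV \<phi>" using assms by (simp add: test_fun_def smooth_fun_continuous)
  obtain C where C: "\<And>x. cmod (\<phi> x) \<le> C" using continuous_compact_support_bounded[OF c K] by metis
  have i: "integrable lebesgue (\<lambda>x. C * cmod (indicat_real K x *\<^sub>R g x))"
    using g K by (auto simp: loc_integrable_def set_integrable_def simp del: norm_scaleR intro!: integrable_norm integrable_mult_right)
  show ?thesis
  proof (rule Bochner_Integration.integrable_bound[OF i])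
    show "(\<lambda>x. g x * \<phi> x) \<in> borel_measurable lebesgue"
      using g continuous_borel_measurable_lebesgue[OF c] by (auto simp: loc_integrable_def intro: borel_measurable_times)
    have "cmod (g x * \<phi> x) \<le> norm (C * cmod (indicat_real K x *\<^sub>R g x))" for x
    proof (cases "x \<in> K")
      case True
      have "C \<ge> 0" using C[of x] norm_ge_zero[of "\<phi> x"] by linarith
      then show ?thesis using True C[of x] mult_right_mono[OF C[of x], of "cmod (g x)"] by (simp add: norm_mult abs_mult mult.commute)
    qed (use K in simp)
    then show "AE x in lebesgue. norm (g x * \<phi> x) \<le> norm (C * cmod (indicat_real K x *\<^sub>R g x))" by simp
  qed
qed

lemma fundamental_lemma_eq:
  assumes f: "loc_integrable f" and g: "loc_integrable g"
    and eq: "\<And>\<phi>. test_fun \<phi> \<Longrightarrow> (LINT x|lebesgue. f x * \<phi> x) = (LINT x|lebesgue. g x * \<phi> x)"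
  shows "AE x in lebesgue. f x = g x"
proof -
  have l: "loc_integrable (\<lambda>x. f x - g x)"
    using f g unfolding loc_integrable_def set_integrable_def by (auto simp: scaleR_diff_right)
  have "(LINT x|lebesgue. (f x - g x) * \<phi> x) = 0" if "test_fun \<phi>" for \<phi>
    using eq[OF that] loc_integrable_mult_test[OF f that] loc_integrable_mult_test[OF g that]
    by (simp add: left_diff_distrib)
  from fundamental_lemma[OF l this] show ?thesis by simp
qed

lemma weak_pderiv_unique:
  assumes "is_weak_pderiv f b g" "is_weak_pderiv f b h" shows "AE x in lebesgue. g x = h x"
  by (rule fundamental_lemma_eq) (use assms in \<open>auto simp: is_weak_pderiv_def\<close>)

lemma L2_cong_AE:
  assumes "L2 f" "AE x in lebesgue. f x = g x" "g \<in> borel_measurable lebesgue" shows "L2 g"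
proof -
  have m: "(\<lambda>x. (cmod (g x))\<^sup>2) \<in> borel_measurable lebesgue" using assms(3) by simp
  have "AE x in lebesgue. (cmod (f x))\<^sup>2 = (cmod (g x))\<^sup>2" using assms(2) by eventually_elim simp
  from integrable_cong_AE_imp[OF _ m this] assms(1,3) show ?thesis by (simp add: L2_def)
qed

lemma L2_norm_cong_AE:
  assumes "L2 f" "L2 g" "AE x in lebesgue. f x = g x" shows "L2_norm f = L2_norm g"
  using L2_inner_cong_AE[OF assms(3,3) assms(1,2,1,2)] by (simp add: L2_norm_eq_nrm L2.nrm_def)

text \<open>The choice in \<open>weak_pderiv\<close> ranges over all weak derivatives; uniqueness
  almost everywhere transfers square-integrability to whichever one is chosen.\<close>

lemma H1_weak_pderiv:
  assumes "f \<in> H1" "b \<in> Basis"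
  shows "is_weak_pderiv f b (weak_pderiv f b)" "L2 (weak_pderiv f b)"
proof -
  obtain g where g: "is_weak_pderiv f b g" "L2 g" using assms by (auto simp: H1_def)
  show w: "is_weak_pderiv f b (weak_pderiv f b)" unfolding weak_pderiv_def by (rule someI[of "is_weak_pderiv f b", OF g(1)])
  show "L2 (weak_pderiv f b)"
    by (rule L2_cong_AE[OF g(2) weak_pderiv_unique[OF g(1) w]])
       (use w in \<open>auto simp: is_weak_pderiv_def loc_integrable_def\<close>)
qed

text \<open>Weak sequential compactness of balls, by passing to convex combinations.\<close>
lemma weak_limit_L2:
  fixes z :: "nat \<Rightarrow> 'a::euclidean_space \<Rightarrow> complex"
  assumes z: "\<And>n. L2 (z n)" and B: "\<And>n. L2_norm (z n) \<le> B"
    and lim: "\<And>\<phi>. test_fun \<phi> \<Longrightarrow> (\<lambda>n. pairing (z n) \<phi>) \<longlonglongrightarrow> \<Lambda> \<phi>"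
  obtains y where "L2 y" "L2_norm y \<le> B" "\<And>\<phi>. test_fun \<phi> \<Longrightarrow> pairing y \<phi> = \<Lambda> \<phi>"
proof -
  \<comment> \<open>A stand-in for the closed convex hull of the tail from n on: members inherit the
    norm bound and every bound on the pairings that holds along the tail.\<close>
  define C where "C n = {y. L2 y \<and> L2_norm y \<le> B \<and>
     (\<forall>\<phi> \<delta>. test_fun \<phi> \<and> (\<forall>k\<ge>n. cmod (pairing (z k) \<phi> - \<Lambda> \<phi>) \<le> \<delta>) \<longrightarrow> cmod (pairing y \<phi> - \<Lambda> \<phi>) \<le> \<delta>)}" for n
  define mid where "mid x y = cscl (1/2) (x + y)" for x y :: "'a \<Rightarrow> complex"
  have zC: "z n \<in> C n" for n using z B by (auto simp: C_def)
  have B0: "0 \<le> B" using B[of 0] L2_norm_nonneg[of "z 0"] by linarith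
  have nsq: "Re (L2_inner x x) = (L2_norm x)\<^sup>2" for x :: "'a \<Rightarrow> complex" by (simp add: L2_norm_sq L2_inner_self)
  have mid_L2: "L2 (mid x y)" if "L2 x" "L2 y" for x y
    unfolding mid_def plus_fun_def by (intro L2_scl L2_add that)
  have midC: "mid x y \<in> C n" if "x \<in> C n" "y \<in> C n" for x y n
  proof -
    have xy: "L2 x" "L2 y" "L2_norm x \<le> B" "L2_norm y \<le> B" using that by (auto simp: C_def)
    have "L2.nrm L2_inner (x + y) \<le> L2_norm x + L2_norm y"
      unfolding L2_norm_eq_nrm by (rule L2.nrm_triangle[OF L2_inner_psd]) (use xy in auto)
    moreover have "L2_norm (mid x y) = L2.nrm L2_inner (x + y) / 2"
      using L2.nrm_scl[OF L2_inner_psd, of "x + y" "1/2"] L2_add[OF xy(1,2)]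
      by (simp add: L2_norm_eq_nrm mid_def plus_fun_def)
    ultimately have "L2_norm (mid x y) \<le> B" using xy by simp
    moreover have "cmod (pairing (mid x y) \<phi> - \<Lambda> \<phi>) \<le> \<delta>"
      if t: "test_fun \<phi>" and d: "\<forall>k\<ge>n. cmod (pairing (z k) \<phi> - \<Lambda> \<phi>) \<le> \<delta>" for \<phi> \<delta>
    proof -
      have p: "pairing (mid x y) \<phi> = (pairing x \<phi> + pairing y \<phi>) / 2"
        using L2_inner_linear(1)[OF xy(1,2) test_fun_L2(2)[OF t]]
          L2_inner_linear(3)[OF L2_add[OF xy(1,2)] test_fun_L2(2)[OF t] test_fun_L2(2)[OF t], of "1/2"]
        by (simp add: pairing_def mid_def plus_fun_def)
      have "cmod (pairing x \<phi> - \<Lambda> \<phi>) \<le> \<delta>" "cmod (pairing y \<phi> - \<Lambda> \<phi>) \<le> \<delta>"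
        using \<open>x \<in> C n\<close> \<open>y \<in> C n\<close> t d unfolding C_def by blast+
      moreover have e: "pairing (mid x y) \<phi> - \<Lambda> \<phi> = ((pairing x \<phi> - \<Lambda> \<phi>) + (pairing y \<phi> - \<Lambda> \<phi>)) / 2"
        unfolding p by (simp add: field_simps)
      ultimately show ?thesis
        using norm_triangle_ineq[of "pairing x \<phi> - \<Lambda> \<phi>" "pairing y \<phi> - \<Lambda> \<phi>"] unfolding e norm_divide by simp
    qed
    ultimately show ?thesis using mid_L2 xy unfolding C_def by blast
  qed
  obtain Y where Y: "\<And>n. Y n \<in> C n" "\<And>e. e > 0 \<Longrightarrow> \<exists>N. \<forall>m\<ge>N. \<forall>n\<ge>N. Re (L2_inner (Y m - Y n) (Y m - Y n)) < e"
  proof (rule minimising_sequence_Cauchy[of C 0 "\<lambda>x. Re (L2_inner x x)" "B\<^sup>2" mid "\<lambda>x y. Re (L2_inner (x - y) (x - y))"])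
    show "C n \<subseteq> C m" if "m \<le> n" for m n using that order_trans unfolding C_def by blast
    show "\<exists>x\<in>C n. Re (L2_inner x x) \<le> B\<^sup>2" for n
      using zC[of n] power_mono[OF B L2_norm_nonneg, of n 2] nsq by auto
    show "Re (L2_inner (x - y) (x - y)) = 2 * Re (L2_inner x x) + 2 * Re (L2_inner y y) - 4 * Re (L2_inner (mid x y) (mid x y))"
      if "x \<in> C n" "y \<in> C n" for n x y
      unfolding mid_def by (rule L2.sesq_midpoint[OF L2_inner_sesq]) (use that in \<open>auto simp: C_def\<close>)
  qed (use midC nsq in auto)
  have YL: "L2 (Y n)" "L2_norm (Y n) \<le> B" for n using Y(1)[of n] by (auto simp: C_def)
  have "\<exists>N. \<forall>m\<ge>N. \<forall>n\<ge>N. L2.nrm L2_inner (Y m - Y n) < e" if "e > 0" for e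
    using Y(2)[of "e\<^sup>2"] that by (force simp: L2.nrm_def intro: real_less_lsqrt)
  then obtain y where y: "L2 y" "(\<lambda>n. L2.nrm L2_inner (Y n - y)) \<longlonglongrightarrow> 0"
    using L2_complete YL(1) unfolding L2.complete_for_def by (metis mem_Collect_eq)
  have CS: "cmod (L2_inner x y) \<le> 1 * L2.nrm L2_inner x * L2.nrm L2_inner y"
    if "x \<in> Collect L2" "y \<in> Collect L2" for x y :: "'a \<Rightarrow> complex"
    using L2.Cauchy_Schwarz[OF L2_inner_psd that] by simp
  note lims = L2.bounded_sesq_tendsto[OF L2_inner_sesq L2_inner_psd CS _ _ y(2)]
  have "(\<lambda>n. Re (L2_inner (Y n) (Y n))) \<longlonglongrightarrow> Re (L2_inner y y)"
    by (intro tendsto_Re lims(2)) (use YL y in auto)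
  then have "Re (L2_inner y y) \<le> B\<^sup>2"
    by (rule LIMSEQ_le_const2) (use YL(2) L2_norm_nonneg nsq in \<open>auto intro!: exI[of _ 0] power_mono\<close>)
  then have yB: "L2_norm y \<le> B" unfolding nsq using B0 power2_le_imp_le by blast
  have "pairing y \<phi> = \<Lambda> \<phi>" if t: "test_fun \<phi>" for \<phi>
  proof (rule LIMSEQ_unique)
    show "(\<lambda>n. pairing (Y n) \<phi>) \<longlonglongrightarrow> pairing y \<phi>"
      unfolding pairing_def by (rule lims(1)) (use YL y test_fun_L2(2)[OF t] in auto)
    show "(\<lambda>n. pairing (Y n) \<phi>) \<longlonglongrightarrow> \<Lambda> \<phi>"
    proof (rule LIMSEQ_I)
      fix e :: real assume "0 < e"
      then obtain N where N: "\<And>k. k \<ge> N \<Longrightarrow> cmod (pairing (z k) \<phi> - \<Lambda> \<phi>) < e / 2"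
        using LIMSEQ_D[OF lim[OF t], of "e/2"] by auto
      have "cmod (pairing (Y n) \<phi> - \<Lambda> \<phi>) \<le> e / 2" if "n \<ge> N" for n
      proof -
        have "\<forall>k\<ge>n. cmod (pairing (z k) \<phi> - \<Lambda> \<phi>) \<le> e / 2" using N that by (meson less_imp_le order_trans)
        then show ?thesis using Y(1)[of n] t unfolding C_def by blast
      qed
      then show "\<exists>N. \<forall>n\<ge>N. norm (pairing (Y n) \<phi> - \<Lambda> \<phi>) < e" using \<open>0 < e\<close> by (intro exI[of _ N]) force
    qed
  qed
  then show ?thesis using that y(1) yB by blast
qed

text \<open>Gradients are accessed through these undivided differences, on which moduli, phases and
  quotients can be estimated pointwise.\<close>

definition sdiff :: "real \<Rightarrow> 'a::euclidean_space \<Rightarrow> ('a \<Rightarrow> complex) \<Rightarrow> 'a \<Rightarrow> complex" where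
  "sdiff t b f = (\<lambda>x. f (x + t *\<^sub>R b) - f x)"

lemma L2_sdiff: "L2 f \<Longrightarrow> L2 (sdiff t b f)"
  unfolding sdiff_def by (intro L2_diff L2_translate)

lemma L2_norm_translate: "L2 f \<Longrightarrow> L2_norm (\<lambda>x. f (x + c)) = L2_norm f"
  using integral_translate[of "\<lambda>x. (cmod (f x))\<^sup>2" c] by (auto simp: L2_norm_def L2_def dest: borel_measurable_integrable)

lemma smooth_line_derivative:
  assumes "smooth_fun \<phi>"
  shows "((\<lambda>s. \<phi> (x - s *\<^sub>R b)) has_vector_derivative - pderiv_cl \<phi> b (x - s *\<^sub>R b)) (at s within S)"
proof -
  have "((\<lambda>s. x - s *\<^sub>R b) has_derivative (\<lambda>h. - (h *\<^sub>R b))) (at s within S)"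
    by (auto intro!: derivative_eq_intros)
  from has_derivative_compose[OF this smooth_fun_has_derivative[OF assms]]
  have d: "((\<lambda>s. \<phi> (x - s *\<^sub>R b)) has_derivative (\<lambda>h. frechet_derivative \<phi> (at (x - s *\<^sub>R b)) (- (h *\<^sub>R b)))) (at s within S)" .
  have "linear (frechet_derivative \<phi> (at (x - s *\<^sub>R b)))"
    by (rule linear_frechet_derivative[OF smooth_funD(1)[OF assms]])
  then have "(\<lambda>h. frechet_derivative \<phi> (at (x - s *\<^sub>R b)) (- (h *\<^sub>R b))) = (\<lambda>h. h *\<^sub>R (- pderiv_cl \<phi> b (x - s *\<^sub>R b)))"
    by (auto simp: pderiv_cl_def linear_neg linear_scale)
  then show ?thesis using d by (simp add: has_vector_derivative_def)
qed

lemma test_fun_taylor: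
  assumes t: "test_fun \<phi>" and b: "b \<in> Basis"
  obtains C R where "C \<ge> 0" "R \<ge> 0"
    "\<And>x s. 0 \<le> s \<Longrightarrow> s \<le> 1 \<Longrightarrow> cmod (\<phi> (x - s *\<^sub>R b) - \<phi> x + s * pderiv_cl \<phi> b x) \<le> C * s\<^sup>2"
    "\<And>x s. 0 \<le> s \<Longrightarrow> s \<le> 1 \<Longrightarrow> x \<notin> cball 0 R \<Longrightarrow> \<phi> (x - s *\<^sub>R b) - \<phi> x + s * pderiv_cl \<phi> b x = 0"
proof -
  let ?p = "pderiv_cl \<phi> b"
  have s: "smooth_fun \<phi>" and sp: "smooth_fun ?p" using t b smooth_funD(2) by (auto simp: test_fun_def)
  obtain K1 where K: "compact K1" "\<And>x. x \<notin> K1 \<Longrightarrow> \<phi> x = 0" "\<And>x. x \<notin> K1 \<Longrightarrow> ?p x = 0"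
    using test_fun_support[OF t] by metis
  obtain C where C: "C > 0" "\<And>x. cmod (pderiv_cl ?p b x) \<le> C"
    using test_fun_bounded[OF test_fun_pderiv[OF t b] b] by metis
  obtain R where R: "R > 0" "\<And>x. x \<in> K1 \<Longrightarrow> norm x \<le> R" using compact_imp_bounded[OF K(1)] by (auto simp: bounded_pos)
  \<comment> \<open>The linearisation error contributes 2 C s and the linear term C s.\<close>
  have 1: "cmod (?p (x - s *\<^sub>R b) - ?p x) \<le> 3 * C * s" if "0 \<le> s" for x s
  proof -
    have "cmod (?p (x - s *\<^sub>R b) - ?p (x - 0 *\<^sub>R b) - (s - 0) *\<^sub>R (- pderiv_cl ?p b (x - 0 *\<^sub>R b))) \<le> norm (s - 0) * (2 * C)"
    proof (rule vector_differentiable_bound_linearization[where S=UNIV])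
      show "((\<lambda>s. ?p (x - s *\<^sub>R b)) has_vector_derivative - pderiv_cl ?p b (x - r *\<^sub>R b)) (at r within UNIV)" for r
        by (rule smooth_line_derivative[OF sp])
      show "norm (- pderiv_cl ?p b (x - r *\<^sub>R b) - - pderiv_cl ?p b (x - 0 *\<^sub>R b)) \<le> 2 * C" for r
        using norm_triangle_ineq4[of "- pderiv_cl ?p b (x - r *\<^sub>R b)" "- pderiv_cl ?p b (x - 0 *\<^sub>R b)"]
          C(2)[of "x - r *\<^sub>R b"] C(2)[of "x - 0 *\<^sub>R b"] by simp
    qed auto
    moreover have "cmod ((s - 0) *\<^sub>R (- pderiv_cl ?p b (x - 0 *\<^sub>R b))) \<le> s * C"
      using C(2)[of x] that by (simp add: mult_left_mono)
    ultimately show ?thesis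
      using norm_triangle_sub[of "?p (x - s *\<^sub>R b) - ?p (x - 0 *\<^sub>R b)" "(s - 0) *\<^sub>R (- pderiv_cl ?p b (x - 0 *\<^sub>R b))"] that
      by (simp add: algebra_simps)
  qed
  show thesis
  \<comment> \<open>The radius grows by 1 because x - s b lies within distance 1 of x.\<close>
  proof (rule that[of "3 * C" "R + 1"])
    fix x :: 'a and s :: real assume s01: "0 \<le> s" "s \<le> 1"
    have "cmod (\<phi> (x - s *\<^sub>R b) - \<phi> (x - 0 *\<^sub>R b) - (s - 0) *\<^sub>R (- ?p (x - 0 *\<^sub>R b))) \<le> norm (s - 0) * (3 * C * s)"
    proof (rule vector_differentiable_bound_linearization[where S="{0..s}"])
      show "((\<lambda>s. \<phi> (x - s *\<^sub>R b)) has_vector_derivative - ?p (x - r *\<^sub>R b)) (at r within {0..s})" for r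
        by (rule smooth_line_derivative[OF s])
      show "norm (- ?p (x - r *\<^sub>R b) - - ?p (x - 0 *\<^sub>R b)) \<le> 3 * C * s" if "r \<in> {0..s}" for r
      proof -
        have "norm (- ?p (x - r *\<^sub>R b) - - ?p (x - 0 *\<^sub>R b)) \<le> 3 * C * r"
          using 1[of r x] that by (simp add: norm_minus_commute)
        also have "... \<le> 3 * C * s" using that C(1) by (intro mult_left_mono) auto
        finally show ?thesis .
      qed
    qed (use s01 in \<open>auto simp: closed_segment_eq_real_ivl\<close>)
    then show "cmod (\<phi> (x - s *\<^sub>R b) - \<phi> x + s * ?p x) \<le> 3 * C * s\<^sup>2"
      using s01 by (simp add: scaleR_conv_of_real power2_eq_square mult_ac)
    assume "x \<notin> cball 0 (R + 1)"
    then have nx: "norm x > R + 1" by simp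
    have "norm x \<le> norm (x - s *\<^sub>R b) + norm (s *\<^sub>R b)" using norm_triangle_ineq[of "x - s *\<^sub>R b" "s *\<^sub>R b"] by simp
    also have "norm (s *\<^sub>R b) \<le> 1" using s01 b by simp
    finally have "norm (x - s *\<^sub>R b) > R" using nx by simp
    then have "x \<notin> K1" "x - s *\<^sub>R b \<notin> K1" using nx R by force+
    then show "\<phi> (x - s *\<^sub>R b) - \<phi> x + s * ?p x = 0" using K by simp
  qed (use C R in auto)
qed

lemma pairing_translate:
  assumes f: "L2 f" and t: "test_fun \<phi>"
  shows "pairing (\<lambda>x. f (x + c)) \<phi> = pairing f (\<lambda>x. \<phi> (x - c))"
  using integral_translate[of "\<lambda>x. f x * \<phi> (x - c)" c] L2_measurable[OF f]
    L2_measurable[OF test_fun_L2(1)[OF test_fun_translate[OF t, of "-c"]]]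
  by (simp add: pairing_eq)

lemma pairing_diff:
  "L2 f \<Longrightarrow> L2 g \<Longrightarrow> test_fun \<phi> \<Longrightarrow> pairing (\<lambda>x. f x - g x) \<phi> = pairing f \<phi> - pairing g \<phi>"
  unfolding pairing_eq by (simp add: left_diff_distrib loc_integrable_mult_test[OF L2_loc_integrable])

text \<open>Moving the translation onto the test function leaves a Taylor remainder with L2 norm of
  order s^2. The constant is chosen before f, so it serves all translates of a function at
  once.\<close>

lemma sdiff_pairing:
  assumes t: "test_fun \<phi>" and b: "b \<in> Basis"
  obtains C where "C \<ge> 0" "\<And>f s. L2 f \<Longrightarrow> 0 \<le> s \<Longrightarrow> s \<le> 1 \<Longrightarrow>
    cmod (pairing (sdiff s b f) \<phi> + s * pairing f (pderiv_cl \<phi> b)) \<le> C * s\<^sup>2 * L2_norm f"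
proof -
  obtain C R where CR: "C \<ge> 0" "R \<ge> 0"
    "\<And>x s. 0 \<le> s \<Longrightarrow> s \<le> 1 \<Longrightarrow> cmod (\<phi> (x - s *\<^sub>R b) - \<phi> x + s * pderiv_cl \<phi> b x) \<le> C * s\<^sup>2"
    "\<And>x s. 0 \<le> s \<Longrightarrow> s \<le> 1 \<Longrightarrow> x \<notin> cball 0 R \<Longrightarrow> \<phi> (x - s *\<^sub>R b) - \<phi> x + s * pderiv_cl \<phi> b x = 0"
    using test_fun_taylor[OF t b] by metis
  define V where "V = sqrt (measure lebesgue (cball (0::'a) R))"
  show thesis
  proof (rule that[of "C * V"])
    show "C * V \<ge> 0" using CR by (simp add: V_def)
    fix f :: "'a \<Rightarrow> complex" and s :: real assume f: "L2 f" and s: "0 \<le> s" "s \<le> 1"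
    define \<psi> where "\<psi> x = cnj (\<phi> (x - s *\<^sub>R b)) - cnj (\<phi> x) + s * cnj (pderiv_cl \<phi> b x)" for x
    have psi: "\<psi> x = cnj (\<phi> (x - s *\<^sub>R b) - \<phi> x + s * pderiv_cl \<phi> b x)" for x by (simp add: \<psi>_def)
    have t1: "test_fun (\<lambda>x. \<phi> (x - s *\<^sub>R b))" using test_fun_translate[OF t, of "- s *\<^sub>R b"] by simp
    have l: "L2 (\<lambda>x. cnj (\<phi> (x - s *\<^sub>R b)))" "L2 (\<lambda>x. cnj (\<phi> x))" "L2 (\<lambda>x. cnj (pderiv_cl \<phi> b x))"
      by (intro test_fun_L2 t1 t test_fun_pderiv b)+
    have lpsi: "L2 \<psi>" unfolding \<psi>_def[abs_def] by (intro L2_add L2_diff L2_scl l)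
    have "(L2_norm \<psi>)\<^sup>2 \<le> (C * s\<^sup>2)\<^sup>2 * measure lebesgue (cball (0::'a) R)"
      by (rule L2_bounded_compact_support(2)) (use lpsi L2_measurable CR(3,4)[OF s] in \<open>auto simp: psi simp del: complex_cnj_diff complex_cnj_add\<close>)
    then have "L2_norm \<psi> \<le> sqrt ((C * s\<^sup>2)\<^sup>2 * measure lebesgue (cball (0::'a) R))" by (rule real_le_rsqrt)
    also have "... = C * s\<^sup>2 * V" using CR(1) by (simp add: real_sqrt_mult V_def)
    finally have n: "L2_norm \<psi> \<le> C * s\<^sup>2 * V" .
    have "L2_inner f \<psi> = pairing f (\<lambda>x. \<phi> (x - s *\<^sub>R b)) - pairing f \<phi> + s * pairing f (pderiv_cl \<phi> b)"
    proof -
      have "integrable lebesgue (\<lambda>x. f x * \<phi> (x - s *\<^sub>R b))" "integrable lebesgue (\<lambda>x. f x * \<phi> x)"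
        "integrable lebesgue (\<lambda>x. f x * pderiv_cl \<phi> b x)"
        by (intro loc_integrable_mult_test L2_loc_integrable f t t1 test_fun_pderiv b)+
      then show ?thesis by (simp add: L2_inner_def pairing_eq psi algebra_simps mult.left_commute[of _ "complex_of_real s"])
    qed
    also have "pairing f (\<lambda>x. \<phi> (x - s *\<^sub>R b)) - pairing f \<phi> = pairing (sdiff s b f) \<phi>"
      unfolding sdiff_def using pairing_diff[OF L2_translate[OF f] f t] pairing_translate[OF f t] by simp
    finally have e: "pairing (sdiff s b f) \<phi> + s * pairing f (pderiv_cl \<phi> b) = L2_inner f \<psi>" by simp
    have "cmod (L2_inner f \<psi>) \<le> L2_norm f * (C * s\<^sup>2 * V)"
      using L2_Cauchy_Schwarz[OF f lpsi] mult_left_mono[OF n L2_norm_nonneg[of f]] by linarith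
    then show "cmod (pairing (sdiff s b f) \<phi> + s * pairing f (pderiv_cl \<phi> b)) \<le> C * V * s\<^sup>2 * L2_norm f"
      unfolding e by (simp add: mult_ac)
  qed
qed

lemma L2_zero: "L2 (\<lambda>x. 0)" by (simp add: L2_def)

lemma L2_norm_add: "L2 f \<Longrightarrow> L2 g \<Longrightarrow> L2_norm (\<lambda>x. f x + g x) \<le> L2_norm f + L2_norm g"
  using L2.nrm_triangle[OF L2_inner_psd, of f g] by (simp add: L2_norm_eq_nrm plus_fun_def)

lemma L2_norm_scl: "L2 f \<Longrightarrow> L2_norm (\<lambda>x. c * f x) = cmod c * L2_norm f"
  using L2.nrm_scl[OF L2_inner_psd, of f c] by (simp add: L2_norm_eq_nrm)

lemma L2_norm_mono:
  assumes "L2 g" "f \<in> borel_measurable lebesgue" "\<And>x. cmod (f x) \<le> cmod (g x)"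
  shows "L2_norm f \<le> L2_norm g"
proof -
  have "L2 f" by (rule L2_bound[OF assms(1,2), of 1]) (use assms(3) in simp)
  then show ?thesis unfolding L2_norm_def
    using assms by (intro real_sqrt_le_mono integral_mono) (auto simp: L2_def intro: power_mono)
qed

lemma L2_sum:
  assumes "\<And>i. L2 (u i)"
  shows "L2 (\<lambda>x. \<Sum>i<n. u i x)" "L2_norm (\<lambda>x. \<Sum>i<(n::nat). u i x) \<le> (\<Sum>i<n. L2_norm (u i))"
    "test_fun \<phi> \<Longrightarrow> pairing (\<lambda>x. \<Sum>i<n. u i x) \<phi> = (\<Sum>i<n. pairing (u i) \<phi>)"
proof -
  have "L2 (\<lambda>x. \<Sum>i<n. u i x) \<and> L2_norm (\<lambda>x. \<Sum>i<n. u i x) \<le> (\<Sum>i<n. L2_norm (u i)) \<and>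
     (test_fun \<phi> \<longrightarrow> pairing (\<lambda>x. \<Sum>i<n. u i x) \<phi> = (\<Sum>i<n. pairing (u i) \<phi>))"
  proof (induction n)
    case 0 show ?case by (simp add: L2_zero L2_norm_def pairing_eq)
  next
    case (Suc n)
    then have IH: "L2 (\<lambda>x. \<Sum>i<n. u i x)" "L2_norm (\<lambda>x. \<Sum>i<n. u i x) \<le> (\<Sum>i<n. L2_norm (u i))" by auto
    have "pairing (\<lambda>x. (\<Sum>i<n. u i x) + u n x) \<phi> = pairing (\<lambda>x. \<Sum>i<n. u i x) \<phi> + pairing (u n) \<phi>" if "test_fun \<phi>"
      unfolding pairing_def by (rule L2_inner_linear(1)[OF IH(1) assms test_fun_L2(2)[OF that]])
    then show ?case using Suc IH L2_add[OF IH(1) assms, of n] L2_norm_add[OF IH(1) assms, of n]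
      unfolding sum.lessThan_Suc by auto
  qed
  then show "L2 (\<lambda>x. \<Sum>i<n. u i x)" "L2_norm (\<lambda>x. \<Sum>i<(n::nat). u i x) \<le> (\<Sum>i<n. L2_norm (u i))"
    "test_fun \<phi> \<Longrightarrow> pairing (\<lambda>x. \<Sum>i<n. u i x) \<phi> = (\<Sum>i<n. pairing (u i) \<phi>)" by auto
qed

lemma pairing_scl: "pairing (\<lambda>x. c * f x) \<phi> = c * pairing f \<phi>"
  unfolding pairing_eq by (simp add: mult.assoc)

lemma is_weak_pderiv_iff:
  assumes "L2 f" "L2 g"
  shows "is_weak_pderiv f b g \<longleftrightarrow> (\<forall>\<phi>. test_fun \<phi> \<longrightarrow> pairing f (pderiv_cl \<phi> b) = - pairing g \<phi>)"
  using assms by (simp add: is_weak_pderiv_def pairing_eq L2_loc_integrable)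

lemma is_weak_pderiv_translate:
  assumes "L2 f" "L2 g" "is_weak_pderiv f b g" "b \<in> Basis"
  shows "is_weak_pderiv (\<lambda>x. f (x + c)) b (\<lambda>x. g (x + c))"
proof -
  have "pairing (\<lambda>x. f (x + c)) (pderiv_cl \<phi> b) = - pairing (\<lambda>x. g (x + c)) \<phi>" if t: "test_fun \<phi>" for \<phi>
  proof -
    have s: "test_fun (\<lambda>x. \<phi> (x - c))" using test_fun_translate[OF t, of "-c"] by simp
    have "pderiv_cl (\<lambda>x. \<phi> (x - c)) b = (\<lambda>x. pderiv_cl \<phi> b (x - c))"
      using pderiv_cl_translate[of \<phi> "-c" b] t by (auto simp: test_fun_def)
    then show ?thesis
      using assms(3)[unfolded is_weak_pderiv_iff[OF assms(1,2)], rule_format, OF s] pairing_translate[OF assms(1) test_fun_pderiv[OF t assms(4)], of c] pairing_translate[OF assms(2) t, of c]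
      by simp
  qed
  then show ?thesis by (simp add: is_weak_pderiv_iff[OF L2_translate L2_translate] assms)
qed

lemma is_weak_pderiv_linear:
  assumes "L2 f" "L2 g" "is_weak_pderiv f b f'" "is_weak_pderiv g b g'" "L2 f'" "L2 g'" "b \<in> Basis"
  shows "is_weak_pderiv (\<lambda>x. f x + c * g x) b (\<lambda>x. f' x + c * g' x)"
proof -
  have p: "pairing (\<lambda>x. f x + c * g x) \<phi> = pairing f \<phi> + c * pairing g \<phi>"
    if "L2 f" "L2 g" "test_fun \<phi>" for f g :: "'a \<Rightarrow> complex" and \<phi>
    using L2_inner_linear(1)[OF that(1) L2_scl[OF that(2)] test_fun_L2(2)[OF that(3)]] pairing_scl[of c g \<phi>]
    by (simp add: pairing_def)
  show ?thesis
    using assms by (auto simp: is_weak_pderiv_iff L2_add L2_scl p test_fun_pderiv algebra_simps)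
qed

text \<open>In the weak sense f(x + t b) - f(x) is the integral of g(x + s b) over 0 <= s <= t. Its
  Riemann sums \<open>z n\<close> have norm at most t times that of g and converge against test
  functions, so the weak limit inherits the bound.\<close>

lemma L2_norm_sdiff_le:
  assumes f: "L2 f" and g: "L2 g" and w: "is_weak_pderiv f b g" and b: "b \<in> Basis" and t: "0 \<le> t" "t \<le> 1"
  shows "L2_norm (sdiff t b f) \<le> t * L2_norm g"
proof -
  define h where "h n = t / real (Suc n)" for n
  define G where "G n i x = g (x + (real i * h n) *\<^sub>R b)" for n i x
  define F where "F n i x = f (x + (real i * h n) *\<^sub>R b)" for n i x
  define z where "z n x = complex_of_real (h n) * (\<Sum>i<Suc n. G n i x)" for n x
  have h: "0 \<le> h n" "h n \<le> 1" "real (Suc n) * h n = t" for n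
    using t by (auto simp: h_def field_simps intro: order_trans[of t 1])
  have LG: "L2 (G n i)" "L2_norm (G n i) = L2_norm g" and LF: "L2 (F n i)" "L2_norm (F n i) = L2_norm f" for n i
    using L2_translate L2_norm_translate f g by (auto simp: G_def[abs_def] F_def[abs_def])
  have wFG: "is_weak_pderiv (F n i) b (G n i)" for n i
    unfolding F_def[abs_def] G_def[abs_def] by (rule is_weak_pderiv_translate[OF f g w b])
  have zL: "L2 (z n)" for n unfolding z_def[abs_def] by (intro L2_scl L2_sum LG)
  have zn: "L2_norm (z n) \<le> t * L2_norm g" for n
  proof -
    have "L2_norm (z n) = h n * L2_norm (\<lambda>x. \<Sum>i<Suc n. G n i x)"
      unfolding z_def[abs_def] by (subst L2_norm_scl[OF L2_sum(1)[OF LG(1)]]) (use h in \<open>simp del: sum.lessThan_Suc\<close>)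
    also have "... \<le> h n * (\<Sum>i<Suc n. L2_norm (G n i))" by (intro mult_left_mono L2_sum(2) LG h)
    also have "... = (real (Suc n) * h n) * L2_norm g" by (simp add: LG)
    finally show ?thesis unfolding h(3) .
  qed
  have tel: "sdiff t b f = (\<lambda>x. \<Sum>i<Suc n. sdiff (h n) b (F n i) x)" for n
  proof
    fix x
    have e: "sdiff (h n) b (F n i) x = f (x + (real (Suc i) * h n) *\<^sub>R b) - f (x + (real i * h n) *\<^sub>R b)" for i
      by (simp add: sdiff_def F_def algebra_simps)
    have "(\<Sum>i<Suc n. sdiff (h n) b (F n i) x) = f (x + (real (Suc n) * h n) *\<^sub>R b) - f (x + (real 0 * h n) *\<^sub>R b)"
      unfolding e by (rule sum_lessThan_telescope)
    then show "sdiff t b f x = (\<Sum>i<Suc n. sdiff (h n) b (F n i) x)" unfolding h(3) by (simp add: sdiff_def)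
  qed
  have lim: "(\<lambda>n. pairing (z n) \<phi>) \<longlonglongrightarrow> pairing (sdiff t b f) \<phi>" if tf: "test_fun \<phi>" for \<phi>
  proof -
    obtain C where C: "C \<ge> 0" "\<And>f s. L2 f \<Longrightarrow> 0 \<le> s \<Longrightarrow> s \<le> 1 \<Longrightarrow>
      cmod (pairing (sdiff s b f) \<phi> + s * pairing f (pderiv_cl \<phi> b)) \<le> C * s\<^sup>2 * L2_norm f"
      using sdiff_pairing[OF tf b] by metis
    \<comment> \<open>There are n + 1 steps of length \<open>h n\<close>, each with error of order
      \<open>h n\<close> squared; since their lengths add up to t, the total is of order t
      \<open>h n\<close>.\<close>
    have "cmod (pairing (sdiff t b f) \<phi> - pairing (z n) \<phi>) \<le> (C * t\<^sup>2 * L2_norm f) * (1 / real (Suc n))" for n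
    proof -
      have 1: "pairing (sdiff t b f) \<phi> = (\<Sum>i<Suc n. pairing (sdiff (h n) b (F n i)) \<phi>)"
        unfolding tel[of n] by (rule L2_sum(3)[OF L2_sdiff[OF LF(1)] tf])
      have "pairing (z n) \<phi> = h n * pairing (\<lambda>x. \<Sum>i<Suc n. G n i x) \<phi>"
        unfolding z_def[abs_def] by (rule pairing_scl)
      also have "... = h n * (\<Sum>i<Suc n. pairing (G n i) \<phi>)" unfolding L2_sum(3)[OF LG(1) tf] ..
      also have "... = (\<Sum>i<Suc n. - (h n * pairing (F n i) (pderiv_cl \<phi> b)))"
        unfolding sum_distrib_left by (rule sum.cong) (use wFG tf in \<open>auto simp: is_weak_pderiv_iff[OF LF(1) LG(1)]\<close>)
      finally have 2: "pairing (sdiff t b f) \<phi> - pairing (z n) \<phi>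
         = (\<Sum>i<Suc n. pairing (sdiff (h n) b (F n i)) \<phi> + h n * pairing (F n i) (pderiv_cl \<phi> b))"
        unfolding 1 by (simp add: sum.distrib sum_negf del: sum.lessThan_Suc)
      have "cmod (pairing (sdiff t b f) \<phi> - pairing (z n) \<phi>) \<le> (\<Sum>i<Suc n. C * (h n)\<^sup>2 * L2_norm f)"
        unfolding 2 by (rule sum_norm_le) (use C(2)[OF LF(1) h(1,2)] LF(2) in simp)
      also have "... = C * (real (Suc n) * h n) * h n * L2_norm f" by (simp add: power2_eq_square)
      also have "... = (C * t\<^sup>2 * L2_norm f) * (1 / real (Suc n))" unfolding h(3) by (simp add: h_def power2_eq_square)
      finally show ?thesis .
    qed
    then have "(\<lambda>n. pairing (sdiff t b f) \<phi> - pairing (z n) \<phi>) \<longlonglongrightarrow> 0"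
      by (intro Lim_null_comparison[OF always_eventually tendsto_mult_right_zero[OF LIMSEQ_Suc[OF lim_1_over_n]]]) auto
    from tendsto_diff[OF tendsto_const[of "pairing (sdiff t b f) \<phi>"] this] show ?thesis by simp
  qed
  obtain y where y: "L2 y" "L2_norm y \<le> t * L2_norm g"
    "\<And>\<phi>. test_fun \<phi> \<Longrightarrow> pairing y \<phi> = pairing (sdiff t b f) \<phi>"
    using weak_limit_L2[OF zL zn lim] by blast
  have "AE x in lebesgue. y x = sdiff t b f x"
    by (rule fundamental_lemma_eq) (use y(3) L2_loc_integrable y(1) L2_sdiff[OF f] in \<open>auto simp: pairing_eq\<close>)
  then show ?thesis using y(2) L2_norm_cong_AE[OF y(1) L2_sdiff[OF f]] by simp
qed

text \<open>A weak limit of bounded difference quotients is a weak derivative. It works along an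
  arbitrary null sequence, which the contradiction argument of \<open>sdiff_norm_tendsto\<close>
  requires.\<close>

lemma weak_pderiv_from_quotients:
  assumes f: "L2 f" and b: "b \<in> Basis" and t: "\<And>n. 0 < t n" "\<And>n. t n \<le> 1" "t \<longlonglongrightarrow> 0"
    and B: "\<And>n. L2_norm (sdiff (t n) b f) \<le> B * t n"
  obtains y where "L2 y" "L2_norm y \<le> B" "is_weak_pderiv f b y"
proof -
  define z where "z n x = complex_of_real (1 / t n) * sdiff (t n) b f x" for n x
  have zL: "L2 (z n)" for n unfolding z_def[abs_def] by (intro L2_scl L2_sdiff f)
  have zn: "L2_norm (z n) \<le> B" for n
    unfolding z_def[abs_def] L2_norm_scl[OF L2_sdiff[OF f]] using B[of n] t(1)[of n] by (simp add: norm_divide field_simps)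
  have lim: "(\<lambda>n. pairing (z n) \<phi>) \<longlonglongrightarrow> - pairing f (pderiv_cl \<phi> b)" if tf: "test_fun \<phi>" for \<phi>
  proof -
    obtain C where C: "C \<ge> 0" "\<And>f s. L2 f \<Longrightarrow> 0 \<le> s \<Longrightarrow> s \<le> 1 \<Longrightarrow>
      cmod (pairing (sdiff s b f) \<phi> + s * pairing f (pderiv_cl \<phi> b)) \<le> C * s\<^sup>2 * L2_norm f"
      using sdiff_pairing[OF tf b] by metis
    have "cmod (pairing (z n) \<phi> - - pairing f (pderiv_cl \<phi> b)) \<le> C * L2_norm f * t n" for n
    proof -
      have "pairing (z n) \<phi> - - pairing f (pderiv_cl \<phi> b)
         = complex_of_real (1 / t n) * (pairing (sdiff (t n) b f) \<phi> + t n * pairing f (pderiv_cl \<phi> b))"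
        unfolding z_def[abs_def] pairing_scl using t(1)[of n] by (simp add: field_simps)
      then have "cmod (pairing (z n) \<phi> - - pairing f (pderiv_cl \<phi> b)) \<le> 1 / t n * (C * (t n)\<^sup>2 * L2_norm f)"
        using C(2)[OF f, of "t n"] t(1,2)[of n] by (simp add: norm_mult norm_divide divide_right_mono)
      then show ?thesis using t(1)[of n] by (simp add: power2_eq_square mult_ac)
    qed
    then have "(\<lambda>n. pairing (z n) \<phi> - - pairing f (pderiv_cl \<phi> b)) \<longlonglongrightarrow> 0"
      by (intro Lim_null_comparison[OF always_eventually tendsto_mult_right_zero[OF t(3)]]) auto
    then show ?thesis by (simp only: LIM_zero_iff)
  qed
  obtain y where "L2 y" "L2_norm y \<le> B" "\<And>\<phi>. test_fun \<phi> \<Longrightarrow> pairing y \<phi> = - pairing f (pderiv_cl \<phi> b)"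
    using weak_limit_L2[OF zL zn lim] by blast
  then show ?thesis using that by (simp add: is_weak_pderiv_iff[OF f])
qed

lemma H1_I:
  assumes f: "L2 f" and B: "\<And>b. b \<in> Basis \<Longrightarrow> \<exists>B. \<forall>t. 0 < t \<and> t \<le> 1 \<longrightarrow> L2_norm (sdiff t b f) \<le> B * t"
  shows "f \<in> H1"
  unfolding H1_def
proof (intro CollectI conjI ballI f)
  fix b :: 'a assume b: "b \<in> Basis"
  obtain C where "\<forall>t. 0 < t \<and> t \<le> 1 \<longrightarrow> L2_norm (sdiff t b f) \<le> C * t" using B[OF b] by blast
  then have C: "L2_norm (sdiff t b f) \<le> C * t" if "0 < t" "t \<le> 1" for t using that by blast
  obtain y where "L2 y" "is_weak_pderiv f b y"
  proof (rule weak_pderiv_from_quotients[OF f b])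
    show "L2_norm (sdiff (1 / real (Suc n)) b f) \<le> C * (1 / real (Suc n))" for n by (rule C) auto
    show "(\<lambda>n. 1 / real (Suc n)) \<longlonglongrightarrow> 0" by (rule LIMSEQ_Suc[OF lim_1_over_n])
  qed auto
  then show "\<exists>g. is_weak_pderiv f b g \<and> L2 g" by blast
qed

lemma H1_L2: "f \<in> H1 \<Longrightarrow> L2 f" by (simp add: H1_def)

lemma H1_sdiff_le:
  "f \<in> H1 \<Longrightarrow> b \<in> Basis \<Longrightarrow> 0 \<le> t \<Longrightarrow> t \<le> 1 \<Longrightarrow> L2_norm (sdiff t b f) \<le> t * L2_norm (weak_pderiv f b)"
  using L2_norm_sdiff_le[OF H1_L2 H1_weak_pderiv(2) H1_weak_pderiv(1)] by blast

text \<open>The upper bound is \<open>L2_norm_sdiff_le\<close>. If quotients stayed below some a <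
  |g| along a null sequence, their weak limit would be a weak derivative of norm at most a,
  contradicting uniqueness.\<close>

lemma sdiff_norm_tendsto:
  assumes f: "L2 f" and g: "L2 g" and w: "is_weak_pderiv f b g" and b: "b \<in> Basis"
  shows "((\<lambda>t. L2_norm (sdiff t b f) / t) \<longlongrightarrow> L2_norm g) (at_right 0)"
proof (rule order_tendstoI)
  fix a assume a: "L2_norm g < a"
  have "eventually (\<lambda>t. t \<in> {0<..<1::real}) (at_right 0)" by (rule eventually_at_right_real) simp
  then show "eventually (\<lambda>t. L2_norm (sdiff t b f) / t < a) (at_right 0)"
  proof eventually_elim
    fix t :: real assume t: "t \<in> {0<..<1}"
    then have "L2_norm (sdiff t b f) / t \<le> L2_norm g"
      using L2_norm_sdiff_le[OF f g w b, of t] by (simp add: field_simps)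
    then show "L2_norm (sdiff t b f) / t < a" using a by simp
  qed
next
  fix a assume a: "a < L2_norm g"
  show "eventually (\<lambda>t. a < L2_norm (sdiff t b f) / t) (at_right 0)"
  proof (rule ccontr)
    assume ne: "\<not> ?thesis"
    have "\<exists>t. 0 < t \<and> t < 1 / real (Suc n) \<and> L2_norm (sdiff t b f) \<le> a * t" for n
    proof (rule ccontr)
      assume "\<not> ?thesis"
      then have "\<forall>t>0. t < 1 / real (Suc n) \<longrightarrow> a < L2_norm (sdiff t b f) / t" by (auto simp: field_simps not_le)
      then have "eventually (\<lambda>t. a < L2_norm (sdiff t b f) / t) (at_right 0)"
        unfolding eventually_at_right_field by (intro exI[of _ "1 / real (Suc n)"]) auto
      then show False using ne by blast
    qed
    then obtain t where t: "\<And>n. 0 < t n" "\<And>n. t n < 1 / real (Suc n)" "\<And>n. L2_norm (sdiff (t n) b f) \<le> a * t n" by metis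
    have t1: "t n \<le> 1" for n using t(2)[of n] by (rule order_trans[OF less_imp_le]) simp
    have t0: "t \<longlonglongrightarrow> 0"
      by (rule tendsto_sandwich[OF _ _ tendsto_const LIMSEQ_Suc[OF lim_1_over_n]]) (use less_imp_le[OF t(1)] less_imp_le[OF t(2)] in \<open>auto intro!: always_eventually\<close>)
    obtain y where y: "L2 y" "L2_norm y \<le> a" "is_weak_pderiv f b y"
      using weak_pderiv_from_quotients[OF f b t(1) t1 t0 t(3)] by metis
    have "L2_norm y = L2_norm g" using L2_norm_cong_AE[OF y(1) g weak_pderiv_unique[OF y(3) w]] .
    then show False using y(2) a by simp
  qed
qed

lemma L2_inner_self_norm: "L2_inner f f = complex_of_real ((L2_norm f)\<^sup>2)"
  unfolding L2_norm_sq by (rule L2_inner_self)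

lemma sdiff_linear: "sdiff t b (\<lambda>x. f x + c * g x) = (\<lambda>x. sdiff t b f x + c * sdiff t b g x)"
  by (auto simp: sdiff_def algebra_simps)

text \<open>Polarisation of the convergence of norms, applied to f + c g for the four units
  c.\<close>

lemma sdiff_inner_tendsto:
  assumes f: "L2 f" "L2 f'" "is_weak_pderiv f b f'" and g: "L2 g" "L2 g'" "is_weak_pderiv g b g'" and b: "b \<in> Basis"
  shows "((\<lambda>t. L2_inner (sdiff t b f) (sdiff t b g) / t\<^sup>2) \<longlongrightarrow> L2_inner f' g') (at_right 0)"
proof -
  define Q where "Q c t = complex_of_real ((L2_norm (sdiff t b (\<lambda>x. f x + c * g x)) / t)\<^sup>2)" for c t
  have lim: "(Q c \<longlongrightarrow> complex_of_real ((L2_norm (\<lambda>x. f' x + c * g' x))\<^sup>2)) (at_right 0)" for c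
    unfolding Q_def
    by (intro tendsto_intros sdiff_norm_tendsto L2_add L2_scl is_weak_pderiv_linear f g b)
  have pol: "4 * L2_inner u v = complex_of_real ((L2_norm (\<lambda>x. u x + 1 * v x))\<^sup>2) - complex_of_real ((L2_norm (\<lambda>x. u x + (-1) * v x))\<^sup>2)
     + \<i> * complex_of_real ((L2_norm (\<lambda>x. u x + \<i> * v x))\<^sup>2) - \<i> * complex_of_real ((L2_norm (\<lambda>x. u x + (-\<i>) * v x))\<^sup>2)"
    if "L2 u" "L2 v" for u v :: "'a \<Rightarrow> complex"
    using L2.sesq_polarisation[OF L2_inner_sesq, of u v] that unfolding L2_inner_self_norm plus_fun_def by simp
  have "((\<lambda>t. (Q 1 t - Q (-1) t + \<i> * Q \<i> t - \<i> * Q (-\<i>) t) / 4) \<longlongrightarrow> (4 * L2_inner f' g') / 4) (at_right 0)"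
    unfolding pol[OF f(2) g(2)] by (intro tendsto_intros lim) simp
  moreover have "(Q 1 t - Q (-1) t + \<i> * Q \<i> t - \<i> * Q (-\<i>) t) / 4 = L2_inner (sdiff t b f) (sdiff t b g) / t\<^sup>2" for t
  proof -
    have "(Q 1 t - Q (-1) t + \<i> * Q \<i> t - \<i> * Q (-\<i>) t) / 4 = 4 * L2_inner (sdiff t b f) (sdiff t b g) / t\<^sup>2 / 4"
      unfolding pol[OF L2_sdiff[OF f(1)] L2_sdiff[OF g(1)], of t b t b] Q_def sdiff_linear power_divide of_real_divide
      by (simp add: diff_divide_distrib add_divide_distrib)
    then show ?thesis by simp
  qed
  ultimately show ?thesis by simp
qed

section \<open>The gradient inner product on H1\<close>

definition grad_inner :: "('a::euclidean_space \<Rightarrow> complex) \<Rightarrow> ('a \<Rightarrow> complex) \<Rightarrow> complex" where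
  "grad_inner f g = (\<Sum>b\<in>Basis. L2_inner (weak_pderiv f b) (weak_pderiv g b))"

text \<open>The chosen derivatives are linear only almost everywhere. As a limit of this explicit
  expression, \<open>grad_inner\<close> inherits the identities and inequalities that hold pointwise
  for differences.\<close>

definition grad_quot :: "real \<Rightarrow> ('a::euclidean_space \<Rightarrow> complex) \<Rightarrow> ('a \<Rightarrow> complex) \<Rightarrow> complex" where
  "grad_quot t f g = (\<Sum>b\<in>Basis. L2_inner (sdiff t b f) (sdiff t b g) / t\<^sup>2)"

lemma grad_quot_tendsto:
  "f \<in> H1 \<Longrightarrow> g \<in> H1 \<Longrightarrow> ((\<lambda>t. grad_quot t f g) \<longlongrightarrow> grad_inner f g) (at_right 0)"
  unfolding grad_quot_def grad_inner_def
  by (intro tendsto_sum sdiff_inner_tendsto H1_weak_pderiv H1_L2)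

text \<open>The common membership test: moduli are dominated by one function, quotients by numerator
  and denominator, while the term t |w| absorbs Lipschitz cut-offs and varying phases.\<close>

lemma H1_I_dominated:
  assumes F: "L2 F" and f: "f \<in> H1" and g: "g \<in> H1" and w: "L2 w" and A: "A \<ge> 0"
    and le: "\<And>b t x. b \<in> Basis \<Longrightarrow> 0 < t \<Longrightarrow> t \<le> 1 \<Longrightarrow>
       cmod (sdiff t b F x) \<le> A * cmod (sdiff t b f x) + A * cmod (sdiff t b g x) + t * cmod (w x)"
  shows "F \<in> H1"
proof (rule H1_I[OF F])
  fix b :: 'a assume b: "b \<in> Basis"
  have nL: "L2 (\<lambda>x. complex_of_real (cmod (h x)))" "L2_norm (\<lambda>x. complex_of_real (cmod (h x))) = L2_norm h" if "L2 h" for h :: "'a \<Rightarrow> complex"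
    using that by (auto simp: L2_def L2_norm_def)
  have "L2_norm (sdiff t b F) \<le> (A * L2_norm (weak_pderiv f b) + A * L2_norm (weak_pderiv g b) + L2_norm w) * t"
    if t: "0 < t" "t \<le> 1" for t
  proof -
    define G where "G x = (complex_of_real A * complex_of_real (cmod (sdiff t b f x)) + complex_of_real A * complex_of_real (cmod (sdiff t b g x)))
       + complex_of_real t * complex_of_real (cmod (w x))" for x
    note L = nL[OF L2_sdiff[OF H1_L2[OF f]]] nL[OF L2_sdiff[OF H1_L2[OF g]]] nL[OF w]
    have GL: "L2 G" unfolding G_def[abs_def] by (intro L2_add L2_scl L)
    have Gn: "cmod (G x) = A * cmod (sdiff t b f x) + A * cmod (sdiff t b g x) + t * cmod (w x)" for x
      unfolding G_def of_real_mult[symmetric] of_real_add[symmetric] norm_of_real using A t by simp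
    have "L2_norm (sdiff t b F) \<le> L2_norm G"
      by (rule L2_norm_mono[OF GL L2_measurable[OF L2_sdiff[OF F]]]) (use le[OF b t] Gn in simp)
    also have "... \<le> A * L2_norm (sdiff t b f) + A * L2_norm (sdiff t b g) + t * L2_norm w"
      unfolding G_def[abs_def]
      by (intro order_trans[OF L2_norm_add] add_mono) (use L A t in \<open>auto simp: L2_norm_scl intro!: L2_add L2_scl\<close>)
    also have "... \<le> A * (t * L2_norm (weak_pderiv f b)) + A * (t * L2_norm (weak_pderiv g b)) + t * L2_norm w"
      using t A by (intro add_mono mult_left_mono H1_sdiff_le f g b) auto
    finally show ?thesis by (simp add: algebra_simps)
  qed
  then show "\<exists>B. \<forall>t. 0 < t \<and> t \<le> 1 \<longrightarrow> L2_norm (sdiff t b F) \<le> B * t" by blast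
qed

lemma H1_linear:
  assumes f: "f \<in> H1" and g: "g \<in> H1" shows "(\<lambda>x. f x + c * g x) \<in> H1"
  unfolding H1_def
proof (intro CollectI conjI ballI L2_add L2_scl H1_L2 f g)
  fix b :: 'a assume b: "b \<in> Basis"
  note w = H1_weak_pderiv[OF f b] H1_weak_pderiv[OF g b]
  show "\<exists>h. is_weak_pderiv (\<lambda>x. f x + c * g x) b h \<and> L2 h"
    using is_weak_pderiv_linear[OF H1_L2[OF f] H1_L2[OF g] w(1,3,2,4) b, of c] L2_add[OF w(2) L2_scl[OF w(4)], of c]
    by (rule exI[where x="\<lambda>x. weak_pderiv f b x + c * weak_pderiv g b x", OF conjI])
qed

lemma H1_zero: "(\<lambda>x. 0) \<in> H1"
  by (rule H1_I) (auto simp: L2_zero sdiff_def L2_norm_def intro!: exI[of _ 0])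

interpretation H1: cspace "H1 :: ('a::euclidean_space \<Rightarrow> complex) set" cscl
proof
  show "f + g \<in> H1" if "f \<in> H1" "g \<in> H1" for f g :: "'a \<Rightarrow> complex"
    using H1_linear[OF that, of 1] by (simp add: plus_fun_def)
  show "cscl c f \<in> H1" if "f \<in> H1" for f :: "'a \<Rightarrow> complex" and c
    using H1_linear[OF H1_zero that, of c] by simp
qed (auto simp: fun_eq_iff)

lemma grad_inner_psd: "H1.psd grad_inner"
  unfolding H1.psd_def H1.sesq_def
proof (intro conjI ballI allI)
  note u = tendsto_unique[OF trivial_limit_at_right_real]
  fix f g h :: "'a \<Rightarrow> complex" and c
  assume f: "f \<in> H1" and g: "g \<in> H1"
  have L: "L2 (sdiff t b f)" "L2 (sdiff t b g)" for t b using f g H1_L2 L2_sdiff by blast+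
  have sc: "sdiff t b (cscl c u) = cscl c (sdiff t b u)" for t b u
    by (auto simp: sdiff_def algebra_simps)
  have cf: "cscl c f \<in> H1" and cg: "cscl c g \<in> H1" using H1.D_scl f g by blast+
  have "grad_quot t (cscl c f) g = c * grad_quot t f g" "grad_quot t f (cscl c g) = cnj c * grad_quot t f g" for t
    unfolding grad_quot_def sum_distrib_left
    by (auto simp: sc L2_inner_linear(3)[OF L L(1)] L2_inner_linear(4)[OF L L(2)] intro!: sum.cong)
  then show "grad_inner (cscl c f) g = c * grad_inner f g" "grad_inner f (cscl c g) = cnj c * grad_inner f g"
    using u[OF grad_quot_tendsto[OF cf g]] u[OF grad_quot_tendsto[OF f cg]] tendsto_mult_left[OF grad_quot_tendsto[OF f g]] by simp_all
  show "grad_inner g f = cnj (grad_inner f g)"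
    unfolding grad_inner_def cnj_sum by (rule sum.cong[OF refl L2_inner_commute]) (use f g H1_weak_pderiv(2) in blast)+
  assume h: "h \<in> H1"
  have Lh: "L2 (sdiff t b h)" for t b using h H1_L2 L2_sdiff by blast
  have a: "sdiff t b (x + y) = (\<lambda>z. sdiff t b x z + sdiff t b y z)" for t b and x y :: "'a \<Rightarrow> complex"
    by (auto simp: sdiff_def)
  have "grad_quot t (f + g) h = grad_quot t f h + grad_quot t g h" "grad_quot t f (g + h) = grad_quot t f g + grad_quot t f h" for t
    unfolding grad_quot_def sum.distrib[symmetric] a
    using L2_inner_linear(1)[OF L Lh] L2_inner_linear(2)[OF L Lh] by (auto simp: add_divide_distrib intro!: sum.cong)
  then show "grad_inner (f + g) h = grad_inner f h + grad_inner g h" "grad_inner f (g + h) = grad_inner f g + grad_inner f h"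
    using u[OF grad_quot_tendsto[OF H1.D_add[OF f g] h]] u[OF grad_quot_tendsto[OF f H1.D_add[OF g h]]]
      tendsto_add[OF grad_quot_tendsto[OF f h] grad_quot_tendsto[OF g h]] tendsto_add[OF grad_quot_tendsto[OF f g] grad_quot_tendsto[OF f h]]
    by simp_all
next
  fix f :: "'a \<Rightarrow> complex"
  show "0 \<le> Re (grad_inner f f)" by (simp add: grad_inner_def L2_inner_self sum_nonneg)
qed

section \<open>The form domain\<close>

definition potential_form :: "('a::euclidean_space \<Rightarrow> complex) \<Rightarrow> ('a \<Rightarrow> complex) \<Rightarrow> ('a \<Rightarrow> complex) \<Rightarrow> complex" where
  "potential_form V f g = (LINT x|lebesgue. V x * f x * cnj (g x))"

lemma form_E_eq: "form_E V f g = grad_inner f g + potential_form V f g"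
  by (simp add: form_E_def grad_inner_def potential_form_def)

lemma integrable_potential:
  fixes V f g :: "'a::euclidean_space \<Rightarrow> complex"
  assumes V: "V \<in> borel_measurable lebesgue" and f: "L2 f" "integrable lebesgue (\<lambda>x. V x * (cmod (f x))\<^sup>2)"
    and g: "L2 g" "integrable lebesgue (\<lambda>x. V x * (cmod (g x))\<^sup>2)"
  shows "integrable lebesgue (\<lambda>x. V x * f x * cnj (g x))"
proof (rule Bochner_Integration.integrable_bound)
  show "integrable lebesgue (\<lambda>x. cmod (V x * (cmod (f x))\<^sup>2) + cmod (V x * (cmod (g x))\<^sup>2))"
    using f g by (intro Bochner_Integration.integrable_add integrable_norm)
  show "(\<lambda>x. V x * f x * cnj (g x)) \<in> borel_measurable lebesgue"
    by (intro borel_measurable_times V L2_measurable f g borel_measurable_cnj)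
  have "cmod (V x * f x * cnj (g x)) \<le> norm (cmod (V x * (cmod (f x))\<^sup>2) + cmod (V x * (cmod (g x))\<^sup>2))" for x
  proof -
    have "0 \<le> (cmod (f x) - cmod (g x))\<^sup>2 + (cmod (f x))\<^sup>2 + (cmod (g x))\<^sup>2" by simp
    then have "cmod (f x) * cmod (g x) \<le> (cmod (f x))\<^sup>2 + (cmod (g x))\<^sup>2" by (simp add: power2_diff)
    from mult_left_mono[OF this, of "cmod (V x)"] show ?thesis
      by (simp add: norm_mult norm_power algebra_simps)
  qed
  then show "AE x in lebesgue. cmod (V x * f x * cnj (g x)) \<le> norm (cmod (V x * (cmod (f x))\<^sup>2) + cmod (V x * (cmod (g x))\<^sup>2))"
    by simp
qed

lemma borel_measurable_complex_of_real:
  "f \<in> borel_measurable M \<Longrightarrow> (\<lambda>x. complex_of_real (f x)) \<in> borel_measurable M"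
  by (rule borel_measurable_continuous_on[OF continuous_on_of_real[OF continuous_on_id]])

locale schrodinger_form =
  fixes V :: "'a::euclidean_space \<Rightarrow> complex"
  assumes loc: "loc_integrable V"
begin

lemma V_measurable: "V \<in> borel_measurable lebesgue"
  using loc by (simp add: loc_integrable_def)

lemma form_domD:
  assumes "f \<in> form_dom V"
  shows "f \<in> H1" "L2 f" "integrable lebesgue (\<lambda>x. V x * (cmod (f x))\<^sup>2)" "f \<in> borel_measurable lebesgue"
  using assms by (auto simp: form_dom_def L2_def)

lemma form_dom_integrable:
  "f \<in> form_dom V \<Longrightarrow> g \<in> form_dom V \<Longrightarrow> integrable lebesgue (\<lambda>x. V x * f x * cnj (g x))"
  by (rule integrable_potential[OF V_measurable]) (auto dest: form_domD)

lemma form_dom_I_dominated: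
  fixes h :: "'a \<Rightarrow> 'b::{banach, second_countable_topology}"
  assumes F: "F \<in> H1" and h: "integrable lebesgue h" and le: "\<And>x. cmod (V x) * (cmod (F x))\<^sup>2 \<le> norm (h x)"
  shows "F \<in> form_dom V"
proof -
  have "integrable lebesgue (\<lambda>x. V x * (cmod (F x))\<^sup>2)"
  proof (rule Bochner_Integration.integrable_bound[OF h])
    show "(\<lambda>x. V x * complex_of_real ((cmod (F x))\<^sup>2)) \<in> borel_measurable lebesgue"
      using V_measurable L2_measurable[OF H1_L2[OF F]] by (intro borel_measurable_times) auto
  qed (use le in \<open>simp add: norm_mult norm_power\<close>)
  then show ?thesis using F H1_L2 by (auto simp: form_dom_def)
qed

sublocale FD: cspace "form_dom V" cscl
proof
  fix f g :: "'a \<Rightarrow> complex" and c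
  assume f: "f \<in> form_dom V"
  show "cscl c f \<in> form_dom V"
  proof (rule form_dom_I_dominated[OF H1.D_scl[OF form_domD(1)[OF f]]])
    show "integrable lebesgue (\<lambda>x. (cmod c)\<^sup>2 * (V x * (cmod (f x))\<^sup>2))" using form_domD(3)[OF f] by simp
  qed (simp add: norm_mult norm_power power_mult_distrib)
  assume g: "g \<in> form_dom V"
  show "f + g \<in> form_dom V"
  proof (rule form_dom_I_dominated[OF H1.D_add[OF form_domD(1)[OF f] form_domD(1)[OF g]]])
    show "integrable lebesgue (\<lambda>x. 2 * (cmod (V x * (cmod (f x))\<^sup>2) + cmod (V x * (cmod (g x))\<^sup>2)))"
      using form_domD(3)[OF f] form_domD(3)[OF g] by (intro integrable_mult_right Bochner_Integration.integrable_add integrable_norm)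
    fix x
    show "cmod (V x) * (cmod ((f + g) x))\<^sup>2 \<le> norm (2 * (cmod (V x * (cmod (f x))\<^sup>2) + cmod (V x * (cmod (g x))\<^sup>2)))"
      using mult_left_mono[OF cmod_add_sq[of "f x" "g x"], of "cmod (V x)"]
      by (simp add: norm_mult norm_power algebra_simps)
  qed
qed (auto simp: fun_eq_iff)

lemma grad_inner_sesq: "FD.sesq grad_inner"
  using H1.psdD(1)[OF grad_inner_psd] form_domD(1) unfolding FD.sesq_def H1.sesq_def by blast

lemma potential_form_sesq: "FD.sesq (potential_form V)"
  unfolding FD.sesq_def
proof (intro conjI ballI allI)
  fix f g h c assume f: "f \<in> form_dom V" and g: "g \<in> form_dom V"
  note i = form_dom_integrable
  have "(\<lambda>x. V x * (c * f x) * cnj (g x)) = (\<lambda>x. c * (V x * f x * cnj (g x)))"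
    "(\<lambda>x. V x * f x * cnj (c * g x)) = (\<lambda>x. cnj c * (V x * f x * cnj (g x)))"
    by (auto simp: fun_eq_iff)
  then show "potential_form V (cscl c f) g = c * potential_form V f g" "potential_form V f (cscl c g) = cnj c * potential_form V f g"
    unfolding potential_form_def by (simp_all only: integral_mult_right_zero)
  assume h: "h \<in> form_dom V"
  show "potential_form V (f + g) h = potential_form V f h + potential_form V g h"
    "potential_form V f (g + h) = potential_form V f g + potential_form V f h"
    unfolding potential_form_def using i[OF f h] i[OF g h] i[OF f g] by (simp_all add: algebra_simps)
qed

lemma form_E_sesq: "FD.sesq (form_E V)"
  using grad_inner_sesq potential_form_sesq unfolding FD.sesq_def form_E_eq[abs_def] by (auto simp: algebra_simps)

lemma L2_inner_psd_form: "FD.psd L2_inner"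
  using L2_inner_psd form_domD(2) unfolding FD.psd_def L2.psd_def FD.sesq_def L2.sesq_def by blast

text \<open>Supplies the concrete test functions \<open>bump\<close> and \<open>cutoff\<close>. The
  potential term is finite because F is bounded with compact support and V is locally
  integrable.\<close>

lemma form_dom_lipschitz:
  assumes lip: "\<And>x y. \<bar>F x - F y\<bar> \<le> L * dist x y" and K: "compact K" and 0: "\<And>x. x \<notin> K \<Longrightarrow> F x = 0"
  shows "(\<lambda>x. complex_of_real (F x)) \<in> form_dom V" (is "?F \<in> _")
proof -
  obtain b0 :: 'a where "b0 \<in> Basis" using nonempty_Basis by blast
  then have "0 \<le> L" using order_trans[OF abs_ge_zero lip[of b0 0]] by simp
  have c: "continuous_on UNIV ?F"
  proof (rule continuous_on_of_real, unfold continuous_on_iff, intro ballI allI impI)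
    fix x :: 'a and e :: real assume e: "0 < e"
    show "\<exists>d>0. \<forall>x'\<in>UNIV. dist x' x < d \<longrightarrow> dist (F x') (F x) < e"
    proof (intro exI[of _ "e / (L + 1)"] conjI ballI impI)
      show "0 < e / (L + 1)" using e \<open>0 \<le> L\<close> by simp
      fix y assume "dist y x < e / (L + 1)"
      then have "(L + 1) * dist y x < e" using \<open>0 \<le> L\<close> by (simp add: field_simps)
      moreover have "L * dist y x \<le> (L + 1) * dist y x" by (intro mult_right_mono) auto
      ultimately show "dist (F y) (F x) < e" using lip[of y x] by (simp add: dist_real_def)
    qed
  qed
  have m: "?F \<in> borel_measurable lebesgue" by (rule continuous_borel_measurable_lebesgue[OF c])
  obtain C where C: "C > 0" "\<And>x. cmod (?F x) \<le> C"
    using continuous_compact_support_bounded[OF c K] 0 by (metis of_real_0)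
  have L2F: "L2 ?F" by (rule L2_bounded_compact_support(1)[OF m K _ C(2)]) (use 0 in auto)
  obtain R where R: "R > 0" "\<And>x. x \<in> K \<Longrightarrow> norm x \<le> R" using compact_imp_bounded[OF K] by (auto simp: bounded_pos)
  \<comment> \<open>Differences with t <= 1 can be nonzero only within distance 1 of K, hence the
    radius R + 1.\<close>
  define w where "w x = complex_of_real (L * indicat_real (cball 0 (R + 1)) x)" for x :: 'a
  have w: "L2 w"
  proof (rule L2_bounded_compact_support(1))
    show "w \<in> borel_measurable lebesgue" unfolding w_def[abs_def]
      by (intro borel_measurable_complex_of_real borel_measurable_times borel_measurable_const borel_measurable_indicator) auto
    show "compact (cball (0::'a) (R + 1))" by simp
    show "w x = 0" if "x \<notin> cball 0 (R + 1)" for x using that by (simp add: w_def)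
    show "cmod (w x) \<le> L" for x using \<open>0 \<le> L\<close> by (auto simp: w_def indicator_def)
  qed
  have F: "?F \<in> H1"
  proof (rule H1_I_dominated[OF L2F H1_zero H1_zero w])
    show "(0::real) \<le> 0" by simp
    fix b :: 'a and t :: real and x assume b: "b \<in> Basis" and t: "0 < t" "t \<le> 1"
    show "cmod (sdiff t b ?F x) \<le> 0 * cmod (sdiff t b (\<lambda>x. 0) x) + 0 * cmod (sdiff t b (\<lambda>x. 0) x) + t * cmod (w x)"
    proof (cases "x \<in> cball 0 (R + 1)")
      case True
      have "cmod (sdiff t b ?F x) = \<bar>F (x + t *\<^sub>R b) - F x\<bar>" by (simp add: sdiff_def flip: of_real_diff)
      also have "... \<le> L * dist (x + t *\<^sub>R b) x" by (rule lip)
      also have "dist (x + t *\<^sub>R b) x = t" using b t by (simp add: dist_norm)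
      finally show ?thesis using True \<open>0 \<le> L\<close> by (simp add: w_def mult.commute)
    next
      case False
      have "norm x \<le> norm (x + t *\<^sub>R b) + norm (t *\<^sub>R b)" using norm_triangle_ineq4[of "x + t *\<^sub>R b" "t *\<^sub>R b"] by simp
      moreover have "norm (t *\<^sub>R b) \<le> 1" using b t by simp
      ultimately have "norm (x + t *\<^sub>R b) > R" "norm x > R" using False by auto
      then have "x \<notin> K" "x + t *\<^sub>R b \<notin> K" using R(2) by force+
      then show ?thesis using 0 t by (simp add: sdiff_def)
    qed
  qed
  show ?thesis
  proof (rule form_dom_I_dominated[OF F])
    have "integrable lebesgue (\<lambda>x. indicat_real K x *\<^sub>R V x)"
      using loc K by (auto simp: loc_integrable_def set_integrable_def)
    then show "integrable lebesgue (\<lambda>x. C\<^sup>2 *\<^sub>R (indicat_real K x *\<^sub>R V x))" by (rule integrable_scaleR_right)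
    fix x
    show "cmod (V x) * (cmod (?F x))\<^sup>2 \<le> norm (C\<^sup>2 *\<^sub>R (indicat_real K x *\<^sub>R V x))"
    proof (cases "x \<in> K")
      case True
      then show ?thesis using mult_left_mono[OF power_mono[OF C(2)[of x], of 2], of "cmod (V x)"] by (simp add: mult.commute)
    qed (use 0 in simp)
  qed
qed

text \<open>The reverse triangle inequality compares differences of |f| and f pointwise, and the
  comparison of gradient energies survives the limit t to 0.\<close>

lemma form_dom_modulus:
  assumes f: "f \<in> form_dom V"
  shows "(\<lambda>x. complex_of_real (cmod (f x))) \<in> form_dom V" (is "?u \<in> _")
    "potential_form V (\<lambda>x. complex_of_real (cmod (f x))) (\<lambda>x. complex_of_real (cmod (f x))) = potential_form V f f"
    "L2_norm (\<lambda>x. complex_of_real (cmod (f x))) = L2_norm f"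
    "Re (grad_inner (\<lambda>x. complex_of_real (cmod (f x))) (\<lambda>x. complex_of_real (cmod (f x)))) \<le> Re (grad_inner f f)"
proof -
  have "?u \<in> borel_measurable lebesgue" using form_domD(4)[OF f] by (intro borel_measurable_complex_of_real) simp
  then have Lu: "L2 ?u" using form_domD(2)[OF f] by (simp add: L2_def)
  have le: "cmod (sdiff t b ?u x) \<le> cmod (sdiff t b f x)" for t b x
    unfolding sdiff_def of_real_diff[symmetric] norm_of_real by (rule norm_triangle_ineq3)
  have u: "?u \<in> H1"
    by (rule H1_I_dominated[OF Lu form_domD(1)[OF f] H1_zero L2_zero, of 1]) (use le in \<open>auto simp: sdiff_def\<close>)
  show "?u \<in> form_dom V"
    by (rule form_dom_I_dominated[OF u form_domD(3)[OF f]]) (simp add: norm_mult norm_power)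
  have e: "V x * f x * cnj (f x) = V x * complex_of_real ((cmod (f x))\<^sup>2)" for x
    using complex_norm_square[of "f x"] by (simp add: mult.assoc)
  show "potential_form V ?u ?u = potential_form V f f"
    unfolding potential_form_def e by (simp add: power2_eq_square mult.assoc)
  show "L2_norm ?u = L2_norm f" by (simp add: L2_norm_def)
  show "Re (grad_inner ?u ?u) \<le> Re (grad_inner f f)"
  proof (rule tendsto_le[OF trivial_limit_at_right_real])
    show "((\<lambda>t. Re (grad_quot t f f)) \<longlongrightarrow> Re (grad_inner f f)) (at_right 0)"
      by (intro tendsto_Re grad_quot_tendsto form_domD(1)[OF f])
    show "((\<lambda>t. Re (grad_quot t ?u ?u)) \<longlongrightarrow> Re (grad_inner ?u ?u)) (at_right 0)"
      by (intro tendsto_Re grad_quot_tendsto u)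
    have "Re (grad_quot t ?u ?u) \<le> Re (grad_quot t f f)" for t
    proof -
      have "(L2_norm (sdiff t b ?u))\<^sup>2 \<le> (L2_norm (sdiff t b f))\<^sup>2" for b
        by (intro power_mono L2_norm_mono L2_norm_nonneg L2_sdiff form_domD(2)[OF f] L2_measurable[OF L2_sdiff[OF Lu]] le)
      then have "(\<Sum>b\<in>Basis. (L2_norm (sdiff t b ?u))\<^sup>2 / t\<^sup>2) \<le> (\<Sum>b\<in>Basis. (L2_norm (sdiff t b f))\<^sup>2 / t\<^sup>2)"
        by (intro sum_mono divide_right_mono) auto
      then show ?thesis
        unfolding grad_quot_def L2_inner_self_norm of_real_power[symmetric] of_real_divide[symmetric] of_real_sum[symmetric] Re_complex_of_real .
    qed
    then show "eventually (\<lambda>t. Re (grad_quot t ?u ?u) \<le> Re (grad_quot t f f)) (at_right 0)" by simp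
  qed
qed

end

section \<open>Curvature of the boundary of a planar convex set\<close>

lemma tendsto_Inf_at_right_0:
  fixes F :: "real \<Rightarrow> ereal"
  assumes mono: "\<And>x y. 0 < x \<Longrightarrow> x \<le> y \<Longrightarrow> F x \<le> F y"
  shows "(F \<longlongrightarrow> (INF e\<in>{0<..}. F e)) (at_right 0)"
proof (rule order_tendstoI)
  fix a assume "a < (INF e\<in>{0<..}. F e)"
  then have "a < F e" if "0 < e" for e using that by (metis INF_lower greaterThan_iff order_less_le_trans)
  then show "eventually (\<lambda>e. a < F e) (at_right 0)"
    using eventually_at_right_less[of 0] by (auto elim: eventually_mono)
next
  fix a assume "(INF e\<in>{0<..}. F e) < a"
  then obtain e where e: "0 < e" "F e < a" by (auto simp: INF_less_iff)
  have "F x < a" if "0 < x" "x < e" for x using mono[of x e] that e by simp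
  then show "eventually (\<lambda>e. F e < a) (at_right 0)"
    unfolding eventually_at_right_field using e(1) by blast
qed

text \<open>Suprema over shrinking discs are monotone in the radius, so the \<open>Lim\<close> in
  the curvature is a genuine limit, equal to an infimum, and a bound on a single disc
  suffices.\<close>

lemma Lim_at_right_0_le:
  fixes F :: "real \<Rightarrow> ereal"
  assumes mono: "\<And>x y. 0 < x \<Longrightarrow> x \<le> y \<Longrightarrow> F x \<le> F y" and e: "0 < e"
  shows "Lim (at_right 0) F \<le> F e"
proof -
  have "Lim (at_right 0) F = (INF e\<in>{0<..}. F e)"
    using tendsto_Lim[OF trivial_limit_at_right_real tendsto_Inf_at_right_0[OF mono]] .
  also have "... \<le> F e" by (rule INF_lower) (use e in simp)
  finally show ?thesis .
qed

lemma gamma_u_finite: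
  assumes e: "0 < \<epsilon>" and le: "\<And>z. z \<in> frontier \<Omega> \<Longrightarrow> cmod (z - lam) \<le> \<epsilon> \<Longrightarrow> xi_coord \<Omega> lam z \<noteq> 0
     \<Longrightarrow> eta_coord \<Omega> lam z \<le> C * (xi_coord \<Omega> lam z)\<^sup>2"
  shows "gamma_u \<Omega> lam < \<infinity>"
proof -
  have b: "ereal (eta_coord \<Omega> lam z / (xi_coord \<Omega> lam z)\<^sup>2) \<le> ereal C"
    if "z \<in> frontier \<Omega>" "cmod (z - lam) \<le> \<epsilon>" "xi_coord \<Omega> lam z \<noteq> 0" for z
    using le[OF that] that(3) by (simp add: divide_le_eq)
  have "gamma_u_plus \<Omega> lam \<le> (SUP z\<in>{z\<in>frontier \<Omega>. cmod (z - lam) \<le> \<epsilon> \<and> xi_coord \<Omega> lam z > 0}.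
        ereal (eta_coord \<Omega> lam z / (xi_coord \<Omega> lam z)\<^sup>2))"
    unfolding gamma_u_plus_def by (rule Lim_at_right_0_le[OF _ e]) (rule SUP_subset_mono, auto)
  also have "... \<le> ereal C" by (rule SUP_least) (use b in auto)
  finally have 1: "gamma_u_plus \<Omega> lam \<le> ereal C" .
  have "gamma_u_minus \<Omega> lam \<le> (SUP z\<in>{z\<in>frontier \<Omega>. cmod (z - lam) \<le> \<epsilon> \<and> xi_coord \<Omega> lam z < 0}.
        ereal (eta_coord \<Omega> lam z / (xi_coord \<Omega> lam z)\<^sup>2))"
    unfolding gamma_u_minus_def by (rule Lim_at_right_0_le[OF _ e]) (rule SUP_subset_mono, auto)
  also have "... \<le> ereal C" by (rule SUP_least) (use b in auto)
  finally have "gamma_u \<Omega> lam \<le> ereal C" using 1 by (simp add: gamma_u_def)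
  then show ?thesis by (rule order_le_less_trans) simp
qed

lemma supporting_normal_exists:
  assumes conv: "convex \<Omega>" and int: "interior \<Omega> \<noteq> {}" and lam: "lam \<in> \<Omega>" "lam \<notin> interior \<Omega>"
  obtains n where "n \<in> supp_normals \<Omega> lam"
proof -
  have "lam \<notin> rel_interior \<Omega>" using lam int by (simp add: rel_interior_nonempty_interior)
  then obtain a where a: "a \<noteq> 0" "\<And>y. y \<in> \<Omega> \<Longrightarrow> a \<bullet> lam \<le> a \<bullet> y"
    using supporting_hyperplane_rel_boundary[OF conv lam(1)] by metis
  define n where "n = a / complex_of_real (cmod a)"
  have e: "Re ((z - lam) * cnj n) = (a \<bullet> z - a \<bullet> lam) / cmod a" for z
    using a(1) by (simp add: n_def inner_complex_def diff_divide_distrib add_divide_distrib algebra_simps)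
  have "n \<in> supp_normals \<Omega> lam"
    unfolding supp_normals_def mem_Collect_eq e using a by (simp add: n_def norm_divide)
  then show ?thesis by (rule that)
qed

text \<open>Both unit vectors are orthogonal to the same nonzero c, so their determinant vanishes
  and m is n times the real number r = n . m of modulus 1.\<close>

lemma eq_or_eq_minus_if_orthogonal:
  fixes n m c :: complex
  assumes "cmod n = 1" "cmod m = 1" "c \<noteq> 0" "Re (c * cnj n) = 0" "Re (c * cnj m) = 0"
  shows "m = n \<or> m = - n"
proof -
  have "Re (c * cnj n) * Im m - Re (c * cnj m) * Im n = Re c * (Re n * Im m - Re m * Im n)"
    "Re (c * cnj m) * Re n - Re (c * cnj n) * Re m = Im c * (Re n * Im m - Re m * Im n)"
    by (simp_all add: algebra_simps)
  then have d: "Re n * Im m = Re m * Im n" using assms(3-5) by (auto simp: complex_eq_iff)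
  have s: "(Re n)\<^sup>2 + (Im n)\<^sup>2 = 1" "(Re m)\<^sup>2 + (Im m)\<^sup>2 = 1" using assms(1,2) by (metis cmod_power2 one_power2)+
  define r where "r = Re m * Re n + Im m * Im n"
  have "Re m = r * Re n" "Im m = r * Im n"
  proof -
    have "r * Re n = Re m * (Re n)\<^sup>2 + Im n * (Re n * Im m)" by (simp add: r_def power2_eq_square algebra_simps)
    also have "... = Re m * ((Re n)\<^sup>2 + (Im n)\<^sup>2)" unfolding d by (simp add: power2_eq_square algebra_simps)
    finally show "Re m = r * Re n" using s by simp
    have "r * Im n = Re n * (Re m * Im n) + Im m * (Im n)\<^sup>2" by (simp add: r_def power2_eq_square algebra_simps)
    also have "... = Im m * ((Re n)\<^sup>2 + (Im n)\<^sup>2)" unfolding d[symmetric] by (simp add: power2_eq_square algebra_simps)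
    finally show "Im m = r * Im n" using s by simp
  qed
  moreover from this have "r\<^sup>2 * ((Re n)\<^sup>2 + (Im n)\<^sup>2) = 1" using s(2) by (simp add: power_mult_distrib algebra_simps)
  then have "r = 1 \<or> r = -1" using s(1) power2_eq_1_iff by auto
  ultimately show ?thesis by (auto simp: complex_eq_iff)
qed

text \<open>If \<open>\<Omega>\<close> contains a curve that touches \<open>\<lambda>\<close> with nonzero velocity and quadratic error, its
  boundary lies below a parabola near \<open>\<lambda>\<close>.\<close>
lemma curvature_finite:
  assumes conv: "convex \<Omega>" and clo: "closed \<Omega>" and int: "interior \<Omega> \<noteq> {}" and lam: "lam \<in> frontier \<Omega>"
    and c: "c \<noteq> 0" and t0: "t0 > 0"
    and p: "\<And>t. \<bar>t\<bar> < t0 \<Longrightarrow> p t \<in> \<Omega>" "\<And>t. \<bar>t\<bar> < t0 \<Longrightarrow> cmod (p t - lam - t * c) \<le> C * t\<^sup>2"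
  shows "gamma_u \<Omega> lam < \<infinity>"
proof -
  have lamO: "lam \<in> \<Omega>" "lam \<notin> interior \<Omega>" using lam clo by (auto simp: frontier_def closure_closed)
  obtain n where n: "n \<in> supp_normals \<Omega> lam" using supporting_normal_exists[OF conv int lamO] .
  \<comment> \<open>The curve has times of both signs, so it cannot cross a supporting line
    transversally.\<close>
  have orth: "Re (c * cnj m) = 0" if m: "m \<in> supp_normals \<Omega> lam" for m
  proof -
    have m1: "cmod m = 1" and ms: "\<And>z. z \<in> \<Omega> \<Longrightarrow> Re ((z - lam) * cnj m) \<ge> 0" using m by (auto simp: supp_normals_def)
    have key: "0 \<le> t * Re (c * cnj m) + C * t\<^sup>2" if "\<bar>t\<bar> < t0" for t
    proof -
      have "Re ((p t - lam) * cnj m) = t * Re (c * cnj m) + Re ((p t - lam - t * c) * cnj m)"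
        by (simp add: algebra_simps)
      moreover have "Re ((p t - lam - t * c) * cnj m) \<le> C * t\<^sup>2"
        using complex_Re_le_cmod[of "(p t - lam - t * c) * cnj m"] p(2)[OF that] m1 by (simp add: norm_mult)
      ultimately show ?thesis using ms[OF p(1)[OF that]] by linarith
    qed
    show ?thesis
    proof (rule ccontr)
      define r where "r = Re (c * cnj m)"
      assume "Re (c * cnj m) \<noteq> 0"
      then have r: "r \<noteq> 0" by (simp add: r_def)
      \<comment> \<open>Moving for time s against the sign of r loses s |r| and regains at most C
        s^2, which is less for this s.\<close>
      define s where "s = min (t0 / 2) (\<bar>r\<bar> / (2 * (\<bar>C\<bar> + 1)))"
      have "s \<le> \<bar>r\<bar> / (2 * (\<bar>C\<bar> + 1))" by (simp add: s_def)
      then have s: "s * (2 * (\<bar>C\<bar> + 1)) \<le> \<bar>r\<bar>" by (subst (asm) pos_le_divide_eq) auto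
      have "s > 0" "s < t0" using r t0 by (auto simp: s_def min_less_iff_disj)
      note s = this s
      have "0 \<le> - s * \<bar>r\<bar> + C * s\<^sup>2"
        using key[of s] key[of "-s"] s unfolding r_def[symmetric] by (cases "r \<ge> 0") auto
      also have "... \<le> - s * \<bar>r\<bar> + s * (s * (\<bar>C\<bar> + 1))"
        using s(1) mult_right_mono[of C "\<bar>C\<bar> + 1" "s * s"] by (simp add: power2_eq_square mult_ac)
      also have "... \<le> - s * \<bar>r\<bar> + s * (\<bar>r\<bar> / 2)" using s by (intro add_left_mono mult_left_mono) (auto simp: algebra_simps)
      also have "... < 0" using s r by (simp add: field_simps)
      finally show False by simp
    qed
  qed
  have n1: "cmod n = 1" and ns: "\<And>z. z \<in> \<Omega> \<Longrightarrow> Re ((z - lam) * cnj n) \<ge> 0" using n by (auto simp: supp_normals_def)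
  define X where "X z = Re ((z - lam) * cnj (- \<i> * n))" for z
  define Y where "Y z = Re ((z - lam) * cnj n)" for z
  \<comment> \<open>P inverts the coordinates (X, Y), which turn into xi and eta once n is
    identified with \<open>l_normal\<close>.\<close>
  define P where "P x y = lam + complex_of_real x * (- \<i> * n) + complex_of_real y * n" for x y
  have nn: "n * cnj n = 1" using complex_norm_square[of n] n1 by simp
  have nsq: "(Re n)\<^sup>2 + (Im n)\<^sup>2 = 1" using n1 by (metis cmod_power2 one_power2)
  have nsq': "Re n * Re n + Im n * Im n = 1" using nsq by (simp add: power2_eq_square)
  have XP: "X (P x y) = x" and YP: "Y (P x y) = y" for x y
  proof -
    have "(P x y - lam) * cnj n = (- \<i> * of_real x + of_real y) * (n * cnj n)" by (simp add: P_def algebra_simps)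
    then have e: "(P x y - lam) * cnj n = - \<i> * of_real x + of_real y" using nn by simp
    then show "Y (P x y) = y" by (simp add: Y_def)
    have e': "(P x y - lam) * cnj (- \<i> * n) = \<i> * ((P x y - lam) * cnj n)" by simp
    show "X (P x y) = x" unfolding X_def e' e by simp
  qed
  have PXY: "P (X z) (Y z) = z" for z
  proof -
    have "complex_of_real (X z) * (- \<i>) + complex_of_real (Y z) = (z - lam) * cnj n"
      by (simp add: X_def Y_def complex_eq_iff)
    then have "P (X z) (Y z) = lam + (z - lam) * (n * cnj n)"
      unfolding P_def by (metis (no_types, opaque_lifting) add.assoc distrib_right mult.assoc mult.commute)
    then show ?thesis using nn by simp
  qed
  have Xle: "\<bar>X z\<bar> \<le> cmod (z - lam)" and Yle: "\<bar>Y z\<bar> \<le> cmod (z - lam)" for z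
    using abs_Re_le_cmod[of "(z - lam) * cnj (- \<i> * n)"] abs_Re_le_cmod[of "(z - lam) * cnj n"] n1
    by (simp_all add: X_def Y_def norm_mult)
  have Y_int: "Y w > 0" if w: "w \<in> interior \<Omega>" for w
  proof -
    obtain d where d: "d > 0" "cball w d \<subseteq> \<Omega>" using w by (auto simp: mem_interior_cball)
    have "w - of_real d * n \<in> \<Omega>" using d n1 by (intro subsetD[OF d(2)]) (simp add: dist_norm norm_mult)
    then have "0 \<le> Re ((w - of_real d * n - lam) * cnj n)" by (rule ns)
    also have "(w - of_real d * n - lam) * cnj n = (w - lam) * cnj n - of_real d * (n * cnj n)" by (simp add: algebra_simps)
    finally show ?thesis using d(1) nn by (simp add: Y_def)
  qed
  obtain w0 where w0: "w0 \<in> interior \<Omega>" using int by blast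
  \<comment> \<open>Normals orthogonal to c are equal or opposite, and an interior point excludes
    opposite ones; hence \<open>lam\<close> is not a corner.\<close>
  have uniq: "m = n" if m: "m \<in> supp_normals \<Omega> lam" for m
  proof (rule ccontr)
    assume "m \<noteq> n"
    then have "m = - n"
      using eq_or_eq_minus_if_orthogonal[OF n1 _ c orth[OF n] orth[OF m]] m by (auto simp: supp_normals_def)
    then have "Re ((w0 - lam) * cnj (- n)) \<ge> 0" using m w0 interior_subset by (auto simp: supp_normals_def)
    then show False using Y_int[OF w0] by (simp add: Y_def)
  qed
  have "\<not> corner_point \<Omega> lam" using uniq by (auto simp: corner_point_def)
  moreover have "(THE n. n \<in> supp_normals \<Omega> lam) = n" using n uniq by blast
  ultimately have ln: "l_normal \<Omega> lam = n" by (simp add: l_normal_def)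
  have xi: "xi_coord \<Omega> lam z = X z" and eta: "eta_coord \<Omega> lam z = Y z" for z
    by (simp_all add: xi_coord_def eta_coord_def ln X_def Y_def)
  \<comment> \<open>The tangential speed of the curve; it is nonzero because c has no normal
    component.\<close>
  define \<kappa> where "\<kappa> = Re (c * cnj (- \<i> * n))"
  have kap: "\<kappa> \<noteq> 0"
  proof
    assume "\<kappa> = 0"
    then have "c * cnj n = 0" using orth[OF n] by (simp add: \<kappa>_def complex_eq_iff)
    then show False using c n1 by auto
  qed
  have C0: "C \<ge> 0" using p(2)[of "t0/2"] t0 norm_ge_zero[of "p (t0/2) - lam - complex_of_real (t0/2) * c"]
    by (smt (verit) mult_neg_pos zero_less_power half_gt_zero field_sum_of_halves)
  \<comment> \<open>For |x| <= x0 and t = 2 x / \<kappa>, the first entry ensures |t| < t0 and the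
    second C t^2 <= |x|.\<close>
  define x0 where "x0 = min (\<bar>\<kappa>\<bar> * t0 / 4) (\<kappa>\<^sup>2 / (4 * C + 1))"
  have x0: "x0 > 0" using kap t0 C0 by (simp add: x0_def)
  text \<open>Shrinking \<open>p (2 x / \<kappa>)\<close> towards \<open>\<lambda>\<close> gives a point with first coordinate exactly \<open>x\<close>.\<close>
  have low: "\<exists>q\<in>\<Omega>. X q = x \<and> Y q \<le> (4 * C / \<kappa>\<^sup>2) * x\<^sup>2" if x: "x \<noteq> 0" "\<bar>x\<bar> \<le> x0" for x
  proof -
    define t where "t = 2 * x / \<kappa>"
    have "2 * \<bar>x\<bar> \<le> \<bar>\<kappa>\<bar> * t0 / 2" using x by (simp add: x0_def)
    moreover have "\<bar>\<kappa>\<bar> * t0 > 0" using kap t0 by simp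
    ultimately have "2 * \<bar>x\<bar> < \<bar>\<kappa>\<bar> * t0" by linarith
    then have tt: "\<bar>t\<bar> < t0" using kap by (simp add: t_def abs_mult field_simps)
    have t2: "C * t\<^sup>2 = (4 * C / \<kappa>\<^sup>2) * x\<^sup>2" by (simp add: t_def power_divide power_mult_distrib)
    have "\<bar>x\<bar> \<le> \<kappa>\<^sup>2 / (4 * C + 1)" using x by (simp add: x0_def)
    then have "\<bar>x\<bar> * (4 * C + 1) \<le> \<kappa>\<^sup>2" using C0 by (simp add: field_simps)
    then have "4 * C * \<bar>x\<bar> \<le> \<kappa>\<^sup>2" by (simp add: algebra_simps)
    then have "4 * C * \<bar>x\<bar> * \<bar>x\<bar> \<le> \<kappa>\<^sup>2 * \<bar>x\<bar>" by (rule mult_right_mono) simp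
    then have "4 * C * x\<^sup>2 \<le> \<kappa>\<^sup>2 * \<bar>x\<bar>" by (simp add: power2_eq_square mult.assoc)
    then have small: "C * t\<^sup>2 \<le> \<bar>x\<bar>" unfolding t2 using kap by (simp add: divide_le_eq mult.commute)
    have "X (p t) - 2 * x = Re ((p t - lam - t * c) * cnj (- \<i> * n))"
    proof -
      have "2 * x = t * \<kappa>" using kap by (simp add: t_def)
      then show ?thesis by (simp add: X_def \<kappa>_def algebra_simps)
    qed
    then have Xd: "\<bar>X (p t) - 2 * x\<bar> \<le> \<bar>x\<bar>"
      using abs_Re_le_cmod[of "(p t - lam - t * c) * cnj (- \<i> * n)"] p(2)[OF tt] n1 small by (simp add: norm_mult)
    have "(p t - lam - t * c) * cnj n = (p t - lam) * cnj n - complex_of_real t * (c * cnj n)"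
      by (simp add: algebra_simps)
    then have "Y (p t) = Re ((p t - lam - t * c) * cnj n)" unfolding Y_def using orth[OF n] by simp
    then have Yd: "Y (p t) \<le> C * t\<^sup>2"
      using complex_Re_le_cmod[of "(p t - lam - t * c) * cnj n"] p(2)[OF tt] n1 by (simp add: norm_mult)
    define r where "r = X (p t) / x"
    have r: "r \<ge> 1" using Xd x(1) by (cases "x > 0") (auto simp: r_def field_simps abs_if split: if_splits)
    define q where "q = (1 - 1 / r) *\<^sub>R lam + (1 / r) *\<^sub>R p t"
    have "q \<in> \<Omega>" unfolding q_def by (rule convexD[OF conv lamO(1) p(1)[OF tt]]) (use r in auto)
    moreover have ql: "q - lam = complex_of_real (1 / r) * (p t - lam)"
      by (simp add: q_def scaleR_conv_of_real diff_divide_distrib left_diff_distrib right_diff_distrib)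
    have "X q = 1 / r * X (p t)" "Y q = 1 / r * Y (p t)" unfolding X_def Y_def ql mult.assoc by simp_all
    moreover have "1 / r * X (p t) = x" using r x(1) by (auto simp: r_def)
    moreover have "1 / r * Y (p t) \<le> Y (p t)"
      using r ns[OF p(1)[OF tt]] mult_right_mono[of "1 / r" 1 "Y (p t)"] by (simp add: Y_def)
    ultimately show ?thesis using Yd t2 by (intro bexI[of _ q]) auto
  qed
  \<comment> \<open>An interior point on the normal line through \<open>lam\<close>: if w0 is off
    that line, the segment from w0 to a low point on the other side crosses it at an interior
    point.\<close>
  obtain y0 where y0: "y0 \<in> interior \<Omega>" "X y0 = 0"
  proof (cases "X w0 = 0")
    case False
    define x where "x = - sgn (X w0) * x0"
    have x: "x \<noteq> 0" "\<bar>x\<bar> \<le> x0" "x * X w0 < 0"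
      using False x0 linorder_neqE_linordered_idom[OF False]
      by (auto simp: x_def abs_mult sgn_if mult_pos_neg mult_neg_pos)
    obtain q where q: "q \<in> \<Omega>" "X q = x" using low[OF x(1,2)] by blast
    define u where "u = X w0 / (X w0 - x)"
    have u: "0 < u" "u < 1" using x(3) by (cases "X w0 > 0"; auto simp: u_def field_simps mult_less_0_iff)+
    define y where "y = (1 - u) *\<^sub>R w0 + u *\<^sub>R q"
    have "w0 \<noteq> q" using q(2) x(3) by (auto simp: mult_less_0_iff)
    then have "y \<in> open_segment w0 q" using u by (auto simp: y_def in_segment)
    then have "y \<in> interior \<Omega>"
      using in_interior_closure_convex_segment[OF conv w0] q(1) closure_subset by blast
    moreover have "X y = (1 - u) * X w0 + u * X q"
      by (simp add: X_def y_def scaleR_conv_of_real algebra_simps)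
    then have "X y = 0" using x(3) unfolding q(2) u_def by (auto simp: field_simps mult_less_0_iff)
    ultimately show ?thesis by (rule that)
  qed (use w0 that in blast)
  define h where "h = Y y0"
  have h: "h > 0" using Y_int[OF y0(1)] by (simp add: h_def)
  obtain \<rho> where rho: "\<rho> > 0" "ball y0 \<rho> \<subseteq> interior \<Omega>"
    using y0(1) open_contains_ball[of "interior \<Omega>"] by auto
  \<comment> \<open>Small enough that a frontier point z in the disc lies below height h, over the
    ball around y0, and within the range of \<open>low\<close>.\<close>
  define \<epsilon> where "\<epsilon> = min (min (\<rho> / 2) (h / 2)) x0"
  show ?thesis
  proof (rule gamma_u_finite)
    show "0 < \<epsilon>" using rho h x0 by (simp add: \<epsilon>_def)
    fix z assume z: "z \<in> frontier \<Omega>" "cmod (z - lam) \<le> \<epsilon>" "xi_coord \<Omega> lam z \<noteq> 0"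
    have x: "X z \<noteq> 0" "\<bar>X z\<bar> \<le> x0" "\<bar>X z\<bar> < \<rho>" "Y z < h"
      using z Xle[of z] Yle[of z] rho h by (auto simp: xi \<epsilon>_def)
    obtain q where q: "q \<in> \<Omega>" "X q = X z" "Y q \<le> (4 * C / \<kappa>\<^sup>2) * (X z)\<^sup>2" using low[OF x(1,2)] by blast
    \<comment> \<open>Otherwise z lies strictly between the low point q and the point y of height h
      on the same vertical line; as y is interior, z would be interior too.\<close>
    have "Y z \<le> Y q"
    proof (rule ccontr)
      assume "\<not> Y z \<le> Y q"
      then have lt: "Y q < Y z" by simp
      define y where "y = P (X z) h"
      have "y - y0 = P (X z) h - P 0 h" using PXY[of y0] y0(2) by (simp add: y_def h_def)
      also have "... = complex_of_real (X z) * (- \<i> * n)" by (simp add: P_def)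
      finally have "cmod (y - y0) = \<bar>X z\<bar>" using n1 by (simp add: norm_mult)
      then have "dist y0 y = \<bar>X z\<bar>" by (simp add: dist_norm norm_minus_commute)
      then have y: "y \<in> interior \<Omega>" using rho x(3) by auto
      define u where "u = (h - Y z) / (h - Y q)"
      have u: "0 < u" "u < 1" using lt x(4) by (auto simp: u_def field_simps)
      have qe: "q = P (X z) (Y q)" using PXY[of q] q(2) by simp
      have "u * (h - Y q) = h - Y z" using lt x(4) by (simp add: u_def)
      then have "(1 - u) * h + u * Y q = Y z" by (simp add: algebra_simps)
      then have ze: "z = P (X z) ((1 - u) * h + u * Y q)" using PXY[of z] by simp
      have "P x ((1 - u) * h + u * k) = (1 - u) *\<^sub>R P x h + u *\<^sub>R P x k" for x k
        by (simp add: P_def scaleR_conv_of_real algebra_simps)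
      from trans[OF ze this] have "z = (1 - u) *\<^sub>R y + u *\<^sub>R q" unfolding y_def qe[symmetric] .
      moreover have "y \<noteq> q" using YP[of "X z" h] lt x(4) by (auto simp: y_def)
      ultimately have "z \<in> open_segment y q" using u by (auto simp: in_segment)
      then have "z \<in> interior \<Omega>" using in_interior_closure_convex_segment[OF conv y] q(1) closure_subset by blast
      then show False using z(1) by (simp add: frontier_def)
    qed
    then show "eta_coord \<Omega> lam z \<le> (4 * C / \<kappa>\<^sup>2) * (xi_coord \<Omega> lam z)\<^sup>2" using q(3) by (simp add: xi eta)
  qed
qed

section \<open>The numerical range\<close>

lemma cmod_cis_minus_1: "cmod (cis s - 1) \<le> \<bar>s\<bar>"
proof -
  have "(cmod (cis s - 1))\<^sup>2 = (cos s - 1)\<^sup>2 + (sin s)\<^sup>2" by (simp add: cmod_power2)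
  also have "... = 2 - 2 * cos s" using sin_cos_squared_add[of s] unfolding power2_diff by simp
  also have "... = (2 * sin (s / 2))\<^sup>2"
    using cos_double_sin[of "s / 2"] by (simp add: power_mult_distrib)
  finally have "cmod (cis s - 1) \<le> \<bar>2 * sin (s / 2)\<bar>"
    using abs_le_square_iff[of "cmod (cis s - 1)" "2 * sin (s / 2)"] by simp
  also have "... \<le> \<bar>s\<bar>" using abs_sin_x_le_abs_x[of "s / 2"] by simp
  finally show ?thesis .
qed

lemma tendsto_one_minus_cos:
  fixes \<theta> :: real
  shows "((\<lambda>t. (1 - cos (\<theta> * t)) / t\<^sup>2) \<longlongrightarrow> \<theta>\<^sup>2 / 2) (at_right 0)"
proof -
  have "((\<lambda>t. sin (\<theta> / 2 * t)) has_real_derivative \<theta> / 2) (at 0)"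
    by (auto intro!: derivative_eq_intros)
  then have "((\<lambda>t. sin (\<theta> / 2 * t) / t) \<longlongrightarrow> \<theta> / 2) (at 0)" by (simp add: has_field_derivative_iff)
  then have "((\<lambda>t. sin (\<theta> / 2 * t) / t) \<longlongrightarrow> \<theta> / 2) (at_right 0)"
    by (rule tendsto_mono[rotated]) (simp add: at_le)
  then have "((\<lambda>t. 2 * (sin (\<theta> / 2 * t) / t)\<^sup>2) \<longlongrightarrow> 2 * (\<theta> / 2)\<^sup>2) (at_right 0)"
    by (intro tendsto_mult[OF tendsto_const] tendsto_power)
  moreover have e: "2 * (sin (\<theta> / 2 * t) / t)\<^sup>2 = (1 - cos (\<theta> * t)) / t\<^sup>2" for t
    using cos_double_sin[of "\<theta> / 2 * t"] by (simp add: power_divide)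
  ultimately have "((\<lambda>t. (1 - cos (\<theta> * t)) / t\<^sup>2) \<longlongrightarrow> 2 * (\<theta> / 2)\<^sup>2) (at_right 0)" by (simp only: e)
  then show ?thesis by (simp add: power_divide)
qed

text \<open>Adding the two signs of s cancels the sine terms, leaving only cosines.\<close>

lemma cis_sum_squares:
  "(cmod (cis s * w - z))\<^sup>2 + (cmod (cis (- s) * w - z))\<^sup>2
     = 2 * cos s * (cmod (w - z))\<^sup>2 + 2 * (1 - cos s) * ((cmod w)\<^sup>2 + (cmod z)\<^sup>2)"
proof -
  have s: "sin s * sin s = 1 - cos s * cos s" using sin_cos_squared_add[of s] unfolding power2_eq_square by linarith
  have s': "sin s * (sin s * x) = x - cos s * (cos s * x)" for x
    unfolding mult.assoc[symmetric] s by (simp add: algebra_simps)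
  show ?thesis unfolding cmod_power2 by (simp add: power2_eq_square algebra_simps s s')
qed

text \<open>Multiplication by the plane wave exp(i k x . e): a shift in momentum space that leaves
  |f|, and so the potential energy, unchanged.\<close>

definition modulate :: "real \<Rightarrow> 'a::euclidean_space \<Rightarrow> ('a \<Rightarrow> complex) \<Rightarrow> 'a \<Rightarrow> complex" where
  "modulate k e f x = cis (k * (x \<bullet> e)) * f x"

lemma cmod_modulate [simp]: "cmod (modulate k e f x) = cmod (f x)"
  by (simp add: modulate_def norm_mult)

lemma sdiff_modulate:
  "sdiff t b (modulate k e f) x = cis (k * (x \<bullet> e)) * (cis (k * (t * (b \<bullet> e))) * f (x + t *\<^sub>R b) - f x)"
  by (simp add: sdiff_def modulate_def inner_add_left algebra_simps flip: cis_mult)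

lemma borel_measurable_modulate:
  assumes "f \<in> borel_measurable lebesgue" shows "modulate k e f \<in> borel_measurable lebesgue"
proof -
  have "continuous_on UNIV (\<lambda>x. cis (k * (x \<bullet> e)))" by (intro continuous_intros)
  from borel_measurable_times[OF continuous_borel_measurable_lebesgue[OF this] assms]
  show ?thesis by (simp add: modulate_def[abs_def])
qed

lemma L2_modulate: "L2 f \<Longrightarrow> L2 (modulate k e f)"
  by (rule L2_bound[of f _ 1]) (auto simp: L2_def borel_measurable_modulate)

definition bump :: "'a::euclidean_space \<Rightarrow> real \<Rightarrow> 'a \<Rightarrow> real" where
  "bump x0 r x = max 0 (r - dist x x0)"

lemma bump_nonneg: "0 \<le> bump x0 r x" and bump_pos: "x \<in> ball x0 r \<Longrightarrow> 0 < bump x0 r x"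
  and bump_zero: "x \<notin> ball x0 r \<Longrightarrow> bump x0 r x = 0"
  by (auto simp: bump_def dist_commute)

lemma bump_lipschitz: "\<bar>bump x0 r x - bump x0 r y\<bar> \<le> 1 * dist x y"
proof -
  have "\<bar>dist x x0 - dist y x0\<bar> \<le> dist x y"
    using dist_triangle[of x x0 y] dist_triangle[of y x0 x] by (simp add: dist_commute)
  then show ?thesis by (auto simp: bump_def max_def)
qed

section \<open>The numerical range of the form\<close>

context schrodinger_form begin

lemma bump_form_dom: "(\<lambda>x. complex_of_real (bump x0 r x)) \<in> form_dom V"
  by (rule form_dom_lipschitz[OF bump_lipschitz, of "cball x0 r"]) (use bump_zero[of _ x0 r] in auto)

text \<open>On the ball Im V - c has the constant sign \<sigma> and \<open>bump\<close> is positive;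
  outside, \<open>bump\<close> vanishes. The integrand thus has one sign, and its zero integral
  forces w to vanish on the ball.\<close>

lemma vanishes_on_ball:
  assumes int: "integrable lebesgue (\<lambda>x. (Im (V x) - c) * (w x * bump x0 r x))"
    and zero: "(LINT x|lebesgue. (Im (V x) - c) * (w x * bump x0 r x)) = 0"
    and w: "\<And>x. 0 \<le> w x"
    and sign: "\<And>x. x \<in> ball x0 r \<Longrightarrow> 0 < \<sigma> * (Im (V x) - c)"
  shows "AE x in lebesgue. x \<in> ball x0 r \<longrightarrow> w x = 0"
proof -
  have "AE x in lebesgue. \<sigma> * ((Im (V x) - c) * (w x * bump x0 r x)) = 0"
  proof (subst integral_nonneg_eq_0_iff_AE[symmetric])
    show "integrable lebesgue (\<lambda>x. \<sigma> * ((Im (V x) - c) * (w x * bump x0 r x)))" using int by simp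
    have "0 \<le> \<sigma> * ((Im (V x) - c) * (w x * bump x0 r x))" for x
      using sign[of x] w[of x] bump_nonneg[of x0 r x] bump_zero[of x x0 r]
      by (cases "x \<in> ball x0 r") (simp_all flip: mult.assoc)
    then show "AE x in lebesgue. 0 \<le> \<sigma> * ((Im (V x) - c) * (w x * bump x0 r x))" by simp
  qed (use zero in simp)
  then show ?thesis
  proof eventually_elim
    fix x assume z: "\<sigma> * ((Im (V x) - c) * (w x * bump x0 r x)) = 0"
    show "x \<in> ball x0 r \<longrightarrow> w x = 0"
    proof
      assume "x \<in> ball x0 r"
      then show "w x = 0" using z sign[of x] bump_pos[of x x0 r] by auto
    qed
  qed
qed

text \<open>The condition \<open>null\<close> of \<open>Toeplitz_Hausdorff\<close>. A function that
  vanishes almost everywhere has differences of norm 0, so its gradient pairings vanish as limits of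
  quotients.\<close>

lemma form_E_zero:
  assumes x: "x \<in> form_dom V" and y: "y \<in> form_dom V" and 0: "Re (L2_inner x x) = 0"
  shows "form_E V x y = 0 \<and> form_E V y x = 0"
proof -
  have Lx: "L2 x" and Ly: "L2 y" using form_domD(2) x y by blast+
  have n0: "L2_norm x = 0" using 0 by (simp add: L2_inner_self_norm)
  have AE0: "AE z in lebesgue. x z = 0" by (rule L2_norm_zero_AE[OF Lx n0])
  have "L2_norm (sdiff t b x) \<le> 0" for t b
    unfolding sdiff_def using L2_norm_add[OF L2_translate[OF Lx] L2_scl[OF Lx, of "-1"], of "t *\<^sub>R b"]
    by (simp add: L2_norm_scl[OF Lx] L2_norm_translate[OF Lx] n0 L2_norm_scl[OF Lx, of "-1", simplified])
  then have "L2_inner (sdiff t b x) (sdiff t b y) = 0" for t b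
    using L2_Cauchy_Schwarz[OF L2_sdiff[OF Lx] L2_sdiff[OF Ly], of t b t b] L2_norm_nonneg[of "sdiff t b x"]
    by (metis antisym mult_zero_left norm_le_zero_iff)
  then have "((\<lambda>t. grad_quot t x y) \<longlongrightarrow> 0) (at_right 0)" by (simp add: grad_quot_def)
  then have g: "grad_inner x y = 0"
    using tendsto_unique[OF trivial_limit_at_right_real grad_quot_tendsto[OF form_domD(1)[OF x] form_domD(1)[OF y]]] by blast
  then have g': "grad_inner y x = 0" using H1.psdD(2)[OF grad_inner_psd form_domD(1)[OF x] form_domD(1)[OF y]] by simp
  have "potential_form V x y = 0" "potential_form V y x = 0"
    unfolding potential_form_def by (rule integral_eq_zero_AE, use AE0 in eventually_elim, simp)+
  then show ?thesis using g g' by (simp add: form_E_eq)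
qed

lemma form_dom_modulate:
  assumes f: "f \<in> form_dom V" shows "modulate k e f \<in> form_dom V"
proof (rule form_dom_I_dominated[OF _ form_domD(3)[OF f]])
  show "modulate k e f \<in> H1"
  proof (rule H1_I_dominated[OF L2_modulate[OF form_domD(2)[OF f]] form_domD(1)[OF f] H1_zero L2_scl[OF form_domD(2)[OF f], of "of_real (\<bar>k\<bar> * norm e)"], of 1])
    fix b :: 'a and t :: real and x assume b: "b \<in> Basis" and t: "0 < t" "t \<le> 1"
    define s where "s = k * (t * (b \<bullet> e))"
    have "cmod (sdiff t b (modulate k e f) x) = cmod (cis s * (f (x + t *\<^sub>R b) - f x) + (cis s - 1) * f x)"
      unfolding sdiff_modulate norm_mult s_def[symmetric] by (simp add: algebra_simps)
    also have "... \<le> cmod (f (x + t *\<^sub>R b) - f x) + cmod (cis s - 1) * cmod (f x)"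
      using norm_triangle_ineq[of "cis s * (f (x + t *\<^sub>R b) - f x)" "(cis s - 1) * f x"] by (simp add: norm_mult)
    also have "cmod (cis s - 1) * cmod (f x) \<le> t * (\<bar>k\<bar> * norm e) * cmod (f x)"
    proof (intro mult_right_mono)
      have "\<bar>b \<bullet> e\<bar> \<le> norm e" using Cauchy_Schwarz_ineq2[of b e] b by simp
      then have "\<bar>s\<bar> \<le> t * (\<bar>k\<bar> * norm e)"
        using t mult_left_mono[of "\<bar>b \<bullet> e\<bar>" "norm e" "\<bar>k\<bar> * t"] by (simp add: s_def abs_mult mult_ac)
      then show "cmod (cis s - 1) \<le> t * (\<bar>k\<bar> * norm e)" using cmod_cis_minus_1[of s] by linarith
    qed simp
    finally show "cmod (sdiff t b (modulate k e f) x) \<le> 1 * cmod (sdiff t b f x) + 1 * cmod (sdiff t b (\<lambda>x. 0) x)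
        + t * cmod (complex_of_real (\<bar>k\<bar> * norm e) * f x)"
      by (simp add: sdiff_def norm_mult mult_ac)
  qed simp
qed (simp add: norm_mult norm_power)

lemma form_E_self_real_parts:
  "form_E V f f = complex_of_real (Re (grad_inner f f)) + potential_form V f f"
  unfolding form_E_eq grad_inner_def L2_inner_self_norm by (simp flip: of_real_sum of_real_power)

text \<open>The opposite momentum shifts k e and -k e cancel to first order. The term k^2 comes from
  (1 - cos(k t (b . e))) / t^2, whose limits are summed over the basis with e a unit vector.\<close>

lemma form_E_modulate:
  assumes f: "f \<in> form_dom V" and e: "norm e = 1"
  shows "form_E V (modulate k e f) (modulate k e f) + form_E V (modulate (- k) e f) (modulate (- k) e f)
     = 2 * form_E V f f + 2 * k\<^sup>2 * (L2_norm f)\<^sup>2"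
proof -
  have Lf: "L2 f" and Hf: "f \<in> H1" using form_domD f by blast+
  let ?F = "\<lambda>s. modulate s e f"
  have HF: "?F s \<in> H1" for s using form_domD(1) form_dom_modulate[OF f] by blast
  have LF: "L2 (sdiff t b (?F s))" for s t b using L2_sdiff[OF L2_modulate[OF Lf]] .
  have sq: "(L2_norm (sdiff t b (?F k)))\<^sup>2 + (L2_norm (sdiff t b (?F (- k))))\<^sup>2
     = 2 * cos (k * (b \<bullet> e) * t) * (L2_norm (sdiff t b f))\<^sup>2 + 4 * (1 - cos (k * (b \<bullet> e) * t)) * (L2_norm f)\<^sup>2" for t b
  proof -
    define s where "s = k * (t * (b \<bullet> e))"
    have pt: "(cmod (sdiff t b (?F k) x))\<^sup>2 + (cmod (sdiff t b (?F (- k)) x))\<^sup>2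
      = 2 * cos s * (cmod (sdiff t b f x))\<^sup>2 + 2 * (1 - cos s) * ((cmod (f (x + t *\<^sub>R b)))\<^sup>2 + (cmod (f x))\<^sup>2)" for x
      using cis_sum_squares[of s "f (x + t *\<^sub>R b)" "f x"]
      unfolding sdiff_modulate norm_mult norm_cis by (simp add: s_def sdiff_def)
    have i: "integrable lebesgue (\<lambda>x. (cmod (g x))\<^sup>2)" if "L2 g" for g :: "'a \<Rightarrow> complex" using that by (simp add: L2_def)
    have "(L2_norm (sdiff t b (?F k)))\<^sup>2 + (L2_norm (sdiff t b (?F (- k))))\<^sup>2
      = (LINT x|lebesgue. (cmod (sdiff t b (?F k) x))\<^sup>2 + (cmod (sdiff t b (?F (- k)) x))\<^sup>2)"
      unfolding L2_norm_sq by (rule Bochner_Integration.integral_add[symmetric]) (intro i LF)+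
    also have "... = 2 * cos s * (L2_norm (sdiff t b f))\<^sup>2 + 2 * (1 - cos s) * ((L2_norm (\<lambda>x. f (x + t *\<^sub>R b)))\<^sup>2 + (L2_norm f)\<^sup>2)"
      unfolding pt L2_norm_sq using i[OF L2_sdiff[OF Lf], of t b] i[OF L2_translate[OF Lf], of "t *\<^sub>R b"] i[OF Lf]
      by simp
    finally show ?thesis by (simp add: L2_norm_translate[OF Lf] s_def mult_ac)
  qed
  have q: "Re (grad_quot t g g) = (\<Sum>b\<in>Basis. (L2_norm (sdiff t b g))\<^sup>2 / t\<^sup>2)" for t and g :: "'a \<Rightarrow> complex"
    unfolding grad_quot_def L2_inner_self_norm of_real_power[symmetric] of_real_divide[symmetric] of_real_sum[symmetric] Re_complex_of_real ..
  have lim1: "((\<lambda>t. Re (grad_quot t (?F k) (?F k)) + Re (grad_quot t (?F (- k)) (?F (- k))))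
     \<longlongrightarrow> Re (grad_inner (?F k) (?F k)) + Re (grad_inner (?F (- k)) (?F (- k)))) (at_right 0)"
    by (intro tendsto_intros grad_quot_tendsto HF)
  have "((\<lambda>t. \<Sum>b\<in>Basis. 2 * cos (k * (b \<bullet> e) * t) * (L2_norm (sdiff t b f) / t)\<^sup>2
       + 4 * ((1 - cos (k * (b \<bullet> e) * t)) / t\<^sup>2) * (L2_norm f)\<^sup>2)
     \<longlongrightarrow> (\<Sum>b\<in>Basis. 2 * cos (k * (b \<bullet> e) * 0) * (L2_norm (weak_pderiv f b))\<^sup>2 + 4 * ((k * (b \<bullet> e))\<^sup>2 / 2) * (L2_norm f)\<^sup>2)) (at_right 0)"
    by (intro tendsto_intros tendsto_one_minus_cos sdiff_norm_tendsto Lf H1_weak_pderiv Hf)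
  also have "(\<lambda>t. \<Sum>b\<in>Basis. 2 * cos (k * (b \<bullet> e) * t) * (L2_norm (sdiff t b f) / t)\<^sup>2
       + 4 * ((1 - cos (k * (b \<bullet> e) * t)) / t\<^sup>2) * (L2_norm f)\<^sup>2)
     = (\<lambda>t. Re (grad_quot t (?F k) (?F k)) + Re (grad_quot t (?F (- k)) (?F (- k))))"
    unfolding q sum.distrib[symmetric] add_divide_distrib[symmetric] sq by (simp add: power_divide add_divide_distrib)
  also have "(\<Sum>b\<in>Basis. 2 * cos (k * (b \<bullet> e) * 0) * (L2_norm (weak_pderiv f b))\<^sup>2 + 4 * ((k * (b \<bullet> e))\<^sup>2 / 2) * (L2_norm f)\<^sup>2)
     = 2 * Re (grad_inner f f) + 2 * k\<^sup>2 * (L2_norm f)\<^sup>2"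
  proof -
    have "(\<Sum>b\<in>Basis. (b \<bullet> e)\<^sup>2) = 1"
      using e euclidean_inner[of e e] by (simp add: dot_square_norm power2_eq_square inner_commute)
    moreover have "(\<Sum>b\<in>Basis. 4 * ((k * (b \<bullet> e))\<^sup>2 / 2) * (L2_norm f)\<^sup>2) = 2 * k\<^sup>2 * (L2_norm f)\<^sup>2 * (\<Sum>b\<in>Basis. (b \<bullet> e)\<^sup>2)"
      by (simp add: sum_distrib_left power_mult_distrib mult_ac)
    moreover have "(\<Sum>b\<in>Basis. 2 * (L2_norm (weak_pderiv f b))\<^sup>2) = 2 * Re (grad_inner f f)"
      unfolding grad_inner_def L2_inner_self_norm by (simp add: sum_distrib_left)
    ultimately show ?thesis by (simp add: sum.distrib)
  qed
  finally have g: "Re (grad_inner (?F k) (?F k)) + Re (grad_inner (?F (- k)) (?F (- k))) = 2 * Re (grad_inner f f) + 2 * k\<^sup>2 * (L2_norm f)\<^sup>2"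
    using tendsto_unique[OF trivial_limit_at_right_real lim1] by blast
  have p: "potential_form V g g = (LINT x|lebesgue. V x * complex_of_real ((cmod (g x))\<^sup>2))" for g
    unfolding potential_form_def complex_norm_square by (simp add: mult.assoc)
  have "form_E V (?F k) (?F k) + form_E V (?F (- k)) (?F (- k))
    = complex_of_real (Re (grad_inner (?F k) (?F k)) + Re (grad_inner (?F (- k)) (?F (- k)))) + 2 * potential_form V f f"
    unfolding form_E_self_real_parts p by simp
  then show ?thesis unfolding g form_E_self_real_parts[of f] by simp
qed

text \<open>Unlike \<open>Num V\<close>, this set is accessible to |f| and to modulated functions,
  which are known to lie only in the form domain.\<close>

definition form_range :: "complex set" where
  "form_range = {form_E V f f |f. f \<in> form_dom V \<and> Re (L2_inner f f) = 1}"

lemma form_range_convex: "convex form_range"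
  unfolding form_range_def by (rule FD.Toeplitz_Hausdorff[OF form_E_sesq L2_inner_psd_form form_E_zero])

lemma form_range_I: "f \<in> form_dom V \<Longrightarrow> L2_norm f = 1 \<Longrightarrow> form_E V f f \<in> form_range"
  unfolding form_range_def L2_inner_self_norm by auto

lemma form_range_E:
  assumes "z \<in> form_range" obtains f where "f \<in> form_dom V" "L2_norm f = 1" "z = form_E V f f"
proof -
  obtain f where f: "f \<in> form_dom V" "Re (L2_inner f f) = 1" "z = form_E V f f" using assms by (auto simp: form_range_def)
  have "L2_norm f = 1" using f(2) L2_norm_nonneg[of f] by (simp add: L2_inner_self_norm power2_eq_1_iff)
  then show ?thesis using that f by blast
qed

lemma form_range_normalise:
  assumes f: "f \<in> form_dom V" and n: "L2_norm f \<noteq> 0"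
  shows "form_E V f f / (L2_norm f)\<^sup>2 \<in> form_range"
proof -
  let ?c = "complex_of_real (1 / L2_norm f)"
  have "form_E V (cscl ?c f) (cscl ?c f) = form_E V f f / (L2_norm f)\<^sup>2"
    using FD.sesq_simps(3)[OF form_E_sesq f FD.D_scl[OF f], of ?c ?c] FD.sesq_simps(4)[OF form_E_sesq f f, of ?c]
    by (simp add: power2_eq_square)
  moreover have "L2_norm (cscl ?c f) = 1"
    unfolding L2_norm_scl[OF form_domD(2)[OF f]] using n L2_norm_nonneg[of f] by (simp add: norm_divide)
  ultimately show ?thesis using form_range_I[OF FD.D_scl[OF f, of ?c]] by simp
qed

text \<open>\<open>form_E_modulate\<close> gives only the average of the two modulated values, so
  convexity is what places the shifted point in the range.\<close>

lemma form_range_shift: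
  assumes z: "z \<in> form_range" shows "z + complex_of_real (k\<^sup>2) \<in> form_range"
proof -
  obtain f where f: "f \<in> form_dom V" "L2_norm f = 1" "z = form_E V f f" using z by (rule form_range_E)
  obtain e :: 'a where "e \<in> Basis" using nonempty_Basis by blast
  then have e: "norm e = 1" by simp
  have n: "L2_norm (modulate s e f) = 1" for s using f(2) by (simp add: L2_norm_def)
  have "(1/2) *\<^sub>R form_E V (modulate k e f) (modulate k e f) + (1/2) *\<^sub>R form_E V (modulate (- k) e f) (modulate (- k) e f) \<in> form_range"
    by (rule convexD[OF form_range_convex]) (use n form_range_I form_dom_modulate[OF f(1)] in auto)
  also have "(1/2) *\<^sub>R form_E V (modulate k e f) (modulate k e f) + (1/2) *\<^sub>R form_E V (modulate (- k) e f) (modulate (- k) e f)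
     = (1/2) *\<^sub>R (2 * form_E V f f + 2 * k\<^sup>2 * (L2_norm f)\<^sup>2)"
    unfolding form_E_modulate[OF f(1) e, symmetric] by (rule scaleR_add_right[symmetric])
  also have "... = z + complex_of_real (k\<^sup>2)" using f by (simp add: scaleR_conv_of_real)
  finally show ?thesis .
qed

lemma Im_form_E: "Im (form_E V f f) = Im (potential_form V f f)"
  by (simp add: form_E_self_real_parts)

lemma integrable_Im_potential:
  assumes v: "(\<lambda>x. complex_of_real (v x)) \<in> form_dom V" and w: "(\<lambda>x. complex_of_real (w x)) \<in> form_dom V"
  shows "integrable lebesgue (\<lambda>x. (Im (V x) - c) * (v x * w x))"
    "(LINT x|lebesgue. (Im (V x) - c) * (v x * w x))
      = Im (potential_form V (\<lambda>x. complex_of_real (v x)) (\<lambda>x. complex_of_real (w x)))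
        - c * Re (L2_inner (\<lambda>x. complex_of_real (v x)) (\<lambda>x. complex_of_real (w x)))"
proof -
  have i1: "integrable lebesgue (\<lambda>x. V x * complex_of_real (v x) * cnj (complex_of_real (w x)))"
    using form_dom_integrable[OF v w] .
  have i2: "integrable lebesgue (\<lambda>x. complex_of_real (v x) * cnj (complex_of_real (w x)))"
    by (rule integrable_mult_L2) (use form_domD(2) v w in blast)+
  have e: "(Im (V x) - c) * (v x * w x) = Im (V x * complex_of_real (v x) * cnj (complex_of_real (w x)))
     - c * Re (complex_of_real (v x) * cnj (complex_of_real (w x)))" for x by (simp add: algebra_simps)
  show "integrable lebesgue (\<lambda>x. (Im (V x) - c) * (v x * w x))"
    unfolding e using i1 i2 by (intro Bochner_Integration.integrable_diff integrable_Im integrable_mult_right integrable_Re)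
  show "(LINT x|lebesgue. (Im (V x) - c) * (v x * w x))
      = Im (potential_form V (\<lambda>x. complex_of_real (v x)) (\<lambda>x. complex_of_real (w x)))
        - c * Re (L2_inner (\<lambda>x. complex_of_real (v x)) (\<lambda>x. complex_of_real (w x)))"
    unfolding e potential_form_def L2_inner_def
    using integral_Im[OF i1] integral_Re[OF i2] integrable_Im[OF i1] integrable_Re[OF i2] by simp
qed

end

text \<open>Whatever c is, Im V differs from c at one of the two points of \<open>C1\<close>, and
  continuity there fixes the sign on a ball.\<close>

lemma C1_sign:
  assumes "C1 V"
  obtains x0 r \<sigma> where "r > 0" "\<And>x. x \<in> ball x0 r \<Longrightarrow> 0 < \<sigma> * (Im (V x) - c)"
proof -
  obtain x1 where x1: "isCont (\<lambda>x. Im (V x)) x1" "Im (V x1) \<noteq> c"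
    using assms unfolding C1_def by metis
  define d where "d = \<bar>Im (V x1) - c\<bar>"
  have d: "d > 0" using x1 by (simp add: d_def)
  obtain r where r: "r > 0" "\<And>x. dist x x1 < r \<Longrightarrow> dist (Im (V x)) (Im (V x1)) < d"
    using x1(1) d unfolding continuous_at_eps_delta by (metis)
  show thesis
  proof (rule that[of r x1 "sgn (Im (V x1) - c)"])
    fix x assume "x \<in> ball x1 r"
    then have "\<bar>Im (V x) - Im (V x1)\<bar> < d" using r(2)[of x] by (simp add: dist_commute dist_real_def)
    then show "0 < sgn (Im (V x1) - c) * (Im (V x) - c)" unfolding d_def by (auto simp: sgn_if)
  qed (rule r)
qed

lemma not_AE_notin_ball:
  assumes "r > 0" shows "\<not> (AE x in lebesgue. (x::'a::euclidean_space) \<notin> ball x0 r)"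
proof
  assume "AE x in lebesgue. x \<notin> ball x0 r"
  then have "ball x0 r \<in> null_sets lebesgue"
    using AE_iff_null_sets[of "ball x0 r" lebesgue] by simp
  then have "negligible (ball x0 r)" by (simp add: negligible_iff_null_sets)
  then show False using open_not_negligible[of "ball x0 r"] assms by simp
qed

section \<open>Closed sectorial forms and the numerical range of the operator\<close>

locale schrodinger = schrodinger_form +
  assumes closed: "closed_form V" and sectorial: "sectorial_form V" and C1: "C1 V"
begin

text \<open>Otherwise the form evaluated at a bump would make Im V - c integrate to 0 against a
  positive weight on a ball where it has a strict sign.\<close>

lemma Im_form_not_constant: "\<exists>f\<in>form_dom V. Im (form_E V f f) \<noteq> c * (L2_norm f)\<^sup>2"
proof (rule ccontr)
  assume "\<not> ?thesis"
  then have eq: "Im (form_E V f f) = c * (L2_norm f)\<^sup>2" if "f \<in> form_dom V" for f using that by blast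
  obtain x0 r \<sigma> where r: "r > 0" "\<And>x. x \<in> ball x0 r \<Longrightarrow> 0 < \<sigma> * (Im (V x) - c)" using C1_sign[OF C1] by metis
  let ?b = "\<lambda>x. complex_of_real (bump x0 r x)"
  note i = integrable_Im_potential[OF bump_form_dom[of x0 r] bump_form_dom[of x0 r], of c]
  have "(LINT x|lebesgue. (Im (V x) - c) * (bump x0 r x * bump x0 r x)) = 0"
    unfolding i(2) using eq[OF bump_form_dom[of x0 r]] by (simp add: Im_form_E L2_inner_self_norm)
  then have "AE x in lebesgue. x \<in> ball x0 r \<longrightarrow> bump x0 r x = 0"
    by (rule vanishes_on_ball[OF i(1) _ bump_nonneg]) (rule r(2))
  then have "AE x in lebesgue. x \<notin> ball x0 r"
  proof eventually_elim
    case (elim x)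
    then show ?case using bump_pos[of x x0 r] by auto
  qed
  then show False using not_AE_notin_ball[OF r(1)] by blast
qed

lemma form_range_Im_distinct:
  obtains p q where "p \<in> form_range" "q \<in> form_range" "Im p \<noteq> Im q"
proof -
  have "\<exists>p\<in>form_range. Im p \<noteq> c" for c
  proof -
    obtain f where f: "f \<in> form_dom V" "Im (form_E V f f) \<noteq> c * (L2_norm f)\<^sup>2" using Im_form_not_constant by blast
    have n: "L2_norm f \<noteq> 0"
    proof
      assume n: "L2_norm f = 0"
      then have "form_E V f f = 0" using form_E_zero[OF f(1) f(1)] by (simp add: L2_inner_self_norm)
      then show False using f(2) n by simp
    qed
    have "Im (form_E V f f / (L2_norm f)\<^sup>2) \<noteq> c"
      using f(2) n by (simp add: field_simps flip: of_real_power)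
    then show ?thesis using form_range_normalise[OF f(1) n] by blast
  qed
  then show ?thesis using that by metis
qed

text \<open>A flat range would lie on a line. Shifting by 1 makes that line horizontal, while two
  points of the range have distinct imaginary parts.\<close>

lemma interior_form_range: "interior form_range \<noteq> {}"
proof
  assume "interior form_range = {}"
  then obtain a b where ab: "a \<noteq> 0" "form_range \<subseteq> {x. a \<bullet> x = b}"
    using empty_interior_subset_hyperplane[OF form_range_convex] by metis
  obtain p q where pq: "p \<in> form_range" "q \<in> form_range" "Im p \<noteq> Im q" by (rule form_range_Im_distinct)
  have "p + 1 \<in> form_range" using form_range_shift[OF pq(1), of 1] by simp
  then have "a \<bullet> (p + 1) = a \<bullet> p" using ab pq by blast
  then have "Re a = 0" by (simp add: inner_add_right inner_complex_def)
  moreover have "a \<bullet> p = a \<bullet> q" using ab pq by blast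
  ultimately have "Im a = 0" using pq(3) by (simp add: inner_complex_def)
  then show False using \<open>Re a = 0\<close> ab(1) by (simp add: complex_eq_iff)
qed

text \<open>The sector condition made homogeneous in f. Its slope is positive because slope 0 would
  put the whole range on the real axis.\<close>

lemma sectorial_bound:
  obtains T \<gamma> where "T > 0" "\<And>f. f \<in> form_dom V \<Longrightarrow> \<bar>Im (form_E V f f)\<bar> \<le> T * (Re (form_E V f f) - \<gamma> * (L2_norm f)\<^sup>2)"
proof -
  obtain \<gamma> \<theta> where th: "0 \<le> \<theta>" "\<theta> < pi / 2"
    and b: "\<And>f. f \<in> form_dom V \<Longrightarrow> L2_norm f = 1 \<Longrightarrow> \<bar>Im (form_E V f f)\<bar> \<le> tan \<theta> * (Re (form_E V f f) - \<gamma>)"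
    using sectorial unfolding sectorial_form_def by metis
  have fr: "\<bar>Im z\<bar> \<le> tan \<theta> * (Re z - \<gamma>)" if "z \<in> form_range" for z
    using that b by (auto elim!: form_range_E)
  have "tan \<theta> \<ge> 0" using th tan_gt_zero[of \<theta>] by (cases "\<theta> = 0") auto
  moreover have "tan \<theta> \<noteq> 0"
  proof
    assume "tan \<theta> = 0"
    then have "Im z = 0" if "z \<in> form_range" for z using fr[OF that] by simp
    then show False using form_range_Im_distinct by metis
  qed
  ultimately have T: "tan \<theta> > 0" by simp
  show thesis
  proof (rule that[OF T, of \<gamma>])
    fix f assume f: "f \<in> form_dom V"
    show "\<bar>Im (form_E V f f)\<bar> \<le> tan \<theta> * (Re (form_E V f f) - \<gamma> * (L2_norm f)\<^sup>2)"
    proof (cases "L2_norm f = 0")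
      case True
      then have "form_E V f f = 0" using form_E_zero[OF f f] by (simp add: L2_inner_self_norm)
      then show ?thesis using True by simp
    next
      case False
      define N where "N = (L2_norm f)\<^sup>2"
      have N: "N > 0" using False by (simp add: N_def)
      have "\<bar>Im (form_E V f f / N)\<bar> \<le> tan \<theta> * (Re (form_E V f f / N) - \<gamma>)"
        using fr[OF form_range_normalise[OF f False]] by (simp add: N_def)
      then have "\<bar>Im (form_E V f f)\<bar> / N \<le> tan \<theta> * (Re (form_E V f f) / N - \<gamma>)" using N by simp
      also have "... = tan \<theta> * (Re (form_E V f f) - \<gamma> * N) / N" using N by (simp add: field_simps)
      finally show ?thesis using N unfolding N_def[symmetric] by (simp only: divide_le_cancel)
    qed
  qed
qed

lemma op_dom_form_dom: "f \<in> op_dom V \<Longrightarrow> f \<in> form_dom V" by (simp add: op_dom_def)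

text \<open>The values of \<open>op_H\<close> are chosen, but pairing them with form vectors is
  fixed by the defining identity, and f itself is one.\<close>

lemma Num_eq: "Num V = {form_E V f f |f. f \<in> op_dom V \<and> Re (L2_inner f f) = 1}"
proof -
  have E: "L2_inner (op_H V f) f = form_E V f f" if f: "f \<in> op_dom V" for f
  proof -
    have "\<exists>h. L2 h \<and> (\<forall>g\<in>form_dom V. form_E V f g = L2_inner h g)" using f by (simp add: op_dom_def)
    from someI_ex[OF this] have "\<forall>g\<in>form_dom V. form_E V f g = L2_inner (op_H V f) g" unfolding op_H_def by (rule conjunct2)
    then show ?thesis using op_dom_form_dom[OF f] by simp
  qed
  have N: "L2_norm f = 1 \<longleftrightarrow> Re (L2_inner f f) = 1" for f :: "'a \<Rightarrow> complex"
    using L2_norm_nonneg[of f] by (simp add: L2_inner_self_norm power2_eq_1_iff)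
  show ?thesis
  proof (rule set_eqI, rule iffI)
    fix z assume "z \<in> Num V"
    then obtain f where "f \<in> op_dom V" "L2_norm f = 1" "z = L2_inner (op_H V f) f" unfolding Num_def by blast
    then show "z \<in> {form_E V f f |f. f \<in> op_dom V \<and> Re (L2_inner f f) = 1}" using E[of f] N[of f] by auto
  next
    fix z assume "z \<in> {form_E V f f |f. f \<in> op_dom V \<and> Re (L2_inner f f) = 1}"
    then obtain f where "f \<in> op_dom V" "Re (L2_inner f f) = 1" "z = form_E V f f" by blast
    then show "z \<in> Num V" using E[of f] N[of f] unfolding Num_def by (intro CollectI exI[of _ f]) simp
  qed
qed

lemma Num_subset_form_range: "Num V \<subseteq> form_range"
  unfolding Num_eq form_range_def using op_dom_form_dom by blast

sublocale OD: cspace "op_dom V" cscl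
proof
  fix f g :: "'a \<Rightarrow> complex" and c assume "f \<in> op_dom V"
  then obtain h where f: "f \<in> form_dom V" and h: "L2 h" "\<And>y. y \<in> form_dom V \<Longrightarrow> form_E V f y = L2_inner h y"
    by (auto simp: op_dom_def)
  note L = form_domD(2)
  have "form_E V (cscl c f) y = L2_inner (cscl c h) y" if "y \<in> form_dom V" for y
    using FD.sesq_simps(3)[OF form_E_sesq f that] L2_inner_linear(3)[OF h(1) L[OF that] L[OF that]] h(2)[OF that] by simp
  then show "cscl c f \<in> op_dom V" using FD.D_scl[OF f] L2_scl[OF h(1)] by (auto simp: op_dom_def)
  assume "g \<in> op_dom V"
  then obtain k where g: "g \<in> form_dom V" and k: "L2 k" "\<And>y. y \<in> form_dom V \<Longrightarrow> form_E V g y = L2_inner k y"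
    by (auto simp: op_dom_def)
  have "form_E V (f + g) y = L2_inner (\<lambda>x. h x + k x) y" if "y \<in> form_dom V" for y
    using FD.sesq_simps(1)[OF form_E_sesq f g that] L2_inner_linear(1)[OF h(1) k(1) L[OF that]] h(2)[OF that] k(2)[OF that] by simp
  then show "f + g \<in> op_dom V" using FD.D_add[OF f g] L2_add[OF h(1) k(1)] unfolding op_dom_def by blast
qed (auto simp: fun_eq_iff)

lemma Num_convex: "convex (Num V)"
  unfolding Num_eq
proof (rule OD.Toeplitz_Hausdorff[of "form_E V" L2_inner])
  show "OD.sesq (form_E V)"
    using form_E_sesq op_dom_form_dom unfolding OD.sesq_def FD.sesq_def by blast
  show "OD.psd L2_inner"
    using L2_inner_psd_form op_dom_form_dom unfolding OD.psd_def FD.psd_def OD.sesq_def FD.sesq_def by blast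
qed (use form_E_zero op_dom_form_dom in blast)

text \<open>The operator domain is a core of the form. After a shift, sectoriality bounds the form
  by its hermitian part s, closedness is completeness for s, and \<open>operator_domain_core\<close>
  approximates g in the s-norm, along which the Rayleigh quotients converge.\<close>

lemma form_range_subset_closure_Num: "form_range \<subseteq> closure (Num V)"
proof
  fix z assume "z \<in> form_range"
  then obtain g where g: "g \<in> form_dom V" "L2_norm g = 1" "z = form_E V g g" by (rule form_range_E)
  obtain T \<gamma> where T: "T > 0" "\<And>f. f \<in> form_dom V \<Longrightarrow> \<bar>Im (form_E V f f)\<bar> \<le> T * (Re (form_E V f f) - \<gamma> * (L2_norm f)\<^sup>2)"
    using sectorial_bound by metis
  \<comment> \<open>Adding c = 1 - \<gamma> raises the lower bound of the real part to the square of
    the L2 norm.\<close>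
  define c where "c = 1 - \<gamma>"
  define a where "a f g = form_E V f g + of_real c * L2_inner f g" for f g
  define s where "s f g = (a f g + cnj (a g f)) / 2" for f g
  have a: "FD.sesq a" unfolding a_def[abs_def]
    by (rule FD.sesq_add_scaled[OF form_E_sesq FD.psdD(1)[OF L2_inner_psd_form]])
  have Rea: "Re (a f f) = Re (form_E V f f) + c * (L2_norm f)\<^sup>2" for f by (simp add: a_def L2_inner_self_norm)
  have sa: "Re (s f f) = Re (a f f)" for f by (simp add: s_def)
  have low: "(L2_norm f)\<^sup>2 \<le> Re (s f f)" "\<bar>Im (form_E V f f)\<bar> \<le> T * Re (s f f)" if f: "f \<in> form_dom V" for f
  proof -
    have "0 \<le> T * (Re (form_E V f f) - \<gamma> * (L2_norm f)\<^sup>2)" using T(2)[OF f] by linarith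
    then have "0 \<le> Re (form_E V f f) - \<gamma> * (L2_norm f)\<^sup>2" using T(1) by (simp add: zero_le_mult_iff)
    then show "(L2_norm f)\<^sup>2 \<le> Re (s f f)" unfolding sa Rea c_def by (simp add: algebra_simps)
    have "Re (form_E V f f) - \<gamma> * (L2_norm f)\<^sup>2 \<le> Re (s f f)" unfolding sa Rea c_def by (simp add: algebra_simps)
    then show "\<bar>Im (form_E V f f)\<bar> \<le> T * Re (s f f)" using T(2)[OF f] T(1) by (smt (verit) mult_left_mono)
  qed
  have s: "FD.psd s"
    unfolding FD.psd_def
  proof (intro conjI ballI)
    show "FD.sesq s" using a unfolding FD.sesq_def s_def by (auto simp: algebra_simps add_divide_distrib)
    show "s y x = cnj (s x y)" for x y by (simp add: s_def add.commute)
    show "0 \<le> Re (s f f)" if "f \<in> form_dom V" for f using low(1)[OF that] zero_le_power2[of "L2_norm f"] by linarith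
  qed
  define M where "M = 2 * (1 + T)"
  have M: "cmod (a x y) \<le> M * FD.nrm s x * FD.nrm s y" if "x \<in> form_dom V" "y \<in> form_dom V" for x y
    unfolding M_def
  proof (rule FD.sesq_bounded[OF a s _ _ that])
    fix f assume f: "f \<in> form_dom V"
    have "cmod (a f f) \<le> \<bar>Re (a f f)\<bar> + \<bar>Im (a f f)\<bar>" by (rule cmod_le)
    also have "Im (a f f) = Im (form_E V f f)" by (simp add: a_def L2_inner_self_norm)
    finally show "cmod (a f f) \<le> (1 + T) * Re (s f f)"
      using low[OF f] sa[of f] zero_le_power2[of "L2_norm f"] by (simp add: algebra_simps)
  qed (use T in simp)
  have nL: "FD.nrm s f \<ge> L2_norm f" if "f \<in> form_dom V" for f
    unfolding FD.nrm_def using low(1)[OF that] by (rule real_le_rsqrt)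
  have compl: "FD.complete_for s"
    unfolding FD.complete_for_def
  proof (intro allI impI, elim conjE)
    fix X :: "nat \<Rightarrow> 'a \<Rightarrow> complex"
    assume X: "\<forall>n. X n \<in> form_dom V" and C: "\<forall>e>0. \<exists>N. \<forall>m\<ge>N. \<forall>n\<ge>N. FD.nrm s (X m - X n) < e"
    then have X: "X n \<in> form_dom V" for n by blast
    have XL: "X n \<in> Collect L2" for n using form_domD(2)[OF X] by simp
    have d: "X m - X n \<in> form_dom V" for m n using FD.D_diff X by blast
    have "\<forall>e>0. \<exists>N. \<forall>m\<ge>N. \<forall>n\<ge>N. L2.nrm L2_inner (X m - X n) < e"
      using C nL[OF d] unfolding L2_norm_eq_nrm[symmetric] by (meson order_le_less_trans)
    then obtain f where f: "L2 f" "(\<lambda>n. L2_norm (X n - f)) \<longlonglongrightarrow> 0"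
      using L2_complete XL unfolding L2.complete_for_def L2_norm_eq_nrm by (metis mem_Collect_eq)
    \<comment> \<open>\<open>closed_form\<close> expresses Cauchy sequences through the form itself,
      so smallness in s has to be converted; |c| appears because the shift may have either
      sign.\<close>
    have E_le: "cmod (form_E V h h) \<le> (1 + \<bar>c\<bar> + T) * (FD.nrm s h)\<^sup>2" if h: "h \<in> form_dom V" for h
    proof -
      have "cmod (form_E V h h) \<le> \<bar>Re (form_E V h h)\<bar> + \<bar>Im (form_E V h h)\<bar>" by (rule cmod_le)
      moreover have "\<bar>Re (form_E V h h)\<bar> \<le> Re (s h h) + \<bar>c\<bar> * (L2_norm h)\<^sup>2"
      proof -
        have "Re (form_E V h h) = Re (s h h) - c * (L2_norm h)\<^sup>2" unfolding sa Rea by simp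
        moreover have "\<bar>c * (L2_norm h)\<^sup>2\<bar> = \<bar>c\<bar> * (L2_norm h)\<^sup>2" by (simp add: abs_mult)
        ultimately show ?thesis using FD.psdD(3)[OF s h] by linarith
      qed
      moreover have "\<bar>c\<bar> * (L2_norm h)\<^sup>2 \<le> \<bar>c\<bar> * Re (s h h)" using low(1)[OF h] by (intro mult_left_mono) auto
      ultimately show ?thesis using low(2)[OF h] by (simp add: FD.nrm_sq[OF s h] algebra_simps)
    qed
    have "\<forall>e>0. \<exists>N. \<forall>n\<ge>N. \<forall>m\<ge>N. cmod (form_E V (\<lambda>x. X n x - X m x) (\<lambda>x. X n x - X m x)) < e"
    proof (intro allI impI)
      fix e :: real assume e: "e > 0"
      define K where "K = 1 + \<bar>c\<bar> + T"
      have K: "K > 0" using T by (simp add: K_def)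
      obtain N where N: "\<And>m n. m \<ge> N \<Longrightarrow> n \<ge> N \<Longrightarrow> FD.nrm s (X m - X n) < sqrt (e / K)"
        using C e K by (metis divide_pos_pos real_sqrt_gt_zero)
      have "cmod (form_E V (X n - X m) (X n - X m)) < e" if "n \<ge> N" "m \<ge> N" for m n
      proof -
        have "(FD.nrm s (X n - X m))\<^sup>2 < (sqrt (e / K))\<^sup>2"
          using N[OF that] FD.nrm_nonneg[OF s d] by (intro power_strict_mono) auto
        then have "K * (FD.nrm s (X n - X m))\<^sup>2 < e" using e K by (simp add: field_simps)
        then show ?thesis using E_le[OF d, of n m] by (simp add: K_def)
      qed
      then show "\<exists>N. \<forall>n\<ge>N. \<forall>m\<ge>N. cmod (form_E V (\<lambda>x. X n x - X m x) (\<lambda>x. X n x - X m x)) < e"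
        unfolding fun_diff_def by blast
    qed
    then have lim: "f \<in> form_dom V \<and> (\<lambda>n. form_E V (\<lambda>x. X n x - f x) (\<lambda>x. X n x - f x)) \<longlonglongrightarrow> 0"
      using closed X f unfolding closed_form_def fun_diff_def by blast
    then have "(\<lambda>n. Re (form_E V (X n - f) (X n - f)) + c * (L2_norm (X n - f))\<^sup>2) \<longlonglongrightarrow> Re 0 + c * 0\<^sup>2"
      unfolding fun_diff_def by (intro tendsto_intros) (use f(2) in \<open>auto simp: fun_diff_def\<close>)
    then have "(\<lambda>n. sqrt (Re (s (X n - f) (X n - f)))) \<longlonglongrightarrow> sqrt 0"
      unfolding sa Rea by (intro tendsto_real_sqrt) simp
    then show "\<exists>x\<in>form_dom V. (\<lambda>n. FD.nrm s (X n - x)) \<longlonglongrightarrow> 0" using lim by (auto simp: FD.nrm_def)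
  qed
  obtain X where X: "\<And>n. X n \<in> form_dom V" "\<And>n. \<exists>h\<in>form_dom V. \<forall>y\<in>form_dom V. a (X n) y = L2_inner h y"
    "(\<lambda>n. FD.nrm s (X n - g)) \<longlonglongrightarrow> 0"
  proof (rule FD.operator_domain_core[OF a s L2_inner_psd_form _ M _ compl _ _ g(1)])
    show "Re (a x x) = Re (s x x)" for x by (simp add: sa)
    show "0 \<le> M" using T by (simp add: M_def)
    show "Re (L2_inner x x) \<le> Re (s x x)" if "x \<in> form_dom V" for x using low(1)[OF that] by (simp add: L2_inner_self_norm)
    show "Re (s x x) = 0" if "x \<in> form_dom V" "Re (L2_inner x x) = 0" for x
      using form_E_zero[OF that(1,1,2)] that(2) by (simp add: sa a_def)
  qed auto
  \<comment> \<open>Moving the shift to the other side turns the equation for a into one for E,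
    represented by h - c \<open>X n\<close>.\<close>
  have XO: "X n \<in> op_dom V" for n
  proof -
    obtain h where h: "h \<in> form_dom V" "\<And>y. y \<in> form_dom V \<Longrightarrow> a (X n) y = L2_inner h y" using X(2)[of n] by blast
    have "form_E V (X n) y = L2_inner (\<lambda>x. h x + (- of_real c) * X n x) y" if y: "y \<in> form_dom V" for y
    proof -
      note L = form_domD(2)[OF X(1)[of n]] form_domD(2)[OF y]
      show ?thesis
        unfolding L2_inner_linear(1)[OF form_domD(2)[OF h(1)] L2_scl[OF L(1)] L(2)] L2_inner_linear(3)[OF L L(2)]
        using h(2)[OF y] by (simp add: a_def eq_diff_eq)
    qed
    moreover have "L2 (\<lambda>x. h x + (- of_real c) * X n x)" by (intro L2_add L2_scl form_domD(2) h(1) X(1))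
    ultimately show ?thesis using X(1) unfolding op_dom_def by blast
  qed
  have bL: "cmod (L2_inner x y) \<le> 1 * FD.nrm s x * FD.nrm s y" if "x \<in> form_dom V" "y \<in> form_dom V" for x y
    using L2_Cauchy_Schwarz[OF form_domD(2) form_domD(2), OF that] mult_mono[OF nL[OF that(1)] nL[OF that(2)]]
      FD.nrm_nonneg[OF s that(1)] L2_norm_nonneg[of y] by simp
  have la: "(\<lambda>n. a (X n) (X n)) \<longlonglongrightarrow> a g g" by (rule FD.bounded_sesq_tendsto(2)[OF a s M X(1) g(1) X(3)])
  have lL: "(\<lambda>n. L2_inner (X n) (X n)) \<longlonglongrightarrow> L2_inner g g"
    by (rule FD.bounded_sesq_tendsto(2)[OF FD.psdD(1)[OF L2_inner_psd_form] s bL X(1) g(1) X(3)])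
  have g1: "L2_inner g g = 1" using g(2) by (simp add: L2_inner_self_norm)
  have "(\<lambda>n. (a (X n) (X n) - of_real c * L2_inner (X n) (X n)) / L2_inner (X n) (X n))
     \<longlonglongrightarrow> (a g g - of_real c * L2_inner g g) / L2_inner g g"
    by (intro tendsto_intros la lL) (simp add: g1)
  then have lim: "(\<lambda>n. form_E V (X n) (X n) / L2_inner (X n) (X n)) \<longlonglongrightarrow> z"
    by (simp add: a_def g1 g(3))
  \<comment> \<open>The squared norms tend to 1, so the approximants can eventually be
    normalised.\<close>
  have "eventually (\<lambda>n. L2_inner (X n) (X n) \<noteq> 0) sequentially"
    using tendsto_imp_eventually_ne[OF lL] g1 by simp
  then have "eventually (\<lambda>n. form_E V (X n) (X n) / L2_inner (X n) (X n) \<in> closure (Num V)) sequentially"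
  proof eventually_elim
    fix n assume ne: "L2_inner (X n) (X n) \<noteq> 0"
    then have n0: "L2_norm (X n) \<noteq> 0" by (simp add: L2_inner_self_norm)
    let ?c = "complex_of_real (1 / L2_norm (X n))"
    have "form_E V (cscl ?c (X n)) (cscl ?c (X n)) = form_E V (X n) (X n) / L2_inner (X n) (X n)"
      using FD.sesq_simps(3)[OF form_E_sesq X(1)[of n] FD.D_scl[OF X(1)[of n]], of ?c ?c] FD.sesq_simps(4)[OF form_E_sesq X(1)[of n] X(1)[of n], of ?c]
      by (simp add: power2_eq_square L2_inner_self_norm)
    moreover have "L2_norm (cscl ?c (X n)) = 1"
      unfolding L2_norm_scl[OF form_domD(2)[OF X(1)]] using n0 L2_norm_nonneg[of "X n"] by (simp add: norm_divide)
    then have "Re (L2_inner (cscl ?c (X n)) (cscl ?c (X n))) = 1" unfolding L2_inner_self_norm by simp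
    ultimately have "form_E V (X n) (X n) / L2_inner (X n) (X n) \<in> Num V"
      unfolding Num_eq using OD.D_scl[OF XO, of ?c n] by (metis (mono_tags, lifting) mem_Collect_eq)
    then show "form_E V (X n) (X n) / L2_inner (X n) (X n) \<in> closure (Num V)" using closure_subset by blast
  qed
  then show "z \<in> closure (Num V)" using Lim_in_closed_set[OF closed_closure _ sequentially_bot lim] by blast
qed

lemma Num_closure_facts:
  shows "convex (closure (Num V))" "interior (closure (Num V)) \<noteq> {}" "interior (closure (Num V)) = interior (Num V)"
  using Num_convex interior_form_range interior_mono[OF form_range_subset_closure_Num]
  by (auto intro: convex_closure simp: convex_interior_closure)

text \<open>The curvature lemmas need a closed set. A convex set and its closure have the same
  interior here, hence frontier points of the one are frontier points of the other.\<close>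

lemma frontier_closure_Num: "lam \<in> frontier (Num V) \<Longrightarrow> lam \<in> frontier (closure (Num V))"
  using Num_closure_facts(3) by (simp add: frontier_def)

text \<open>The closure contains the horizontal segment from \<open>lam\<close> - s to
  \<open>lam\<close> + 1, so t \<mapsto> \<open>lam\<close> + t is an admissible curve with velocity
  1 and error constant 0.\<close>

lemma gamma_u_finite_if_left:
  assumes lam: "lam \<in> frontier (closure (Num V))" "lam \<in> form_range"
    and s: "s > 0" "lam - complex_of_real s \<in> closure (Num V)"
  shows "gamma_u (closure (Num V)) lam < \<infinity>"
proof (rule curvature_finite[OF Num_closure_facts(1) closed_closure Num_closure_facts(2) lam(1), of 1 "min s 1" "\<lambda>t. lam + t" 0])
  fix t :: real assume t: "\<bar>t\<bar> < min s 1"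
  have r: "lam + 1 \<in> closure (Num V)"
    using form_range_shift[OF lam(2), of 1] form_range_subset_closure_Num by auto
  \<comment> \<open>The weight for which the convex combination of the two ends is
    \<open>lam\<close> + t.\<close>
  define v where "v = (1 - t) / (1 + s)"
  have v: "v * (1 + s) = 1 - t" using s by (simp add: v_def)
  have "v *\<^sub>R (lam - complex_of_real s) + (1 - v) *\<^sub>R (lam + 1) \<in> closure (Num V)"
    by (rule convexD[OF Num_closure_facts(1) s(2) r]) (use s t in \<open>auto simp: v_def field_simps\<close>)
  also have "v *\<^sub>R (lam - complex_of_real s) + (1 - v) *\<^sub>R (lam + 1) = lam + 1 - complex_of_real (v * (1 + s))"
    by (simp add: scaleR_conv_of_real algebra_simps)
  finally show "lam + complex_of_real t \<in> closure (Num V)" unfolding v by simp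
qed (use s in auto)

text \<open>First order variation: a nonzero linear term of \<open>t \<mapsto> E(u + t h)\<close> would produce a curve as in
  \<open>curvature_finite\<close>.\<close>
lemma eigenfunction_if_infinite_curvature:
  assumes lam: "lam \<in> frontier (closure (Num V))" and g: "\<not> gamma_u (closure (Num V)) lam < \<infinity>"
    and u: "u \<in> form_dom V" "L2_norm u = 1" "form_E V u u = lam" and h: "h \<in> form_dom V"
  shows "form_E V u h = lam * L2_inner u h"
proof -
  have zero: "form_E V u h - lam * L2_inner u h + (form_E V h u - lam * L2_inner h u) = 0" if h: "h \<in> form_dom V" for h
  proof (rule ccontr)
    define c where "c = form_E V u h - lam * L2_inner u h + (form_E V h u - lam * L2_inner h u)"
    define e where "e = form_E V h h - lam * L2_inner h h"
    assume "form_E V u h - lam * L2_inner u h + (form_E V h u - lam * L2_inner h u) \<noteq> 0"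
    then have c: "c \<noteq> 0" by (simp add: c_def)
    define w where "w t = u + cscl (complex_of_real t) h" for t
    have w: "w t \<in> form_dom V" for t unfolding w_def using FD.D_add[OF u(1) FD.D_scl[OF h]] .
    define k where "k = 2 * Re (L2_inner u h)"
    define m where "m = Re (L2_inner h h)"
    define N where "N t = (L2_norm (w t))\<^sup>2" for t
    have u1: "L2_inner u u = 1" using u(2) by (simp add: L2_inner_self_norm)
    have Lww: "L2_inner (w t) (w t) = 1 + t * (L2_inner u h + L2_inner h u) + t\<^sup>2 * L2_inner h h" for t
      unfolding w_def FD.sesq_perturb[OF FD.psdD(1)[OF L2_inner_psd_form] u(1) h] by (simp add: u1 power2_eq_square algebra_simps)
    have Nt: "N t = 1 + t * k + t\<^sup>2 * m" for t
    proof -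
      have "N t = Re (L2_inner (w t) (w t))" by (simp add: N_def L2_inner_self_norm)
      then show ?thesis unfolding Lww using L2_inner_commute[OF form_domD(2)[OF u(1)] form_domD(2)[OF h]]
        by (simp add: k_def m_def power2_eq_square)
    qed
    have Ew: "form_E V (w t) (w t) - lam * L2_inner (w t) (w t) = t * c + t\<^sup>2 * e" for t
      unfolding Lww unfolding w_def FD.sesq_perturb[OF form_E_sesq u(1) h] u(3)
      by (simp add: c_def e_def power2_eq_square algebra_simps)
    \<comment> \<open>R bounds the drift of the squared norm: |N t - 1| <= |t| R, so N t >= 1/2 for
      |t| < 1 / (2 R).\<close>
    define R where "R = \<bar>k\<bar> + \<bar>m\<bar> + 1"
    have R: "R \<ge> 1" by (simp add: R_def)
    define t0 where "t0 = 1 / (2 * R)"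
    have t0: "t0 > 0" "t0 * (2 * R) = 1" "t0 \<le> 1" using R by (auto simp: t0_def divide_le_eq)
    have N_low: "N t \<ge> 1 / 2" and N_dev: "\<bar>N t - 1\<bar> \<le> \<bar>t\<bar> * R" if t: "\<bar>t\<bar> < t0" for t
    proof -
      have "\<bar>N t - 1\<bar> \<le> \<bar>t\<bar> * \<bar>k\<bar> + \<bar>t\<bar> * (\<bar>t\<bar> * \<bar>m\<bar>)"
        unfolding Nt using abs_triangle_ineq[of "t * k" "t\<^sup>2 * m"] by (simp add: abs_mult power2_eq_square mult.assoc)
      also have "... \<le> \<bar>t\<bar> * \<bar>k\<bar> + \<bar>t\<bar> * (1 * \<bar>m\<bar>)"
        using t t0 by (intro add_left_mono mult_left_mono mult_right_mono) auto
      also have "... \<le> \<bar>t\<bar> * R" by (simp add: R_def algebra_simps)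
      finally show d: "\<bar>N t - 1\<bar> \<le> \<bar>t\<bar> * R" .
      have "\<bar>t\<bar> * R \<le> t0 * R" using t R by (intro mult_right_mono) auto
      then show "N t \<ge> 1 / 2" using d t0(2) by (simp add: abs_le_iff)
    qed
    \<comment> \<open>The Rayleigh quotient of u + t h. It stays in the range and has velocity c at
      t = 0.\<close>
    define p where "p t = form_E V (w t) (w t) / N t" for t
    have pin: "p t \<in> closure (Num V)" if "\<bar>t\<bar> < t0" for t
    proof -
      have "L2_norm (w t) \<noteq> 0" using N_low[OF that] by (auto simp: N_def)
      then show ?thesis using form_range_normalise[OF w, of t] form_range_subset_closure_Num by (auto simp: p_def N_def)
    qed
    have pd: "cmod (p t - lam - t * c) \<le> (2 * (cmod e + cmod c * R)) * t\<^sup>2" if t: "\<bar>t\<bar> < t0" for t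
    proof -
      have Np: "N t > 0" using N_low[OF t] by simp
      have L: "L2_inner (w t) (w t) = N t" by (simp add: L2_inner_self_norm N_def)
      have "N t * (p t - lam - t * c) = form_E V (w t) (w t) - lam * L2_inner (w t) (w t) - t * c * N t"
        using Np by (simp add: p_def L algebra_simps)
      also have "... = t\<^sup>2 * e - t * c * complex_of_real (N t - 1)" unfolding Ew by (simp add: algebra_simps)
      finally have "N t * cmod (p t - lam - t * c) = cmod (t\<^sup>2 * e - t * c * complex_of_real (N t - 1))"
        using Np by (metis abs_of_pos norm_mult norm_of_real)
      also have "... \<le> t\<^sup>2 * cmod e + \<bar>t\<bar> * cmod c * \<bar>N t - 1\<bar>"
        using norm_triangle_ineq4[of "t\<^sup>2 * e" "t * c * complex_of_real (N t - 1)"]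
        unfolding norm_mult norm_of_real by (simp add: norm_mult norm_power)
      also have "... \<le> t\<^sup>2 * cmod e + \<bar>t\<bar> * cmod c * (\<bar>t\<bar> * R)"
        using N_dev[OF t] by (intro add_left_mono mult_left_mono) auto
      also have "... = (cmod e + cmod c * R) * t\<^sup>2" by (simp add: power2_eq_square algebra_simps)
      finally have 1: "N t * cmod (p t - lam - t * c) \<le> (cmod e + cmod c * R) * t\<^sup>2" .
      have "1 / 2 * cmod (p t - lam - t * c) \<le> N t * cmod (p t - lam - t * c)"
        using N_low[OF t] by (rule mult_right_mono) simp
      then have "cmod (p t - lam - t * c) \<le> 2 * ((cmod e + cmod c * R) * t\<^sup>2)" using 1 by linarith
      then show ?thesis by (simp only: mult.assoc)
    qed
    have "gamma_u (closure (Num V)) lam < \<infinity>"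
      by (rule curvature_finite[OF Num_closure_facts(1) closed_closure Num_closure_facts(2) lam c t0(1) pin pd])
    then show False using g by simp
  qed
  \<comment> \<open>\<open>zero\<close> gives only the sum of the terms for (u, h) and (h, u);
    replacing h by i h gives their difference.\<close>
  have ih: "cscl \<i> h \<in> form_dom V" using FD.D_scl[OF h] .
  note pL = FD.psdD(1)[OF L2_inner_psd_form]
  have "- \<i> * (form_E V u h - lam * L2_inner u h) + \<i> * (form_E V h u - lam * L2_inner h u) = 0"
    using zero[OF ih] u(1) h
      FD.sesq_simps(3)[OF form_E_sesq h u(1), of \<i>] FD.sesq_simps(4)[OF form_E_sesq u(1) h, of \<i>]
      FD.sesq_simps(3)[OF pL h u(1), of \<i>] FD.sesq_simps(4)[OF pL u(1) h, of \<i>]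
    by (simp add: algebra_simps)
  then have "\<i> * (form_E V h u - lam * L2_inner h u) = \<i> * (form_E V u h - lam * L2_inner u h)"
    by (simp add: algebra_simps)
  then have "form_E V h u - lam * L2_inner h u = form_E V u h - lam * L2_inner u h" by simp
  then have "2 * (form_E V u h - lam * L2_inner u h) = 0" using zero[OF h] by simp
  then show ?thesis by simp
qed

end

section \<open>A strong maximum principle for locally integrable potentials\<close>

text \<open>A discrete Picone identity: with a = v + eps and p = phi, and primes at the shifted
  point, the left side is the product of the differences of v and of phi^2 / (v + eps).\<close>

lemma picone_identity:
  fixes a a' p p' :: real
  assumes "a > 0" "a' > 0"
  shows "(a' - a) * (p'\<^sup>2 / a' - p\<^sup>2 / a) = (p' - p)\<^sup>2 - (p * sqrt (a' / a) - p' * sqrt (a / a'))\<^sup>2"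
proof -
  have 1: "sqrt (a' / a) * sqrt (a / a') = 1" using assms by (simp flip: real_sqrt_mult)
  have 2: "(sqrt (a' / a))\<^sup>2 = a' / a" "(sqrt (a / a'))\<^sup>2 = a / a'" using assms by simp_all
  have "(p * sqrt (a' / a) - p' * sqrt (a / a'))\<^sup>2
    = p\<^sup>2 * (sqrt (a' / a))\<^sup>2 + p'\<^sup>2 * (sqrt (a / a'))\<^sup>2 - 2 * p * p' * (sqrt (a' / a) * sqrt (a / a'))"
    by (simp add: power2_eq_square algebra_simps)
  then have "(p * sqrt (a' / a) - p' * sqrt (a / a'))\<^sup>2 = p\<^sup>2 * (a' / a) + p'\<^sup>2 * (a / a') - 2 * p * p'"
    unfolding 1 2 by simp
  moreover have "(a' - a) * (p'\<^sup>2 / a' - p\<^sup>2 / a) = p'\<^sup>2 + p\<^sup>2 - p\<^sup>2 * (a' / a) - p'\<^sup>2 * (a / a')"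
    using assms by (simp add: field_simps)
  ultimately show ?thesis by (simp add: power2_diff)
qed

text \<open>Where the cutoff is 1 the Picone square is that of exp z - exp (-z), with z half the
  logarithmic difference, and |z| <= |exp z - exp (-z)|.\<close>

lemma ln_diff_sq_le:
  fixes a a' :: real
  assumes "a > 0" "a' > 0"
  shows "(ln a' - ln a)\<^sup>2 \<le> 4 * (sqrt (a' / a) - sqrt (a / a'))\<^sup>2"
proof -
  define z where "z = (ln a' - ln a) / 2"
  have e: "sqrt (a' / a) = exp z" "sqrt (a / a') = exp (- z)"
  proof -
    have "(exp z)\<^sup>2 = exp (ln a' - ln a)" by (simp add: z_def flip: exp_double)
    also have "... = a' / a" using assms by (simp add: exp_diff)
    finally show 1: "sqrt (a' / a) = exp z" by (metis exp_ge_zero real_sqrt_abs abs_of_nonneg)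
    have "sqrt (a / a') = 1 / sqrt (a' / a)" by (simp add: real_sqrt_divide)
    then show "sqrt (a / a') = exp (- z)" unfolding 1 by (simp add: exp_minus inverse_eq_divide)
  qed
  have "\<bar>z\<bar> \<le> \<bar>exp z - exp (- z)\<bar>"
  proof (cases "z \<ge> 0")
    case True
    then show ?thesis using exp_ge_add_one_self[of z] exp_le_one_iff[of "- z"] by linarith
  next
    case False
    then show ?thesis using exp_ge_add_one_self[of "- z"] exp_le_one_iff[of z] by linarith
  qed
  then have "z\<^sup>2 \<le> (exp z - exp (- z))\<^sup>2" by (simp add: abs_le_square_iff)
  then show ?thesis unfolding e by (simp add: z_def power_divide)
qed

lemma square_sum_le:
  fixes d :: "nat \<Rightarrow> real"
  shows "(\<Sum>i<n. d i)\<^sup>2 \<le> real n * (\<Sum>i<n. (d i)\<^sup>2)"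
  using Cauchy_Schwarz_ineq_sum[of "\<lambda>_. 1" d "{..<n}"] by simp

lemma L2_inner_of_real:
  "L2_inner (\<lambda>x. complex_of_real (f x)) (\<lambda>x. complex_of_real (g x)) = complex_of_real (LINT x|lebesgue. f x * g x)"
  unfolding L2_inner_def integral_complex_of_real[symmetric] by simp

lemma borel_measurable_of_complex_of_real:
  "(\<lambda>x. complex_of_real (f x)) \<in> borel_measurable M \<Longrightarrow> f \<in> borel_measurable M"
  using borel_measurable_continuous_on[OF continuous_on_Re[OF continuous_on_id], of "\<lambda>x. complex_of_real (f x)" M] by simp

lemma integrable_mult_real:
  assumes "L2 (\<lambda>x. complex_of_real (f x))" "L2 (\<lambda>x. complex_of_real (g x))"
  shows "integrable lebesgue (\<lambda>x. f x * g x)"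
  using integrable_Re[OF integrable_mult_L2[OF assms]] by simp

lemma sdiff_of_real: "sdiff t b (\<lambda>x. complex_of_real (f x)) = (\<lambda>x. complex_of_real (f (x + t *\<^sub>R b) - f x))"
  by (simp add: sdiff_def)

definition cutoff :: "real \<Rightarrow> 'a::euclidean_space \<Rightarrow> real" where
  "cutoff R x = max 0 (min 1 (R + 1 - norm x))"

lemma cutoff_range: "0 \<le> cutoff R x" "cutoff R x \<le> 1" and cutoff_one: "norm x \<le> R \<Longrightarrow> cutoff R x = 1"
  and cutoff_zero: "x \<notin> cball 0 (R + 1) \<Longrightarrow> cutoff R x = 0"
  by (auto simp: cutoff_def)

lemma cutoff_lipschitz: "\<bar>cutoff R x - cutoff R y\<bar> \<le> 1 * dist x y"
  using norm_triangle_ineq3[of x y] by (auto simp: cutoff_def dist_norm max_def min_def)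

section \<open>Logarithmic energy and the spreading of zeros\<close>

context schrodinger_form begin

lemma cutoff_form_dom: "(\<lambda>x. complex_of_real (cutoff R x)) \<in> form_dom V"
  by (rule form_dom_lipschitz[OF cutoff_lipschitz, of "cball 0 (R + 1)"]) (auto intro: cutoff_zero)

text \<open>Makes phi^2 / (v + eps) an admissible test function: the denominator stays above eps, so
  the quotient depends on phi and v in a Lipschitz way.\<close>

lemma quotient_form_dom:
  assumes u: "(\<lambda>x. complex_of_real (v x)) \<in> form_dom V" and v: "\<And>x. 0 \<le> v x" and e: "\<epsilon> > 0"
  shows "(\<lambda>x. complex_of_real ((cutoff R x)\<^sup>2 / (v x + \<epsilon>))) \<in> form_dom V" (is "?F \<in> _")
proof -
  let ?p = "\<lambda>x::'a. complex_of_real (cutoff R x)"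
  note p = cutoff_form_dom[of R]
  have vm: "v \<in> borel_measurable lebesgue" by (rule borel_measurable_of_complex_of_real[OF form_domD(4)[OF u]])
  have pm: "(cutoff R :: 'a \<Rightarrow> real) \<in> borel_measurable lebesgue" by (rule borel_measurable_of_complex_of_real[OF form_domD(4)[OF p]])
  have m: "?F \<in> borel_measurable lebesgue"
    by (intro borel_measurable_complex_of_real borel_measurable_divide borel_measurable_power borel_measurable_add pm vm borel_measurable_const)
  have le: "cmod (?F x) \<le> 1 / \<epsilon> * cmod (?p x)" for x
  proof -
    have "(cutoff R x)\<^sup>2 \<le> cutoff R x" using cutoff_range[of R x] by (simp add: power2_eq_square mult_left_le)
    then have "(cutoff R x)\<^sup>2 / (v x + \<epsilon>) \<le> cutoff R x / \<epsilon>"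
      using v[of x] e cutoff_range[of R x] by (intro frac_le) auto
    moreover have "0 \<le> (cutoff R x)\<^sup>2 / (v x + \<epsilon>)" using v[of x] e by simp
    ultimately show ?thesis unfolding norm_of_real by (subst abs_of_nonneg) (use cutoff_range[of R x] in simp_all)
  qed
  have L: "L2 ?F" by (rule L2_bound[OF form_domD(2)[OF p] m le])
  \<comment> \<open>Covers the coefficient 2 / eps of the difference of the cutoff and 1 / eps^2 of
    that of v.\<close>
  define A where "A = 2 / \<epsilon> + 1 / \<epsilon>\<^sup>2"
  have A: "A \<ge> 0" "2 / \<epsilon> \<le> A" "1 / \<epsilon>\<^sup>2 \<le> A" using e by (auto simp: A_def)
  have "?F \<in> H1"
  proof (rule H1_I_dominated[OF L form_domD(1)[OF p] form_domD(1)[OF u] L2_zero A(1)])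
    fix b :: 'a and t :: real and x
    define p0 p1 v0 v1 where "p0 = cutoff R x" and "p1 = cutoff R (x + t *\<^sub>R b)" and "v0 = v x + \<epsilon>" and "v1 = v (x + t *\<^sub>R b) + \<epsilon>"
    have vv: "v0 \<ge> \<epsilon>" "v1 \<ge> \<epsilon>" using v by (auto simp: v0_def v1_def)
    have pp: "0 \<le> p0" "p0 \<le> 1" "0 \<le> p1" "p1 \<le> 1" using cutoff_range by (auto simp: p0_def p1_def)
    have "p1\<^sup>2 / v1 - p0\<^sup>2 / v0 = (p1 - p0) * ((p1 + p0) / v1) - p0\<^sup>2 * ((v1 - v0) / (v0 * v1))"
      using vv e by (simp add: field_simps power2_eq_square)
    then have "\<bar>p1\<^sup>2 / v1 - p0\<^sup>2 / v0\<bar> \<le> \<bar>p1 - p0\<bar> * ((p1 + p0) / v1) + p0\<^sup>2 * (\<bar>v1 - v0\<bar> / (v0 * v1))"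
      using abs_triangle_ineq4[of "(p1 - p0) * ((p1 + p0) / v1)" "p0\<^sup>2 * ((v1 - v0) / (v0 * v1))"] vv e pp
      by (simp add: abs_mult)
    also have "... \<le> \<bar>p1 - p0\<bar> * (2 / \<epsilon>) + 1 * (\<bar>v1 - v0\<bar> / (\<epsilon> * \<epsilon>))"
    proof (intro add_mono mult_left_mono mult_mono)
      show "(p1 + p0) / v1 \<le> 2 / \<epsilon>" using vv e pp by (intro frac_le) auto
      show "\<bar>v1 - v0\<bar> / (v0 * v1) \<le> \<bar>v1 - v0\<bar> / (\<epsilon> * \<epsilon>)" using vv e by (intro divide_left_mono mult_mono mult_pos_pos) auto
      show "p0\<^sup>2 \<le> 1" using pp by (simp add: power_le_one)
    qed (use vv e in auto)
    also have "... = 2 / \<epsilon> * \<bar>p1 - p0\<bar> + 1 / \<epsilon>\<^sup>2 * \<bar>v1 - v0\<bar>" by (simp add: power2_eq_square)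
    also have "... \<le> A * \<bar>p1 - p0\<bar> + A * \<bar>v1 - v0\<bar>" using A by (intro add_mono mult_right_mono) auto
    finally have "\<bar>p1\<^sup>2 / v1 - p0\<^sup>2 / v0\<bar> \<le> A * \<bar>p1 - p0\<bar> + A * \<bar>v1 - v0\<bar>" .
    then show "cmod (sdiff t b ?F x) \<le> A * cmod (sdiff t b ?p x) + A * cmod (sdiff t b (\<lambda>x. complex_of_real (v x)) x) + t * cmod 0"
      unfolding sdiff_of_real norm_of_real by (simp add: p0_def p1_def v0_def v1_def)
  qed
  then show ?thesis
  proof (rule form_dom_I_dominated)
    show "integrable lebesgue (\<lambda>x. (1 / \<epsilon>)\<^sup>2 *\<^sub>R (V x * (cmod (?p x))\<^sup>2))"
      by (rule integrable_scaleR_right[OF form_domD(3)[OF p]])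
    fix x
    have "norm ((1 / \<epsilon>)\<^sup>2 *\<^sub>R (V x * (cmod (?p x))\<^sup>2)) = cmod (V x) * (1 / \<epsilon> * cmod (?p x))\<^sup>2"
      by (simp add: norm_mult norm_power power_mult_distrib power_divide)
    then show "cmod (V x) * (cmod (?F x))\<^sup>2 \<le> norm ((1 / \<epsilon>)\<^sup>2 *\<^sub>R (V x * (cmod (?p x))\<^sup>2))"
      using mult_left_mono[OF power_mono[OF le[of x] norm_ge_zero, of 2], of "cmod (V x)"] by (simp only: norm_ge_zero)
  qed
qed

text \<open>The logarithm of \<open>v + \<epsilon>\<close> has locally bounded energy, uniformly in \<open>\<epsilon>\<close>: test the equation
  with \<open>\<phi>\<^sup>2 / (v + \<epsilon>)\<close> and use Picone's identity for difference quotients.\<close>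
lemma log_energy_bound:
  assumes u: "(\<lambda>x. complex_of_real (v x)) \<in> form_dom V" and v: "\<And>x. 0 \<le> v x"
    and eq: "\<And>h. h \<in> form_dom V \<Longrightarrow> form_E V (\<lambda>x. complex_of_real (v x)) h = lam * L2_inner (\<lambda>x. complex_of_real (v x)) h"
  obtains C where "\<And>\<epsilon>. \<epsilon> > 0 \<Longrightarrow> \<exists>t0>0. \<forall>t b. 0 < t \<and> t < t0 \<and> b \<in> Basis \<longrightarrow>
     (\<exists>Q. integrable lebesgue Q \<and> (LINT x|lebesgue. Q x) \<le> C * t\<^sup>2 \<and> (\<forall>x. 0 \<le> Q x) \<and>
       (\<forall>x. norm x \<le> R \<and> norm (x + t *\<^sub>R b) \<le> R \<longrightarrow> (ln (v (x + t *\<^sub>R b) + \<epsilon>) - ln (v x + \<epsilon>))\<^sup>2 \<le> Q x))"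
proof -
  let ?u = "\<lambda>x. complex_of_real (v x)"
  let ?p = "\<lambda>x::'a. complex_of_real (cutoff R x)"
  note p = cutoff_form_dom[of R]
  \<comment> \<open>Bounds the integral of |\<open>lam\<close> - V| v h uniformly in eps, because v
    h <= phi^2.\<close>
  define B where "B = (LINT x|lebesgue. (cmod lam * (cutoff R x)\<^sup>2 + cmod (V x) * (cutoff R x)\<^sup>2))"
  have iB: "integrable lebesgue (\<lambda>x. cmod lam * (cutoff R x)\<^sup>2 + cmod (V x) * (cutoff R x)\<^sup>2)"
  proof (intro Bochner_Integration.integrable_add integrable_mult_right)
    show "integrable lebesgue (\<lambda>x::'a. (cutoff R x)\<^sup>2)"
      using integrable_mult_real[OF form_domD(2)[OF p] form_domD(2)[OF p]] by (simp add: power2_eq_square)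
    show "integrable lebesgue (\<lambda>x. cmod (V x) * (cutoff R x)\<^sup>2)"
      using integrable_norm[OF form_domD(3)[OF p]] by (simp add: norm_mult norm_power)
  qed
  \<comment> \<open>The extra 1 makes the inequality strict, so that it holds for the quotients at
    small t. The threshold t0 depends on eps, the constant C does not.\<close>
  define C where "C = Re (grad_inner ?p ?p) + B + 1"
  show thesis
  proof (rule that[of "4 * C"])
    fix \<epsilon> :: real assume e: "\<epsilon> > 0"
    define h where "h x = (cutoff R x)\<^sup>2 / (v x + \<epsilon>)" for x
    let ?F = "\<lambda>x. complex_of_real (h x)"
    have F: "?F \<in> form_dom V" unfolding h_def by (rule quotient_form_dom[OF u v e])
    define G where "G x = lam * (complex_of_real (v x) * cnj (complex_of_real (h x))) - V x * complex_of_real (v x) * cnj (complex_of_real (h x))" for x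
    have "grad_inner ?u ?F = lam * L2_inner ?u ?F - potential_form V ?u ?F"
      using eq[OF F] by (simp add: form_E_eq eq_diff_eq)
    also have "... = (LINT x|lebesgue. G x)"
      unfolding L2_inner_def potential_form_def G_def
      using integrable_mult_L2[OF form_domD(2)[OF u] form_domD(2)[OF F]] form_dom_integrable[OF u F]
      by (subst Bochner_Integration.integral_diff) auto
    finally have "cmod (grad_inner ?u ?F) \<le> (LINT x|lebesgue. cmod (G x))"
      by (simp only: integral_norm_bound)
    also have "... \<le> B"
      unfolding B_def
    proof (rule integral_mono[OF _ iB])
      show "integrable lebesgue (\<lambda>x. cmod (G x))"
        unfolding G_def
        using integrable_mult_L2[OF form_domD(2)[OF u] form_domD(2)[OF F]] form_dom_integrable[OF u F]
        by (intro integrable_norm Bochner_Integration.integrable_diff integrable_mult_right)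
      fix x
      have vh: "0 \<le> v x * h x" "v x * h x \<le> (cutoff R x)\<^sup>2"
      proof -
        show "0 \<le> v x * h x" using v[of x] e by (simp add: h_def)
        have "v x / (v x + \<epsilon>) \<le> 1" using v[of x] e by simp
        from mult_left_mono[OF this, of "(cutoff R x)\<^sup>2"] show "v x * h x \<le> (cutoff R x)\<^sup>2" by (simp add: h_def mult.commute)
      qed
      have "G x = (lam - V x) * complex_of_real (v x * h x)" by (simp add: G_def algebra_simps)
      then have "cmod (G x) = cmod (lam - V x) * (v x * h x)" using vh(1) by (metis abs_of_nonneg norm_mult norm_of_real)
      also have "... \<le> (cmod lam + cmod (V x)) * (cutoff R x)\<^sup>2"
        using vh norm_triangle_ineq4[of lam "V x"] by (intro mult_mono) auto
      finally show "cmod (G x) \<le> cmod lam * (cutoff R x)\<^sup>2 + cmod (V x) * (cutoff R x)\<^sup>2" by (simp add: algebra_simps)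
    qed
    finally have gB: "Re (grad_inner ?p ?p) - Re (grad_inner ?u ?F) < C"
      using abs_Re_le_cmod[of "grad_inner ?u ?F"] unfolding C_def by linarith
    have "((\<lambda>t. Re (grad_quot t ?p ?p) - Re (grad_quot t ?u ?F)) \<longlongrightarrow> Re (grad_inner ?p ?p) - Re (grad_inner ?u ?F)) (at_right 0)"
      by (intro tendsto_intros grad_quot_tendsto form_domD(1) p u F)
    from order_tendstoD(2)[OF this gB] obtain t0 where t0: "t0 > 0"
      "\<And>t. 0 < t \<Longrightarrow> t < t0 \<Longrightarrow> Re (grad_quot t ?p ?p) - Re (grad_quot t ?u ?F) < C"
      by (auto simp: eventually_at_right_field)
    \<comment> \<open>The integrand, in direction b, of t^2 times \<open>grad_quot\<close> of the
      cutoff minus that of v against h; Picone's identity makes it a square.\<close>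
    define Q where "Q t b x = (cutoff R (x + t *\<^sub>R b) - cutoff R x) * (cutoff R (x + t *\<^sub>R b) - cutoff R x)
       - (v (x + t *\<^sub>R b) - v x) * (h (x + t *\<^sub>R b) - h x)" for t b x
    have Q: "Q t b x = (cutoff R x * sqrt ((v (x + t *\<^sub>R b) + \<epsilon>) / (v x + \<epsilon>)) - cutoff R (x + t *\<^sub>R b) * sqrt ((v x + \<epsilon>) / (v (x + t *\<^sub>R b) + \<epsilon>)))\<^sup>2" for t b x
      using picone_identity[of "v x + \<epsilon>" "v (x + t *\<^sub>R b) + \<epsilon>" "cutoff R (x + t *\<^sub>R b)" "cutoff R x"] e v[of x] v[of "x + t *\<^sub>R b"]
      by (simp add: Q_def h_def power2_eq_square add_nonneg_pos)
    have Q0: "0 \<le> Q t b x" for t b x unfolding Q by simp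
    have LQ: "L2 (sdiff t b ?p)" "L2 (sdiff t b ?u)" "L2 (sdiff t b ?F)" for t b
      by (intro L2_sdiff form_domD(2) p u F)+
    have iQ: "integrable lebesgue (Q t b)"
      "(LINT x|lebesgue. Q t b x) = Re (L2_inner (sdiff t b ?p) (sdiff t b ?p)) - Re (L2_inner (sdiff t b ?u) (sdiff t b ?F))" for t b
      using integrable_mult_real[OF LQ(1)[of t b, unfolded sdiff_of_real] LQ(1)[of t b, unfolded sdiff_of_real]]
        integrable_mult_real[OF LQ(2)[of t b, unfolded sdiff_of_real] LQ(3)[of t b, unfolded sdiff_of_real]]
      unfolding Q_def[abs_def] sdiff_of_real L2_inner_of_real by simp_all
    have bound: "(LINT x|lebesgue. Q t b x) \<le> C * t\<^sup>2" if t: "0 < t" "t < t0" and b: "b \<in> Basis" for t b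
    proof -
      \<comment> \<open>Because every Q is nonnegative, one direction is bounded by the sum over all
        of them.\<close>
      have "(LINT x|lebesgue. Q t b x) \<le> (\<Sum>b\<in>Basis. LINT x|lebesgue. Q t b x)"
        by (rule member_le_sum[OF b]) (auto intro!: integral_nonneg_AE simp: Q0)
      also have "... = (Re (grad_quot t ?p ?p) - Re (grad_quot t ?u ?F)) * t\<^sup>2"
        using t(1) unfolding iQ(2) grad_quot_def
        by (simp add: sum_subtractf left_diff_distrib sum_distrib_right flip: of_real_power)
      also have "... \<le> C * t\<^sup>2" using t0(2)[OF t] by (intro mult_right_mono) auto
      finally show ?thesis .
    qed
    have ln: "(ln (v (x + t *\<^sub>R b) + \<epsilon>) - ln (v x + \<epsilon>))\<^sup>2 \<le> 4 * Q t b x" if "norm x \<le> R" "norm (x + t *\<^sub>R b) \<le> R" for t b x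
      unfolding Q cutoff_one[OF that(1)] cutoff_one[OF that(2)]
      using ln_diff_sq_le[of "v x + \<epsilon>" "v (x + t *\<^sub>R b) + \<epsilon>"] e v[of x] v[of "x + t *\<^sub>R b"] by (simp add: add_nonneg_pos)
    show "\<exists>t0>0. \<forall>t b. 0 < t \<and> t < t0 \<and> b \<in> Basis \<longrightarrow>
     (\<exists>Q. integrable lebesgue Q \<and> (LINT x|lebesgue. Q x) \<le> 4 * C * t\<^sup>2 \<and> (\<forall>x. 0 \<le> Q x) \<and>
       (\<forall>x. norm x \<le> R \<and> norm (x + t *\<^sub>R b) \<le> R \<longrightarrow> (ln (v (x + t *\<^sub>R b) + \<epsilon>) - ln (v x + \<epsilon>))\<^sup>2 \<le> Q x))"
    proof (intro exI[of _ t0] conjI allI impI t0(1))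
      fix t :: real and b :: 'a assume "0 < t \<and> t < t0 \<and> b \<in> Basis"
      then show "\<exists>Q. integrable lebesgue Q \<and> (LINT x|lebesgue. Q x) \<le> 4 * C * t\<^sup>2 \<and> (\<forall>x. 0 \<le> Q x) \<and>
       (\<forall>x. norm x \<le> R \<and> norm (x + t *\<^sub>R b) \<le> R \<longrightarrow> (ln (v (x + t *\<^sub>R b) + \<epsilon>) - ln (v x + \<epsilon>))\<^sup>2 \<le> Q x)"
        using iQ(1) bound[of t b] Q0 ln by (intro exI[of _ "\<lambda>x. 4 * Q t b x"]) auto
    qed
  qed
qed

text \<open>If v vanishes at one end of a segment of length H and is at least \<delta> at the other,
  ln (v + eps) changes along it by at least k for a suitable eps. Telescoping over small steps
  bounds k^2 times the measure of such starting points by C H^2, with C independent of k; letting k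
  grow makes the set null.\<close>

lemma zero_set_translation_invariant:
  assumes u: "(\<lambda>x. complex_of_real (v x)) \<in> form_dom V" and v: "\<And>x. 0 \<le> v x"
    and eq: "\<And>h. h \<in> form_dom V \<Longrightarrow> form_E V (\<lambda>x. complex_of_real (v x)) h = lam * L2_inner (\<lambda>x. complex_of_real (v x)) h"
    and b: "b \<in> Basis" and H: "H > 0"
  shows "AE x in lebesgue. v x = 0 \<longleftrightarrow> v (x + H *\<^sub>R b) = 0"
proof -
  have vm: "v \<in> borel_measurable lebesgue" by (rule borel_measurable_of_complex_of_real[OF form_domD(4)[OF u]])
  have vm': "(\<lambda>x. v (x + c)) \<in> borel_measurable lebesgue" for c by (rule borel_measurable_translate[OF vm])
  have "AE x in lebesgue. \<not> (x \<in> cball 0 \<rho> \<and> (v x = 0 \<and> v (x + H *\<^sub>R b) \<ge> \<delta> \<or> v (x + H *\<^sub>R b) = 0 \<and> v x \<ge> \<delta>))"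
    if d: "\<delta> > 0" for \<rho> \<delta>
  proof -
    define B where "B = {x \<in> cball 0 \<rho>. v x = 0 \<and> v (x + H *\<^sub>R b) \<ge> \<delta> \<or> v (x + H *\<^sub>R b) = 0 \<and> v x \<ge> \<delta>}"
    define B' where "B' = B \<inter> cball 0 \<rho>"
    define R where "R = \<rho> + H"
    obtain C where C: "\<And>\<epsilon>. \<epsilon> > 0 \<Longrightarrow> \<exists>t0>0. \<forall>t b. 0 < t \<and> t < t0 \<and> b \<in> Basis \<longrightarrow>
     (\<exists>Q. integrable lebesgue Q \<and> (LINT x|lebesgue. Q x) \<le> C * t\<^sup>2 \<and> (\<forall>x. 0 \<le> Q x) \<and>
       (\<forall>x. norm x \<le> R \<and> norm (x + t *\<^sub>R b) \<le> R \<longrightarrow> (ln (v (x + t *\<^sub>R b) + \<epsilon>) - ln (v x + \<epsilon>))\<^sup>2 \<le> Q x))"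
      using log_energy_bound[OF u v eq, of R] by metis
    have Bm: "B' \<in> sets lebesgue"
    proof -
      have "{x. v x = 0} \<in> sets lebesgue" "{x. v (x + H *\<^sub>R b) \<ge> \<delta>} \<in> sets lebesgue"
        "{x. v (x + H *\<^sub>R b) = 0} \<in> sets lebesgue" "{x. v x \<ge> \<delta>} \<in> sets lebesgue"
        using measurable_sets[OF vm, of "{0}"] measurable_sets[OF vm'[of "H *\<^sub>R b"], of "{\<delta>..}"]
          measurable_sets[OF vm'[of "H *\<^sub>R b"], of "{0}"] measurable_sets[OF vm, of "{\<delta>..}"]
        by (auto simp: vimage_def)
      moreover have "B' = cball 0 \<rho> \<inter> (({x. v x = 0} \<inter> {x. v (x + H *\<^sub>R b) \<ge> \<delta>}) \<union> ({x. v (x + H *\<^sub>R b) = 0} \<inter> {x. v x \<ge> \<delta>}))"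
        by (auto simp: B'_def B_def)
      ultimately show ?thesis by auto
    qed
    have Bf: "B' \<in> lmeasurable"
      by (rule fmeasurableI2[OF lmeasurable_cball[of 0 \<rho>] _ Bm]) (auto simp: B'_def)
    have main: "measure lebesgue B' * k\<^sup>2 \<le> C * H\<^sup>2" if k: "k > 0" for k :: real
    proof -
      \<comment> \<open>Chosen so that \<delta> + \<epsilon> = exp k \<epsilon>, which is a
        logarithmic change of k.\<close>
      define \<epsilon> where "\<epsilon> = \<delta> / (exp k - 1)"
      have e: "\<epsilon> > 0" using d k by (simp add: \<epsilon>_def)
      have "\<delta> / \<epsilon> + 1 = exp k" using d k by (simp add: \<epsilon>_def)
      then have ek: "\<delta> + \<epsilon> = exp k * \<epsilon>" using e by (simp add: field_simps)
      define w where "w x = ln (v x + \<epsilon>)" for x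
      obtain t0 where t0: "t0 > 0" and tQ: "\<And>t. 0 < t \<Longrightarrow> t < t0 \<Longrightarrow>
       (\<exists>Q. integrable lebesgue Q \<and> (LINT x|lebesgue. Q x) \<le> C * t\<^sup>2 \<and> (\<forall>x. 0 \<le> Q x) \<and>
         (\<forall>x. norm x \<le> R \<and> norm (x + t *\<^sub>R b) \<le> R \<longrightarrow> (w (x + t *\<^sub>R b) - w x)\<^sup>2 \<le> Q x))"
        using C[OF e] b unfolding w_def by metis
      \<comment> \<open>The step t = H / n must fall below t0, which depends on \<epsilon>. The
        number of steps drops out at the end, since n^2 C t^2 = C H^2.\<close>
      obtain n :: nat where n: "H / t0 < real n" using reals_Archimedean2 by blast
      have n0: "n > 0" using n H t0 by (cases n) (auto simp: divide_less_0_iff)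
      define t where "t = H / real n"
      have t: "0 < t" "t < t0" "real n * t = H" using n n0 H t0 by (auto simp: t_def field_simps)
      obtain Q where Q: "integrable lebesgue Q" "(LINT x|lebesgue. Q x) \<le> C * t\<^sup>2" "\<And>x. 0 \<le> Q x"
        "\<And>x. norm x \<le> R \<Longrightarrow> norm (x + t *\<^sub>R b) \<le> R \<Longrightarrow> (w (x + t *\<^sub>R b) - w x)\<^sup>2 \<le> Q x"
        using tQ[OF t(1,2)] by blast
      have pt: "k\<^sup>2 * indicat_real B' x \<le> real n * (\<Sum>i<n. Q (x + (real i * t) *\<^sub>R b))" for x
      proof (cases "x \<in> B'")
        case True
        then have x: "norm x \<le> \<rho>" and xc: "v x = 0 \<and> v (x + H *\<^sub>R b) \<ge> \<delta> \<or> v (x + H *\<^sub>R b) = 0 \<and> v x \<ge> \<delta>"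
          by (auto simp: B'_def B_def)
        have lnk: "ln (a + \<epsilon>) - ln \<epsilon> \<ge> k" if "a \<ge> \<delta>" for a
        proof -
          have "ln (exp k * \<epsilon>) \<le> ln (a + \<epsilon>)" using that ek d e by simp
          then show ?thesis using e by (simp add: ln_mult)
        qed
        have "k \<le> \<bar>w (x + H *\<^sub>R b) - w x\<bar>"
          using xc lnk[of "v x"] lnk[of "v (x + H *\<^sub>R b)"] by (auto simp: w_def)
        then have "k\<^sup>2 \<le> (w (x + H *\<^sub>R b) - w x)\<^sup>2" using k by (metis abs_le_square_iff abs_of_pos)
        also have "w (x + H *\<^sub>R b) - w x = (\<Sum>i<n. w (x + (real (Suc i) * t) *\<^sub>R b) - w (x + (real i * t) *\<^sub>R b))"
          by (subst sum_lessThan_telescope) (simp add: t(3))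
        also have "(...)\<^sup>2 \<le> real n * (\<Sum>i<n. (w (x + (real (Suc i) * t) *\<^sub>R b) - w (x + (real i * t) *\<^sub>R b))\<^sup>2)"
          by (rule square_sum_le)
        also have "... \<le> real n * (\<Sum>i<n. Q (x + (real i * t) *\<^sub>R b))"
        proof (intro mult_left_mono sum_mono)
          fix i assume "i \<in> {..<n}"
          have nb: "norm (x + (real j * t) *\<^sub>R b) \<le> R" if "j \<le> n" for j
          proof -
            have "real j * t \<le> real n * t" using that t(1) by (intro mult_right_mono) auto
            then have "norm ((real j * t) *\<^sub>R b) \<le> H" using t b by simp
            then show ?thesis using norm_triangle_ineq[of x "(real j * t) *\<^sub>R b"] x by (simp add: R_def)
          qed
          have s: "x + (real (Suc i) * t) *\<^sub>R b = (x + (real i * t) *\<^sub>R b) + t *\<^sub>R b" by (simp add: algebra_simps)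
          show "(w (x + (real (Suc i) * t) *\<^sub>R b) - w (x + (real i * t) *\<^sub>R b))\<^sup>2 \<le> Q (x + (real i * t) *\<^sub>R b)"
            unfolding s by (rule Q(4)) (use nb[of i] nb[of "Suc i"] \<open>i \<in> {..<n}\<close> in \<open>auto simp: s[symmetric] simp del: of_nat_Suc\<close>)
        qed simp
        finally show ?thesis using True by simp
      next
        case False
        then show ?thesis using Q(3) by (simp add: sum_nonneg)
      qed
      have iQ: "integrable lebesgue (\<lambda>x. Q (x + c))" "(LINT x|lebesgue. Q (x + c)) = (LINT x|lebesgue. Q x)" for c
        using integrable_translate[OF Q(1)] integral_translate[OF borel_measurable_integrable[OF Q(1)]] by auto
      have "(LINT x|lebesgue. k\<^sup>2 * indicat_real B' x) \<le> (LINT x|lebesgue. real n * (\<Sum>i<n. Q (x + (real i * t) *\<^sub>R b)))"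
        by (rule integral_mono) (use lmeasurable_integrable_indicator[OF Bf] iQ pt in auto)
      then have "measure lebesgue B' * k\<^sup>2 \<le> real n * (\<Sum>i<n. LINT x|lebesgue. Q (x + (real i * t) *\<^sub>R b))"
        using iQ(1) Bf by (simp add: fmeasurable_def mult.commute)
      also have "... = (real n)\<^sup>2 * (LINT x|lebesgue. Q x)" unfolding iQ(2) by (simp add: power2_eq_square)
      also have "... \<le> (real n)\<^sup>2 * (C * t\<^sup>2)" by (rule mult_left_mono[OF Q(2)]) simp
      also have "... = C * (real n * t)\<^sup>2" by (simp add: power_mult_distrib)
      finally show ?thesis unfolding t(3) .
    qed
    have "measure lebesgue B' = 0"
    proof (rule ccontr)
      assume "measure lebesgue B' \<noteq> 0"
      then have L: "measure lebesgue B' > 0" by (simp add: less_le)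
      have "0 \<le> C * H\<^sup>2" using main[of 1] L by simp
      define k where "k = C * H\<^sup>2 / measure lebesgue B' + 1"
      have k: "k \<ge> 1" using \<open>0 \<le> C * H\<^sup>2\<close> L by (simp add: k_def)
      have "measure lebesgue B' * k \<le> measure lebesgue B' * k\<^sup>2"
        using k L by (intro mult_left_mono) (auto simp: power2_eq_square)
      also have "... \<le> C * H\<^sup>2" by (rule main) (use k in simp)
      also have "... < measure lebesgue B' * k" using L by (simp add: k_def distrib_left)
      finally show False by simp
    qed
    then have "B' \<in> null_sets lebesgue"
      by (intro null_setsI[OF _ Bm]) (simp add: emeasure_eq_measure2[OF Bf])
    then have "AE x in lebesgue. x \<notin> B'" by (rule AE_not_in)
    then show ?thesis by eventually_elim (auto simp: B'_def B_def)
  qed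
  \<comment> \<open>Countably many radii m and thresholds 1 / (n + 1) exhaust all points and all
    positive values.\<close>
  then have "AE x in lebesgue. \<forall>m n::nat. \<not> (x \<in> cball 0 (real m) \<and>
     (v x = 0 \<and> v (x + H *\<^sub>R b) \<ge> 1 / real (Suc n) \<or> v (x + H *\<^sub>R b) = 0 \<and> v x \<ge> 1 / real (Suc n)))"
    by (simp only: AE_all_countable) simp
  then show ?thesis
  proof eventually_elim
    fix x assume *: "\<forall>m n::nat. \<not> (x \<in> cball 0 (real m) \<and>
     (v x = 0 \<and> v (x + H *\<^sub>R b) \<ge> 1 / real (Suc n) \<or> v (x + H *\<^sub>R b) = 0 \<and> v x \<ge> 1 / real (Suc n)))"
    obtain m :: nat where "norm x \<le> real m" using real_arch_simple by blast
    then have no: "\<not> (v x = 0 \<and> v (x + H *\<^sub>R b) \<ge> 1 / real (Suc n))" "\<not> (v (x + H *\<^sub>R b) = 0 \<and> v x \<ge> 1 / real (Suc n))" for n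
      using * by auto
    have pos: "\<exists>n. 1 / real (Suc n) \<le> a" if "a > 0" for a :: real
      using reals_Archimedean[OF that] by (auto simp: inverse_eq_divide intro: less_imp_le)
    show "v x = 0 \<longleftrightarrow> v (x + H *\<^sub>R b) = 0"
      using no pos[of "v x"] pos[of "v (x + H *\<^sub>R b)"] v[of x] v[of "x + H *\<^sub>R b"] by (metis less_eq_real_def)
  qed
qed

text \<open>Up to null sets the zero set is invariant under coordinate translations, hence under all
  translations, so a ball of zeros can be moved everywhere.\<close>

theorem strong_maximum_principle:
  assumes u: "(\<lambda>x. complex_of_real (v x)) \<in> form_dom V" and v: "\<And>x. 0 \<le> v x"
    and eq: "\<And>h. h \<in> form_dom V \<Longrightarrow> form_E V (\<lambda>x. complex_of_real (v x)) h = lam * L2_inner (\<lambda>x. complex_of_real (v x)) h"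
    and r: "r > 0" and zero: "AE x in lebesgue. x \<in> ball x0 r \<longrightarrow> v x = 0"
  shows "AE x in lebesgue. v x = 0"
proof -
  have coord: "AE x in lebesgue. v x = 0 \<longleftrightarrow> v (x + s *\<^sub>R b) = 0" if b: "b \<in> Basis" for s b
  proof -
    consider "s > 0" | "s = 0" | "s < 0" by linarith
    then show ?thesis
    proof cases
      case 1 then show ?thesis using zero_set_translation_invariant[OF u v eq b] by blast
    next
      case 3
      then have "AE x in lebesgue. v x = 0 \<longleftrightarrow> v (x + (- s) *\<^sub>R b) = 0"
        using zero_set_translation_invariant[OF u v eq b, of "- s"] by simp
      from AE_translate[OF this, of "s *\<^sub>R b"] have "AE x in lebesgue. v (x + s *\<^sub>R b) = 0 \<longleftrightarrow> v x = 0" by simp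
      then show ?thesis by eventually_elim blast
    qed simp
  qed
  have "AE x in lebesgue. v x = 0 \<longleftrightarrow> v (x + (\<Sum>b\<in>S. (y \<bullet> b) *\<^sub>R b)) = 0" if "finite S" "S \<subseteq> Basis" for S y
    using that
  proof (induction S)
    case (insert b S)
    then have "AE x in lebesgue. v x = 0 \<longleftrightarrow> v (x + (\<Sum>b\<in>S. (y \<bullet> b) *\<^sub>R b)) = 0" by simp
    moreover have "AE x in lebesgue. v (x + (\<Sum>b\<in>S. (y \<bullet> b) *\<^sub>R b)) = 0 \<longleftrightarrow> v (x + (\<Sum>b\<in>S. (y \<bullet> b) *\<^sub>R b) + (y \<bullet> b) *\<^sub>R b) = 0"
      using AE_translate[OF coord[of b "y \<bullet> b"], of "\<Sum>b\<in>S. (y \<bullet> b) *\<^sub>R b"] insert by simp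
    ultimately show ?case
      by eventually_elim (use insert in \<open>simp add: add.assoc add.commute[of "(y \<bullet> b) *\<^sub>R b"]\<close>)
  qed simp
  from this[OF finite_Basis order_refl] have inv: "AE x in lebesgue. v x = 0 \<longleftrightarrow> v (x + y) = 0" for y
    by (simp add: euclidean_representation)
  have balls: "AE x in lebesgue. x - y \<in> ball x0 r \<longrightarrow> v x = 0" for y
  proof -
    have "AE x in lebesgue. x \<in> ball x0 r \<longrightarrow> v (x + y) = 0" using zero inv[of y] by eventually_elim auto
    from AE_translate[OF this, of "- y"] show ?thesis by simp
  qed
  \<comment> \<open>The exceptional null set depends on the translation y, so only countably many
    translations may be combined; a dense set of them covers the space by balls.\<close>
  obtain D :: "'a set" where D: "countable D" "\<And>X. open X \<Longrightarrow> X \<noteq> {} \<Longrightarrow> \<exists>d\<in>D. d \<in> X"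
    using countable_dense_exists by blast
  have "AE x in lebesgue. \<forall>y\<in>D. x - y \<in> ball x0 r \<longrightarrow> v x = 0"
    by (subst AE_ball_countable[OF D(1)]) (use balls in blast)
  then show ?thesis
  proof eventually_elim
    fix x assume *: "\<forall>y\<in>D. x - y \<in> ball x0 r \<longrightarrow> v x = 0"
    obtain y where "y \<in> D" "y \<in> ball (x - x0) r" using D(2)[of "ball (x - x0) r"] r by auto
    then have "x - y \<in> ball x0 r" by (simp add: dist_norm norm_minus_commute algebra_simps)
    then show "v x = 0" using * \<open>y \<in> D\<close> by blast
  qed
qed

end

section \<open>Finiteness of the curvature at attained points\<close>

context schrodinger begin

lemma modulus_eigenfunction_vanishes:
  assumes f: "f \<in> form_dom V"
    and eq: "\<And>h. h \<in> form_dom V \<Longrightarrow> form_E V (\<lambda>x. complex_of_real (cmod (f x))) h = lam * L2_inner (\<lambda>x. complex_of_real (cmod (f x))) h"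
  shows "AE x in lebesgue. cmod (f x) = 0"
proof -
  let ?u = "\<lambda>x. complex_of_real (cmod (f x))"
  have u: "?u \<in> form_dom V" by (rule form_dom_modulus(1)[OF f])
  obtain x0 r \<sigma> where r: "r > 0" "\<And>x. x \<in> ball x0 r \<Longrightarrow> 0 < \<sigma> * (Im (V x) - Im lam)" using C1_sign[OF C1] by metis
  let ?b = "\<lambda>x. complex_of_real (bump x0 r x)"
  have b: "?b \<in> form_dom V" by (rule bump_form_dom)
  \<comment> \<open>Difference quotients of real functions are real, so the gradient term disappears
    from the imaginary part of the equation.\<close>
  have "grad_quot t ?u ?b = complex_of_real (Re (grad_quot t ?u ?b))" for t
    unfolding grad_quot_def sdiff_of_real L2_inner_of_real by (simp flip: of_real_sum of_real_power of_real_divide)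
  then have "Im (grad_quot t ?u ?b) = 0" for t by (metis Im_complex_of_real)
  then have "((\<lambda>t. 0) \<longlongrightarrow> Im (grad_inner ?u ?b)) (at_right (0::real))"
    using tendsto_Im[OF grad_quot_tendsto[OF form_domD(1)[OF u] form_domD(1)[OF b]]] by simp
  then have "Im (grad_inner ?u ?b) = 0" using tendsto_unique[OF trivial_limit_at_right_real _ tendsto_const] by blast
  then have "Im (potential_form V ?u ?b) = Im (lam * L2_inner ?u ?b)"
    using arg_cong[OF eq[OF b], of Im] by (simp add: form_E_eq)
  also have "... = Im lam * Re (L2_inner ?u ?b)" unfolding L2_inner_of_real by simp
  finally have "(LINT x|lebesgue. (Im (V x) - Im lam) * (cmod (f x) * bump x0 r x)) = 0"
    using integrable_Im_potential(2)[OF u b, of "Im lam"] by simp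
  then have "AE x in lebesgue. x \<in> ball x0 r \<longrightarrow> cmod (f x) = 0"
    by (rule vanishes_on_ball[OF integrable_Im_potential(1)[OF u b]]) (use r(2) in auto)
  then show ?thesis by (intro strong_maximum_principle[OF u _ eq r(1)]) auto
qed

theorem gamma_u_finite_Num:
  assumes lam: "lam \<in> frontier (Num V)" "lam \<in> Num V"
  shows "gamma_u (closure (Num V)) lam < \<infinity>"
proof (rule ccontr)
  assume inf: "\<not> gamma_u (closure (Num V)) lam < \<infinity>"
  have fr: "lam \<in> frontier (closure (Num V))" by (rule frontier_closure_Num[OF lam(1)])
  have lr: "lam \<in> form_range" using lam(2) Num_subset_form_range by blast
  obtain f where f: "f \<in> form_dom V" "L2_norm f = 1" "lam = form_E V f f" using lr by (rule form_range_E)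
  let ?u = "\<lambda>x. complex_of_real (cmod (f x))"
  note u = form_dom_modulus[OF f(1)]
  \<comment> \<open>The gradient energy lost in passing from f to |f|.\<close>
  define s where "s = Re (grad_inner f f) - Re (grad_inner ?u ?u)"
  have s: "s \<ge> 0" using u(4) by (simp add: s_def)
  have E: "form_E V ?u ?u = lam - complex_of_real s"
    unfolding f(3) form_E_self_real_parts u(2) s_def by simp
  have "lam - complex_of_real s \<in> form_range" using form_range_I[OF u(1)] u(3) f(2) unfolding E by simp
  \<comment> \<open>A positive s would give a boundary point with a horizontal segment of the
    closure on both sides of it, hence finite curvature.\<close>
  then have "s = 0"
    using gamma_u_finite_if_left[OF fr lr, of s] subsetD[OF form_range_subset_closure_Num] s inf by (metis less_eq_real_def)
  then have "form_E V ?u h = lam * L2_inner ?u h" if "h \<in> form_dom V" for h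
    using eigenfunction_if_infinite_curvature[OF fr inf u(1) _ _ that] u(3) f(2) E by simp
  then have "AE x in lebesgue. cmod (f x) = 0" by (rule modulus_eigenfunction_vanishes[OF f(1)])
  then have "AE x in lebesgue. (cmod (f x))\<^sup>2 = 0" by eventually_elim simp
  then have "(LINT x|lebesgue. (cmod (f x))\<^sup>2) = 0" by (rule integral_eq_zero_AE)
  then show False using f(2) by (simp add: L2_norm_def)
qed

end

theorem mainTheorem11:
  fixes V :: "'a::euclidean_space \<Rightarrow> complex"
  assumes "A1 V" and "A2 V" and "A3 V" and "C1 V"
  shows "(\<forall>lam \<in> frontier (Num V) \<inter> Num V. gamma_u (closure (Num V)) lam < \<infinity>)
       \<and> ((\<exists>lam \<in> frontier (Num V). gamma_u (closure (Num V)) lam = \<infinity>) \<longrightarrow> \<not> closed (Num V))"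
proof -
  interpret schrodinger V by standard (use assms in \<open>auto simp: A1_def\<close>)
  have fin: "gamma_u (closure (Num V)) lam < \<infinity>" if "lam \<in> frontier (Num V)" "lam \<in> Num V" for lam
    using that by (rule gamma_u_finite_Num)
  \<comment> \<open>A closed set contains its frontier, so a point of infinite curvature would be
    attained.\<close>
  moreover have "\<not> closed (Num V)" if "lam \<in> frontier (Num V)" "gamma_u (closure (Num V)) lam = \<infinity>" for lam
    using fin[OF that(1)] that frontier_subset_closed[of "Num V"] by auto
  ultimately show ?thesis by blast
qed

end
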